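(* For every tripartite quantum state $\rho\in\mathcal{S}_{\rm all}$ on $ABE$ and every operation $\mathcal{E}\in\Omega$, $$I_M(\rho)\ \geq\ I_M(\mathcal{E}(\rho)),$$ where $I_M(\rho):=I(A:B|E)_\rho$ is the conditional quantum mutual information.
   Context: All Hilbert spaces are finite-dimensional. A quantum operation is a linear completely positive trace-preserving (CPTP) map; its input and output Hilbert spaces may differ. Maps act as the identity on systems not mentioned. Three parties Alice, Bob and Eve hold systems $A$, $B$ and $E$ (each possibly composed of several subsystems). $\mathcal{S}_{\rm all}$ is the set of all density operators on $\mathcal{H}^A\otimes\mathcal{H}^B\otimes\mathcal{H}^E$, for arbitrary finite-dimensional spaces. $\Omega$ is the set of all operations that are compositions of operations from the following classes: - $\mathbb{L}_A$, $\mathbb{L}_B$: arbitrary local quantum operations by Alice on $A$, respectively by Bob on $B$. - $\mathbb{R}_E$: local reversible operations by Eve, i.e. quantum operations $\mathcal{V}$ on $E$ for which there is a quantum operation $\mathcal{V}^*$ on Eve's system such that $\mathcal{V}^*\circ\mathcal{V}$ is the identity on states on the input space of $\mathcal{V}$. - $\mathbb{P}_A$: broadcasting of a classical message by Alice. It maps a state $\sum_m p_m|m\rangle\langle m|^{C_A}\otimes\rho_m^{ABE}$, with $C_A$ a register held by Alice ($\{p_m\}$ a probability distribution, $\{|m\rangle\}$ orthonormal), to $\sum_m p_m|m\rangle\langle m|^{C_B}\otimes|m\rangle\langle m|^{C_E}\otimes\rho_m^{ABE}$, with registers $C_B$ held by Bob and $C_E$ held by Eve. - $\mathbb{P}_B$: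 the same with the roles of Alice and Bob exchanged. - $\mathbb{Q}_{AE}$, $\mathbb{Q}_{BE}$: quantum communication from Alice to Eve (resp. Bob to Eve), i.e. a subsystem $Q$ held by Alice (resp. Bob) becomes part of Eve's system. Conditional quantum mutual information: $I(A:B|E)_\rho:=S(AE)_\rho+S(BE)_\rho-S(ABE)_\rho-S(E)_\rho$, with $S$ the von Neumann entropy (base-2 logarithm); $A$, $B$, $E$ denote everything held by Alice, Bob and Eve, respectively, in the state under consideration. *)

theory Defs
  imports "Jordan_Normal_Form.Schur_Decomposition" Complex_Main
begin

type_synonym cmat = "complex mat"

section \<open>States\<close>

text \<open>The space \<open>\<complex>\<^sup>l \<otimes> \<complex>\<^sup>d \<otimes> \<complex>\<^sup>r\<close> is \<open>\<complex>\<^sup>(l*d*r)\<close> with the lexicographic (Kronecker) order on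
  the product basis: the basis vector \<open>|i\<rangle>|k\<rangle>|j\<rangle>\<close> has number \<open>(i * d + k) * r + j\<close>.\<close>

definition glue :: "nat \<Rightarrow> nat \<Rightarrow> nat \<Rightarrow> nat \<Rightarrow> nat \<Rightarrow> nat" where
  "glue d r i k j = (i * d + k) * r + j"

definition left_ix :: "nat \<Rightarrow> nat \<Rightarrow> nat \<Rightarrow> nat" where
  "left_ix d r x = x div (d * r)"

definition mid_ix :: "nat \<Rightarrow> nat \<Rightarrow> nat \<Rightarrow> nat" where
  "mid_ix d r x = x div r mod d"

definition right_ix :: "nat \<Rightarrow> nat \<Rightarrow> nat" where
  "right_ix r x = x mod r"

lemma glue_left_mid_right: "glue d r (left_ix d r x) (mid_ix d r x) (right_ix r x) = x"
proof -
  have "x div (d * r) = x div r div d"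
    by (metis div_mult2_eq mult.commute)
  then show ?thesis
    by (simp add: glue_def left_ix_def mid_ix_def right_ix_def)
qed

lemma left_mid_right_glue:
  assumes "k < d" "j < r"
  shows "left_ix d r (glue d r i k j) = i"
    and "mid_ix d r (glue d r i k j) = k"
    and "right_ix r (glue d r i k j) = j"
proof -
  have *: "((i * d + k) * r + j) div r = i * d + k"
    using assms by simp
  have "((i * d + k) * r + j) div (d * r) = ((i * d + k) * r + j) div r div d"
    by (metis div_mult2_eq mult.commute)
  then show "left_ix d r (glue d r i k j) = i"
    using assms * by (simp add: glue_def left_ix_def)
  show "mid_ix d r (glue d r i k j) = k"
    using assms * by (simp add: glue_def mid_ix_def)
  show "right_ix r (glue d r i k j) = j"
    using assms by (simp add: glue_def right_ix_def)
qed

definition mtrace :: "cmat \<Rightarrow> complex" where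
  "mtrace A = (\<Sum>i<dim_row A. A $$ (i, i))"

text \<open>With the order on the complex numbers used here, \<open>0 \<le> z\<close> says that \<open>z\<close> is real and
  nonnegative; over the complex field this makes \<open>A\<close> Hermitian.\<close>

definition psd :: "nat \<Rightarrow> cmat \<Rightarrow> bool" where
  "psd n A \<longleftrightarrow> A \<in> carrier_mat n n \<and> (\<forall>v\<in>carrier_vec n. 0 \<le> (A *\<^sub>v v) \<bullet>c v)"

definition density :: "nat \<Rightarrow> cmat \<Rightarrow> bool" where
  "density n \<rho> \<longleftrightarrow> psd n \<rho> \<and> mtrace \<rho> = 1"

text \<open>The dimensions of the systems of Alice, Bob and Eve, in this order.\<close>

type_synonym dims = "nat \<times> nat \<times> nat"

fun states :: "dims \<Rightarrow> cmat set" where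
  "states (a, b, e) = {\<rho>. density (a * b * e) \<rho>}"

section \<open>Entropy\<close>

text \<open>Functional calculus for the base-2 logarithm. By the spectral theorem a suitable \<open>B\<close> exists
  for every Hermitian \<open>A\<close>, and it does not depend on the chosen eigenbasis. Zero eigenvalues of
  \<open>A\<close> contribute nothing to \<open>A * mat_log2 A\<close>, in accordance with \<open>0 log 0 = 0\<close>.\<close>

definition mat_log2 :: "cmat \<Rightarrow> cmat" where
  "mat_log2 A = (SOME B. \<exists>U d. U \<in> carrier_mat (dim_row A) (dim_row A) \<and>
      mat_adjoint U * U = 1\<^sub>m (dim_row A) \<and>
      A = U * mat_diag (dim_row A) (\<lambda>i. complex_of_real (d i)) * mat_adjoint U \<and>
      B = U * mat_diag (dim_row A) (\<lambda>i. complex_of_real (log 2 (d i))) * mat_adjoint U)"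

definition vn_entropy :: "cmat \<Rightarrow> real" where
  "vn_entropy \<rho> = - Re (mtrace (\<rho> * mat_log2 \<rho>))"

text \<open>\<open>ptrace l d r\<close> traces out the middle factor of \<open>\<complex>\<^sup>l \<otimes> \<complex>\<^sup>d \<otimes> \<complex>\<^sup>r\<close>. An outer factor is traced
  out by taking \<open>l = 1\<close> or \<open>r = 1\<close>.\<close>

definition ptrace :: "nat \<Rightarrow> nat \<Rightarrow> nat \<Rightarrow> cmat \<Rightarrow> cmat" where
  "ptrace l d r X = mat (l * r) (l * r) (\<lambda>(x, y).
     \<Sum>k<d. X $$ (glue d r (x div r) k (x mod r), glue d r (y div r) k (y mod r)))"

fun I_M :: "dims \<Rightarrow> cmat \<Rightarrow> real" where
  "I_M (a, b, e) \<rho> =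
     vn_entropy (ptrace a b e \<rho>) + vn_entropy (ptrace 1 a (b * e) \<rho>)
       - vn_entropy \<rho> - vn_entropy (ptrace 1 (a * b) e \<rho>)"

section \<open>Quantum operations\<close>

text \<open>For a linear map \<open>\<Phi>\<close> from \<open>n \<times> n\<close> to \<open>m \<times> m\<close> matrices, \<open>amplify l n m r \<Phi>\<close> is
  \<open>id \<otimes> \<Phi> \<otimes> id\<close> on operators on \<open>\<complex>\<^sup>l \<otimes> \<complex>\<^sup>n \<otimes> \<complex>\<^sup>r\<close>: it applies \<open>\<Phi>\<close> to each \<open>n \<times> n\<close> block with
  fixed row and column indices in the outer factors.\<close>

definition amplify :: "nat \<Rightarrow> nat \<Rightarrow> nat \<Rightarrow> nat \<Rightarrow> (cmat \<Rightarrow> cmat) \<Rightarrow> cmat \<Rightarrow> cmat" where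
  "amplify l n m r \<Phi> X = mat (l * m * r) (l * m * r) (\<lambda>(x, y).
     \<Phi> (mat n n (\<lambda>(k, k').
          X $$ (glue n r (left_ix m r x) k (right_ix r x), glue n r (left_ix m r y) k' (right_ix r y))))
       $$ (mid_ix m r x, mid_ix m r y))"

definition linear_map_mat :: "nat \<Rightarrow> nat \<Rightarrow> (cmat \<Rightarrow> cmat) \<Rightarrow> bool" where
  "linear_map_mat n m \<Phi> \<longleftrightarrow>
     (\<forall>X\<in>carrier_mat n n. \<Phi> X \<in> carrier_mat m m) \<and>
     (\<forall>X\<in>carrier_mat n n. \<forall>Y\<in>carrier_mat n n. \<Phi> (X + Y) = \<Phi> X + \<Phi> Y) \<and>
     (\<forall>c. \<forall>X\<in>carrier_mat n n. \<Phi> (c \<cdot>\<^sub>m X) = c \<cdot>\<^sub>m \<Phi> X)"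

definition completely_positive :: "nat \<Rightarrow> nat \<Rightarrow> (cmat \<Rightarrow> cmat) \<Rightarrow> bool" where
  "completely_positive n m \<Phi> \<longleftrightarrow>
     (\<forall>k X. psd (k * n) X \<longrightarrow> psd (k * m) (amplify k n m 1 \<Phi> X))"

definition quantum_operation :: "nat \<Rightarrow> nat \<Rightarrow> (cmat \<Rightarrow> cmat) \<Rightarrow> bool" where
  "quantum_operation n m \<Phi> \<longleftrightarrow>
     linear_map_mat n m \<Phi> \<and> completely_positive n m \<Phi> \<and>
     (\<forall>X\<in>carrier_mat n n. mtrace (\<Phi> X) = mtrace X)"

definition reversible_operation :: "nat \<Rightarrow> nat \<Rightarrow> (cmat \<Rightarrow> cmat) \<Rightarrow> bool" where
  "reversible_operation n m V \<longleftrightarrow>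
     quantum_operation n m V \<and>
     (\<exists>V'. quantum_operation m n V' \<and> (\<forall>\<rho>. density n \<rho> \<longrightarrow> V' (V \<rho>) = \<rho>))"

section \<open>The class of operations\<close>

text \<open>An operation on tripartite states is represented by its graph, because broadcasting is only
  defined on states that are classical on the register which holds the message.\<close>

type_synonym operation = "(cmat \<times> cmat) set"

definition on_states :: "dims \<Rightarrow> (cmat \<Rightarrow> cmat) \<Rightarrow> operation" where
  "on_states D f = {(\<rho>, f \<rho>) | \<rho>. \<rho> \<in> states D}"

definition ket_bra :: "complex vec \<Rightarrow> cmat" where
  "ket_bra v = mat (dim_vec v) (dim_vec v) (\<lambda>(x, y). v $ x * cnj (v $ y))"

definition orthonormal :: "nat \<Rightarrow> nat \<Rightarrow> (nat \<Rightarrow> complex vec) \<Rightarrow> bool" where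
  "orthonormal c n v \<longleftrightarrow> (\<forall>i<n. v i \<in> carrier_vec c) \<and>
     (\<forall>i<n. \<forall>j<n. v i \<bullet>c v j = (if i = j then 1 else 0))"

text \<open>For \<open>X\<close> on \<open>\<complex>\<^sup>l \<otimes> \<complex>\<^sup>r\<close> and \<open>K\<close> on \<open>\<complex>\<^sup>d\<close>, the operator on \<open>\<complex>\<^sup>l \<otimes> \<complex>\<^sup>d \<otimes> \<complex>\<^sup>r\<close> that is the tensor
  product of \<open>X\<close> (on the outer factors) and \<open>K\<close> (on the middle one).\<close>

definition tensor_insert :: "nat \<Rightarrow> nat \<Rightarrow> nat \<Rightarrow> cmat \<Rightarrow> cmat \<Rightarrow> cmat" where
  "tensor_insert l d r K X = mat (l * d * r) (l * d * r) (\<lambda>(x, y).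
     K $$ (mid_ix d r x, mid_ix d r y) *
     X $$ (left_ix d r x * r + right_ix r x, left_ix d r y * r + right_ix r y))"

definition mixture :: "nat \<Rightarrow> nat \<Rightarrow> (nat \<Rightarrow> real) \<Rightarrow> (nat \<Rightarrow> cmat) \<Rightarrow> cmat" where
  "mixture N n p X = mat N N (\<lambda>(x, y). \<Sum>m<n. complex_of_real (p m) * X m $$ (x, y))"

definition ensemble :: "nat \<Rightarrow> nat \<Rightarrow> (nat \<Rightarrow> real) \<Rightarrow> (nat \<Rightarrow> cmat) \<Rightarrow> bool" where
  "ensemble N n p \<rho> \<longleftrightarrow> (\<forall>m<n. 0 \<le> p m) \<and> (\<Sum>m<n. p m) = 1 \<and> (\<forall>m<n. density N (\<rho> m))"

text \<open>The message registers, all copies of \<open>\<complex>\<^sup>c\<close> with the orthonormal message vectors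
  \<open>v 0, \<dots>, v (n - 1)\<close>, are placed in front of the other systems of their owner. Thus
  \<open>broadcast_A\<close> leads from \<open>(C\<^sub>A \<otimes> A) \<otimes> B \<otimes> E\<close> to \<open>A \<otimes> (C\<^sub>B \<otimes> B) \<otimes> (C\<^sub>E \<otimes> E)\<close>, and \<open>broadcast_B\<close>
  from \<open>A \<otimes> (C\<^sub>B \<otimes> B) \<otimes> E\<close> to \<open>(C\<^sub>A \<otimes> A) \<otimes> B \<otimes> (C\<^sub>E \<otimes> E)\<close>.\<close>

fun broadcast_A :: "nat \<Rightarrow> nat \<Rightarrow> (nat \<Rightarrow> complex vec) \<Rightarrow> dims \<Rightarrow> operation" where
  "broadcast_A c n v (a, b, e) =
     {(mixture (c * a * b * e) n p (\<lambda>m. tensor_insert 1 c (a * b * e) (ket_bra (v m)) (\<rho> m)),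
       mixture (a * (c * b) * (c * e)) n p (\<lambda>m.
         tensor_insert a c (b * (c * e)) (ket_bra (v m))
           (tensor_insert (a * b) c e (ket_bra (v m)) (\<rho> m))))
      | p \<rho>. ensemble (a * b * e) n p \<rho>}"

fun broadcast_B :: "nat \<Rightarrow> nat \<Rightarrow> (nat \<Rightarrow> complex vec) \<Rightarrow> dims \<Rightarrow> operation" where
  "broadcast_B c n v (a, b, e) =
     {(mixture (a * (c * b) * e) n p (\<lambda>m. tensor_insert a c (b * e) (ket_bra (v m)) (\<rho> m)),
       mixture (c * a * b * (c * e)) n p (\<lambda>m.
         tensor_insert 1 c (a * b * (c * e)) (ket_bra (v m))
           (tensor_insert (a * b) c e (ket_bra (v m)) (\<rho> m))))
      | p \<rho>. ensemble (a * b * e) n p \<rho>}"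

text \<open>Reordering of an operator on \<open>A \<otimes> Q \<otimes> B \<otimes> E\<close> into one on \<open>A \<otimes> B \<otimes> Q \<otimes> E\<close>; the arguments are
  the dimensions of \<open>Q\<close>, \<open>B\<close>, \<open>E\<close>, and the number of an output basis vector is turned into that
  of the corresponding input basis vector.\<close>

definition swap_ix :: "nat \<Rightarrow> nat \<Rightarrow> nat \<Rightarrow> nat \<Rightarrow> nat" where
  "swap_ix q b e x =
     (let i = x div (b * q * e); j = x div (q * e) mod b; k = x div e mod q; l = x mod e
      in ((i * q + k) * b + j) * e + l)"

definition move_past :: "nat \<Rightarrow> nat \<Rightarrow> nat \<Rightarrow> nat \<Rightarrow> cmat \<Rightarrow> cmat" where
  "move_past a q b e X = mat (a * b * (q * e)) (a * b * (q * e))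
     (\<lambda>(x, y). X $$ (swap_ix q b e x, swap_ix q b e y))"

text \<open>\<open>Omega D D' F\<close>: \<open>F\<close> is an operation in the class \<open>\<Omega>\<close> from states with dimensions \<open>D\<close> to states
  with dimensions \<open>D'\<close>. In \<open>send_B\<close>, where Bob's system is \<open>B \<otimes> Q\<close>, only the grouping
  \<open>A \<otimes> (B \<otimes> Q) \<otimes> E = A \<otimes> B \<otimes> (Q \<otimes> E)\<close> changes and the matrix stays the same.\<close>

inductive Omega :: "dims \<Rightarrow> dims \<Rightarrow> operation \<Rightarrow> bool" where
  local_A: "quantum_operation a a' \<Phi> \<Longrightarrow>
    Omega (a, b, e) (a', b, e) (on_states (a, b, e) (amplify 1 a a' (b * e) \<Phi>))"
| local_B: "quantum_operation b b' \<Phi> \<Longrightarrow>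
    Omega (a, b, e) (a, b', e) (on_states (a, b, e) (amplify a b b' e \<Phi>))"
| reversible_E: "reversible_operation e e' V \<Longrightarrow>
    Omega (a, b, e) (a, b, e') (on_states (a, b, e) (amplify (a * b) e e' 1 V))"
| public_A: "orthonormal c n v \<Longrightarrow>
    Omega (c * a, b, e) (a, c * b, c * e) (broadcast_A c n v (a, b, e))"
| public_B: "orthonormal c n v \<Longrightarrow>
    Omega (a, c * b, e) (c * a, b, c * e) (broadcast_B c n v (a, b, e))"
| send_A: "Omega (a * q, b, e) (a, b, q * e) (on_states (a * q, b, e) (move_past a q b e))"
| send_B: "Omega (a, b * q, e) (a, b, q * e) (on_states (a, b * q, e) (\<lambda>\<rho>. \<rho>))"
| compose: "Omega D D' F \<Longrightarrow> Omega D' D'' G \<Longrightarrow> Omega D D'' (F O G)"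

section \<open>Graphs of operations are graphs of functions\<close>

lemma orthonormal_coefficients_unique:
  assumes v: "orthonormal c n v" and k: "k < n"
    and eq: "\<And>x y. x < c \<Longrightarrow> y < c \<Longrightarrow>
      (\<Sum>m<n. v m $ x * cnj (v m $ y) * f m) = (\<Sum>m<n. v m $ x * cnj (v m $ y) * g m)"
  shows "f k = (g k :: complex)"
proof -
  have ip: "(\<Sum>x<c. v i $ x * cnj (v j $ x)) = (if i = j then 1 else 0)" if "i < n" "j < n" for i j
  proof -
    have "v i \<bullet>c v j = (\<Sum>x<c. v i $ x * cnj (v j $ x))"
      using v that unfolding orthonormal_def scalar_prod_def
      by (intro sum.cong) (auto simp: lessThan_atLeast0)
    then show ?thesis using v that unfolding orthonormal_def by metis
  qed
  have ex: "(\<Sum>x<c. \<Sum>y<c. cnj (v k $ x) * v k $ y * (\<Sum>m<n. v m $ x * cnj (v m $ y) * h m)) = h k"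
    for h :: "nat \<Rightarrow> complex"
  proof -
    have "(\<Sum>x<c. \<Sum>y<c. cnj (v k $ x) * v k $ y * (\<Sum>m<n. v m $ x * cnj (v m $ y) * h m))
      = (\<Sum>x<c. \<Sum>y<c. \<Sum>m<n. h m * (v m $ x * cnj (v k $ x)) * (v k $ y * cnj (v m $ y)))"
      by (simp add: sum_distrib_left mult_ac)
    also have "\<dots> = (\<Sum>x<c. \<Sum>m<n. \<Sum>y<c. h m * (v m $ x * cnj (v k $ x)) * (v k $ y * cnj (v m $ y)))"
      by (rule sum.cong[OF refl], rule sum.swap)
    also have "\<dots> = (\<Sum>m<n. \<Sum>x<c. \<Sum>y<c. h m * (v m $ x * cnj (v k $ x)) * (v k $ y * cnj (v m $ y)))"
      by (rule sum.swap)
    also have "\<dots> = (\<Sum>m<n. h m * (\<Sum>x<c. v m $ x * cnj (v k $ x)) * (\<Sum>y<c. v k $ y * cnj (v m $ y)))"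
      by (simp add: sum_distrib_left sum_distrib_right mult_ac)
    also have "\<dots> = (\<Sum>m<n. if m = k then h m else 0)"
      using k by (intro sum.cong) (auto simp: ip)
    also have "\<dots> = h k" using k by simp
    finally show ?thesis .
  qed
  have "f k = (\<Sum>x<c. \<Sum>y<c. cnj (v k $ x) * v k $ y * (\<Sum>m<n. v m $ x * cnj (v m $ y) * f m))"
    by (rule ex[symmetric])
  also have "\<dots> = (\<Sum>x<c. \<Sum>y<c. cnj (v k $ x) * v k $ y * (\<Sum>m<n. v m $ x * cnj (v m $ y) * g m))"
    by (intro sum.cong refl) (simp add: eq)
  also have "\<dots> = g k" by (rule ex)
  finally show ?thesis .
qed

lemma pair_index_less:
  assumes "i < l" "k < d" shows "i * d + k < l * (d :: nat)"
proof -
  have "i * d + k < Suc i * d" using assms by simp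
  also have "\<dots> \<le> l * d" using assms by (intro mult_le_mono1) simp
  finally show ?thesis .
qed

lemma glue_less: 
  assumes "i < l" "k < d" "j < r" shows "glue d r i k j < l * d * (r::nat)"
  using assms unfolding glue_def by (intro pair_index_less)

lemma mixture_tensor_insert_unique:
  assumes v: "orthonormal c n v"
    and eq: "mixture N n p (\<lambda>m. tensor_insert l c r (ket_bra (v m)) (\<rho> m)) =
      mixture N n p' (\<lambda>m. tensor_insert l c r (ket_bra (v m)) (\<rho>' m))"
    and N: "N = l * c * r" and m: "m < n" and xy: "x < l * r" "y < l * r"
  shows "complex_of_real (p m) * \<rho> m $$ (x, y) = complex_of_real (p' m) * \<rho>' m $$ (x, y)"
proof (rule orthonormal_coefficients_unique[OF v m])
  fix s t assume st: "s < c" "t < c"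
  have r: "x mod r < r" "y mod r < r" "x div r < l" "y div r < l"
    using xy by (auto simp: less_mult_imp_div_less intro!: mod_less_divisor gr0I)
  let ?a = "glue c r (x div r) s (x mod r)" and ?b = "glue c r (y div r) t (y mod r)"
  have ab: "?a < N" "?b < N" using r st glue_less N by auto
  have dim: "dim_vec (v i) = c" if "i < n" for i using v that by (auto simp: orthonormal_def)
  have e: "mixture N n q (\<lambda>m. tensor_insert l c r (ket_bra (v m)) (\<tau> m)) $$ (?a, ?b)
      = (\<Sum>m<n. v m $ s * cnj (v m $ t) * (complex_of_real (q m) * \<tau> m $$ (x, y)))" for q \<tau>
    using ab r st
    by (auto simp: mixture_def tensor_insert_def N left_mid_right_glue ket_bra_def dim
        mult_ac intro!: sum.cong)
  show "(\<Sum>m<n. v m $ s * cnj (v m $ t) * (complex_of_real (p m) * \<rho> m $$ (x, y)))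
      = (\<Sum>m<n. v m $ s * cnj (v m $ t) * (complex_of_real (p' m) * \<rho>' m $$ (x, y)))"
    using e[of p \<rho>] e[of p' \<rho>'] eq by simp
qed

lemma mixture_insert_twice_cong:
  assumes "\<And>m x y. m < n \<Longrightarrow> x < M \<Longrightarrow> y < M \<Longrightarrow>
      complex_of_real (p m) * \<rho> m $$ (x, y) = complex_of_real (p' m) * \<rho>' m $$ (x, y)"
    and M: "M = l' * r'" and N: "N = l * c * r" and lr: "l * r = l' * c * r'"
  shows "mixture N n p (\<lambda>m. tensor_insert l c r (K m) (tensor_insert l' c r' (K m) (\<rho> m))) =
    mixture N n p' (\<lambda>m. tensor_insert l c r (K m) (tensor_insert l' c r' (K m) (\<rho>' m)))"
proof -
  have dec: "left_ix d s x * s + right_ix s x < l * s" if "x < l * d * s" for l d s x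
  proof -
    have "x < l * (d * s)" using that by (simp add: mult.assoc)
    then have "x div (d * s) < l" by (rule less_mult_imp_div_less)
    moreover have "x mod s < s" using that by (intro mod_less_divisor gr0I) auto
    ultimately show ?thesis unfolding left_ix_def right_ix_def
      by (rule pair_index_less)
  qed
  show ?thesis
    unfolding mixture_def
  proof (intro cong_mat refl, clarsimp, intro sum.cong refl)
    fix x y m assume x: "x < N" and y: "y < N" and m: "m \<in> {..<n}"
    note dx = dec[of x l c r] and dy = dec[of y l c r]
    note ax = assms(1)[OF _ dec[of _ l' c r', folded M] dec[of _ l' c r', folded M]]
    show "complex_of_real (p m) * tensor_insert l c r (K m) (tensor_insert l' c r' (K m) (\<rho> m)) $$ (x, y) =
        complex_of_real (p' m) * tensor_insert l c r (K m) (tensor_insert l' c r' (K m) (\<rho>' m)) $$ (x, y)"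
      using x y m dx dy ax[of m "left_ix c r x * r + right_ix r x" "left_ix c r y * r + right_ix r y"]
      by (simp add: tensor_insert_def N lr mult.left_commute)
  qed
qed

lemma Omega_single_valued: "Omega D D' F \<Longrightarrow> single_valued F"
proof (induction rule: Omega.induct)
  case (public_A c n v a b e)
  show ?case
    unfolding single_valued_def
    by (clarsimp, rule mixture_insert_twice_cong[where M = "a * b * e"],
       rule mixture_tensor_insert_unique[OF public_A, where l = 1 and r = "a * b * e"])
      (auto simp: mult_ac)
next
  case (public_B c n v a b e)
  show ?case
    unfolding single_valued_def
    by (clarsimp, rule mixture_insert_twice_cong[where M = "a * b * e"],
       rule mixture_tensor_insert_unique[OF public_B, where l = a and r = "b * e"])
      (auto simp: mult_ac)
next
  case (compose D D' F D'' G)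
  then show ?case by (blast intro: single_valued_relcomp)
qed (auto simp: single_valued_def on_states_def)

end

theory Submission
  imports Defs
begin

text \<open>
  Every claim reduces to the monotonicity of the conditional entropy \<open>S(B|X)\<close> under channels on \<open>X\<close>.
  As \<open>- S(B|X)\<close> is the relative entropy of the state with respect to \<open>1 \<otimes> \<rho>\<^sub>X\<close>, this is the data
  processing inequality. With eigenvalues \<open>p\<^sub>k\<close>, \<open>q\<^sub>l\<close> and squared overlaps \<open>c\<^sub>k\<^sub>l\<close> of the eigenvectors of
  \<open>\<rho>\<close> and \<open>\<sigma>\<close>, the resolvent form \<open>F(t) = \<Sum> c\<^sub>k\<^sub>l p\<^sub>k\<^sup>2 / (q\<^sub>l + t p\<^sub>k)\<close> is the maximum over \<open>Y\<close> of
  \<open>2 Re tr(\<rho> Y\<^sup>*) - tr(Y\<^sup>* \<sigma> Y) - t tr(Y \<rho> Y\<^sup>*)\<close>. Pulling an optimal \<open>Y\<close> of the output states back through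
  the dual of the channel, the Kadison-Schwarz inequality shows that \<open>F\<close> decreases under channels.
  Integrating over \<open>0 \<le> t \<le> T\<close> and letting \<open>T\<close> tend to infinity turns this into the inequality of the
  relative entropies \<open>\<Sum> c\<^sub>k\<^sub>l p\<^sub>k (ln p\<^sub>k - ln q\<^sub>l)\<close>.

  Local operations of Alice and Bob act on the conditioning system of one of the two conditional
  entropies whose difference is \<open>I(A:B|E)\<close>; a reversible operation of Eve leaves both unchanged.
  Sending a system to Eve is discarding it in one of them, and a broadcast replaces the entropy
  conditioned on an average state by the average of the conditional entropies.
\<close>

section \<open>Vectors and expansions over finite index sets\<close>

text \<open>The scalar source of the resolvent form is that \<open>p^2 / (q + t p)\<close> is the
  derivative in \<open>t\<close> of \<open>p ln (q + t p)\<close>: integrated up to \<open>T\<close>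
  it gives \<open>p (ln (q + T p) - ln q)\<close>, and removing \<open>p ln T\<close> leaves
  \<open>p (ln p - ln q)\<close> in the limit. The divergent part carries the total weight, which is
  the trace, so it cancels between the input and the output of a channel. The maximum has its value
  because the coordinates \<open>y_kl = <Y u_k, w_l>\<close> decouple: each pair
  \<open>(k, l)\<close> contributes one scalar quadratic, and completing the square gives its term
  of \<open>F\<close>. Comparing trial operators avoids inverses and logarithms of matrices; only
  eigenvalues and overlaps occur. The delicate point is the kernel of \<open>sigma\<close>. With
  \<open>ln 0 = 0\<close> and \<open>x / 0 = 0\<close> the sums have the intended meaning only if
  \<open>c_kl p_k = 0\<close> whenever \<open>q_l = 0\<close>. For
  \<open>sigma = 1 \<otimes> rho_X\<close> this holds automatically, so infinite relative entropies
  never arise.\<close>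

text \<open>Operators are functions of two indices from a finite set instead of matrices, so that regrouping
  and reordering tensor factors is a mere bijection of index sets.\<close>

definition ip :: "'i set \<Rightarrow> ('i \<Rightarrow> complex) \<Rightarrow> ('i \<Rightarrow> complex) \<Rightarrow> complex" where
  "ip I x y = (\<Sum>i\<in>I. x i * cnj (y i))"

definition mv :: "'i set \<Rightarrow> ('j \<Rightarrow> 'i \<Rightarrow> complex) \<Rightarrow> ('i \<Rightarrow> complex) \<Rightarrow> 'j \<Rightarrow> complex" where
  "mv I Y x = (\<lambda>j. \<Sum>i\<in>I. Y j i * x i)"

definition adj :: "('j \<Rightarrow> 'i \<Rightarrow> complex) \<Rightarrow> 'i \<Rightarrow> 'j \<Rightarrow> complex" where
  "adj Y = (\<lambda>i j. cnj (Y j i))"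

definition sqnorm :: "'i set \<Rightarrow> ('i \<Rightarrow> complex) \<Rightarrow> real" where
  "sqnorm I x = (\<Sum>i\<in>I. (cmod (x i))\<^sup>2)"

definition ortho :: "'i set \<Rightarrow> 'k set \<Rightarrow> ('k \<Rightarrow> 'i \<Rightarrow> complex) \<Rightarrow> bool" where
  "ortho I K u \<longleftrightarrow> (\<forall>k\<in>K. \<forall>l\<in>K. ip I (u k) (u l) = (if k = l then 1 else 0))"

text \<open>The completeness relation alone, kept apart from \<open>ortho\<close>: Parseval's
  identity rests on this property, Bessel's inequality on the other.\<close>

definition spanning :: "'i set \<Rightarrow> 'k set \<Rightarrow> ('k \<Rightarrow> 'i \<Rightarrow> complex) \<Rightarrow> bool" where
  "spanning I K u \<longleftrightarrow> (\<forall>i\<in>I. \<forall>j\<in>I. (\<Sum>k\<in>K. u k i * cnj (u k j)) = (if i = j then 1 else 0))"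

text \<open>A weighted sum of rank-one operators. Orthonormality is left out on purpose, so that the
  images of eigenvectors under Kraus operators again form an expansion.\<close>

definition expands :: "'i set \<Rightarrow> 'k set \<Rightarrow> ('k \<Rightarrow> 'i \<Rightarrow> complex) \<Rightarrow> ('k \<Rightarrow> real) \<Rightarrow>
    ('i \<Rightarrow> 'i \<Rightarrow> complex) \<Rightarrow> bool" where
  "expands I K u p X \<longleftrightarrow>
    (\<forall>i\<in>I. \<forall>j\<in>I. X i j = (\<Sum>k\<in>K. complex_of_real (p k) * u k i * cnj (u k j)))"

lemma ip_self: "ip I x x = complex_of_real (sqnorm I x)"
  by (simp add: ip_def sqnorm_def complex_norm_square[symmetric])

lemma ip_cnj: "cnj (ip I x y) = ip I y x"
  by (simp add: ip_def mult.commute)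

lemma ip_adj: "ip J (mv I Y x) z = ip I x (mv J (adj Y) z)"
proof -
  have "ip J (mv I Y x) z = (\<Sum>j\<in>J. \<Sum>i\<in>I. Y j i * x i * cnj (z j))"
    by (simp add: ip_def mv_def sum_distrib_right)
  also have "\<dots> = (\<Sum>i\<in>I. \<Sum>j\<in>J. Y j i * x i * cnj (z j))"
    by (rule sum.swap)
  finally show ?thesis
    by (simp add: ip_def mv_def adj_def sum_distrib_left mult_ac)
qed

lemma sqnorm_nonneg: "0 \<le> sqnorm I x"
  by (simp add: sqnorm_def sum_nonneg)

section \<open>Parseval, Bessel and sums over eigenvalues\<close>

lemma parseval:
  assumes "finite I" "spanning I K u"
  shows "(\<Sum>k\<in>K. ip I x (u k) * cnj (ip I y (u k))) = ip I x y"
proof -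
  have "(\<Sum>k\<in>K. ip I x (u k) * cnj (ip I y (u k)))
      = (\<Sum>k\<in>K. \<Sum>i\<in>I. \<Sum>j\<in>I. x i * cnj (y j) * (u k j * cnj (u k i)))"
    by (simp add: ip_def sum_product mult_ac)
  also have "\<dots> = (\<Sum>i\<in>I. \<Sum>k\<in>K. \<Sum>j\<in>I. x i * cnj (y j) * (u k j * cnj (u k i)))"
    by (rule sum.swap)
  also have "\<dots> = (\<Sum>i\<in>I. \<Sum>j\<in>I. \<Sum>k\<in>K. x i * cnj (y j) * (u k j * cnj (u k i)))"
    by (intro sum.cong refl, rule sum.swap)
  also have "\<dots> = (\<Sum>i\<in>I. \<Sum>j\<in>I. x i * cnj (y j) * (\<Sum>k\<in>K. u k j * cnj (u k i)))"
    by (simp add: sum_distrib_left)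
  also have "\<dots> = (\<Sum>i\<in>I. \<Sum>j\<in>I. if j = i then x i * cnj (y j) else 0)"
    using assms(2) by (intro sum.cong refl) (simp add: spanning_def)
  also have "\<dots> = ip I x y"
    using assms(1) by (simp add: ip_def)
  finally show ?thesis .
qed

lemma parseval_sqnorm:
  assumes "finite I" "spanning I K u"
  shows "(\<Sum>k\<in>K. (cmod (ip I x (u k)))\<^sup>2) = sqnorm I x"
proof -
  have "complex_of_real (\<Sum>k\<in>K. (cmod (ip I x (u k)))\<^sup>2) = complex_of_real (sqnorm I x)"
    using parseval[OF assms, of x x] by (simp add: complex_norm_square[symmetric] ip_self)
  then show ?thesis using of_real_eq_iff by blast
qed

lemma bessel:
  assumes K: "finite K" and o: "ortho I K v"
  shows "(\<Sum>k\<in>K. (cmod (ip I x (v k)))\<^sup>2) \<le> sqnorm I x"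
proof -
  define c where "c k = ip I x (v k)" for k
  \<comment> \<open>The projection of \<open>x\<close> onto the span of the \<open>v k\<close>. The
    residual \<open>x - y\<close> has squared norm \<open>sqnorm I x - S\<close>, which cannot be
    negative.\<close>
  define y where "y i = (\<Sum>k\<in>K. c k * v k i)" for i
  define S where "S = (\<Sum>k\<in>K. (cmod (c k))\<^sup>2)"
  have yv: "ip I y (v l) = c l" if l: "l \<in> K" for l
  proof -
    have "ip I y (v l) = (\<Sum>i\<in>I. \<Sum>k\<in>K. c k * (v k i * cnj (v l i)))"
      by (simp add: ip_def y_def sum_distrib_right sum_distrib_left mult_ac)
    also have "\<dots> = (\<Sum>k\<in>K. c k * ip I (v k) (v l))"
      by (subst sum.swap) (simp add: ip_def sum_distrib_left)
    also have "\<dots> = (\<Sum>k\<in>K. if k = l then c k else 0)"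
      using o l by (intro sum.cong refl) (simp add: ortho_def)
    finally show ?thesis using K l by simp
  qed
  have zy: "ip I z y = (\<Sum>k\<in>K. ip I z (v k) * cnj (c k))" for z
  proof -
    have "ip I z y = (\<Sum>i\<in>I. \<Sum>k\<in>K. z i * cnj (v k i) * cnj (c k))"
      by (simp add: ip_def y_def sum_distrib_left mult_ac)
    also have "\<dots> = (\<Sum>k\<in>K. \<Sum>i\<in>I. z i * cnj (v k i) * cnj (c k))" by (rule sum.swap)
    finally show ?thesis by (simp add: ip_def sum_distrib_right)
  qed
  have xy: "ip I x y = complex_of_real S" and yy: "ip I y y = complex_of_real S"
    by (simp_all add: zy yv c_def[symmetric] S_def complex_norm_square[symmetric])
  have "ip I (\<lambda>i. x i - y i) (\<lambda>i. x i - y i) = ip I x x - ip I x y - cnj (ip I x y) + ip I y y"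
    by (simp add: ip_def algebra_simps sum.distrib sum_subtractf)
  also have "\<dots> = complex_of_real (sqnorm I x - S)"
    unfolding xy yy by (simp add: ip_self)
  finally have "sqnorm I (\<lambda>i. x i - y i) = sqnorm I x - S"
    unfolding ip_self using of_real_eq_iff by blast
  then show ?thesis using sqnorm_nonneg[of I "\<lambda>i. x i - y i"] by (simp add: S_def c_def)
qed

lemma expands_mv:
  assumes "expands I K u p X" "i \<in> I"
  shows "mv I X z i = (\<Sum>k\<in>K. complex_of_real (p k) * ip I z (u k) * u k i)"
proof -
  have "mv I X z i = (\<Sum>j\<in>I. \<Sum>k\<in>K. complex_of_real (p k) * (z j * cnj (u k j)) * u k i)"
    unfolding mv_def using assms by (intro sum.cong refl) (simp add: expands_def sum_distrib_right sum_distrib_left mult_ac)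
  also have "\<dots> = (\<Sum>k\<in>K. \<Sum>j\<in>I. complex_of_real (p k) * (z j * cnj (u k j)) * u k i)"
    by (rule sum.swap)
  finally show ?thesis by (simp add: ip_def sum_distrib_left sum_distrib_right mult_ac)
qed

lemma ip_expands:
  assumes "expands I K u p X"
  shows "ip I (mv I X x) y = (\<Sum>k\<in>K. complex_of_real (p k) * ip I x (u k) * ip I (u k) y)"
proof -
  have "ip I (mv I X x) y = (\<Sum>i\<in>I. \<Sum>k\<in>K. complex_of_real (p k) * ip I x (u k) * (u k i * cnj (y i)))"
    unfolding ip_def[of I "mv I X x"] using assms
    by (intro sum.cong refl) (simp add: expands_mv sum_distrib_right sum_distrib_left mult_ac)
  also have "\<dots> = (\<Sum>k\<in>K. \<Sum>i\<in>I. complex_of_real (p k) * ip I x (u k) * (u k i * cnj (y i)))"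
    by (rule sum.swap)
  finally show ?thesis by (simp add: ip_def[of I "u _" y] sum_distrib_left)
qed

text \<open>The eigenvector equation in weak form: functions are controlled only on
  \<open>I\<close>, and the inner product with \<open>y\<close> ignores all other values.\<close>

lemma expands_eigen:
  assumes K: "finite K" and "ortho I K u" "expands I K u p X" "k \<in> K"
  shows "ip I (mv I X (u k)) y = complex_of_real (p k) * ip I (u k) y"
proof -
  have "ip I (mv I X (u k)) y = (\<Sum>l\<in>K. if l = k then complex_of_real (p k) * ip I (u k) y else 0)"
    unfolding ip_expands[OF assms(3)] using assms(2,4)
    by (intro sum.cong refl) (auto simp: ortho_def)
  then show ?thesis using K assms(4) by simp
qed

lemma expands_hermitian:
  assumes "expands I K u p X"
  shows "ip I (mv I X x) y = cnj (ip I (mv I X y) x)"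
  by (simp add: ip_expands[OF assms] ip_cnj mult_ac)

text \<open>Overlaps vanish between eigenvectors to different eigenvalues, which makes the sum of any function
  of the eigenvalues independent of the eigenvectors; since \<open>\<eta> 0 = 0\<close>, the second family may miss
  part of the kernel.\<close>

lemma expansion_sum_unique:
  fixes \<eta> :: "real \<Rightarrow> real"
  assumes fin: "finite I" "finite K" "finite L"
    and u: "ortho I K u" "spanning I K u" "expands I K u p X"
    and w: "ortho I L w" "expands I L w q X"
    and "\<eta> 0 = 0"
  shows "(\<Sum>l\<in>L. \<eta> (q l)) = (\<Sum>k\<in>K. \<eta> (p k))"
proof -
  define c where "c k l = (cmod (ip I (u k) (w l)))\<^sup>2" for k l
  have eq: "p k = q l \<or> c k l = 0" if "k \<in> K" "l \<in> L" for k l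
  proof -
    have "complex_of_real (p k) * ip I (u k) (w l) = ip I (mv I X (u k)) (w l)"
      using expands_eigen[OF fin(2) u(1,3) that(1)] by simp
    also have "\<dots> = complex_of_real (q l) * ip I (u k) (w l)"
      using expands_hermitian[OF w(2), of "u k" "w l"] expands_eigen[OF fin(3) w that(2)] by (simp add: ip_cnj)
    finally show ?thesis by (auto simp: c_def)
  qed
  have wn: "(\<Sum>k\<in>K. c k l) = 1" if "l \<in> L" for l
  proof -
    have "cmod (ip I (w l) (u k)) = cmod (ip I (u k) (w l))" for k
      using complex_mod_cnj[of "ip I (w l) (u k)"] by (simp add: ip_cnj)
    then have "(\<Sum>k\<in>K. c k l) = sqnorm I (w l)"
      using parseval_sqnorm[OF fin(1) u(2), of "w l"] by (simp add: c_def)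
    moreover have "complex_of_real (sqnorm I (w l)) = 1"
      using w(1) that by (simp add: ip_self[symmetric] ortho_def)
    ultimately show ?thesis by simp
  qed
  \<comment> \<open>For \<open>p k \<noteq> 0\<close> the value \<open>p k = <X u_k, u_k>\<close> is
    an average of the \<open>q l\<close> that agree with \<open>p k\<close>, so the weights sum to
    one. For \<open>p k = 0\<close> the sum may be smaller, and \<open>\<eta> 0 = 0\<close> hides
    the deficit.\<close>
  have un: "\<eta> (p k) * (\<Sum>l\<in>L. c k l) = \<eta> (p k)" if k: "k \<in> K" for k
  proof (cases "p k = 0")
    case False
    have "complex_of_real (p k) = ip I (mv I X (u k)) (u k)"
      using expands_eigen[OF fin(2) u(1,3) k] u(1) k by (simp add: ortho_def)
    also have "\<dots> = (\<Sum>l\<in>L. complex_of_real (q l * c k l))"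
      unfolding ip_expands[OF w(2)] c_def
      by (intro sum.cong refl) (simp add: ip_cnj[of I "u k", symmetric] complex_norm_square mult_ac del: of_real_power)
    finally have "complex_of_real (p k) = complex_of_real (\<Sum>l\<in>L. q l * c k l)" by simp
    then have "p k = (\<Sum>l\<in>L. q l * c k l)" using of_real_eq_iff by blast
    also have "\<dots> = (\<Sum>l\<in>L. p k * c k l)" using eq[OF k] by (intro sum.cong refl) fastforce
    also have "\<dots> = p k * (\<Sum>l\<in>L. c k l)" by (simp add: sum_distrib_left)
    finally show ?thesis using False by simp
  qed (simp add: assms)
  have "(\<Sum>l\<in>L. \<eta> (q l)) = (\<Sum>l\<in>L. \<Sum>k\<in>K. \<eta> (q l) * c k l)"
    by (simp add: sum_distrib_left[symmetric] wn)
  also have "\<dots> = (\<Sum>l\<in>L. \<Sum>k\<in>K. \<eta> (p k) * c k l)"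
    using eq by (intro sum.cong refl) fastforce
  also have "\<dots> = (\<Sum>k\<in>K. \<eta> (p k) * (\<Sum>l\<in>L. c k l))"
    by (subst sum.swap) (simp add: sum_distrib_left)
  also have "\<dots> = (\<Sum>k\<in>K. \<eta> (p k))" by (simp add: un)
  finally show ?thesis .
qed

section \<open>Resolvent forms and Kraus maps\<close>

definition overlap :: "'i set \<Rightarrow> ('k \<Rightarrow> 'i \<Rightarrow> complex) \<Rightarrow> ('l \<Rightarrow> 'i \<Rightarrow> complex) \<Rightarrow> 'k \<Rightarrow> 'l \<Rightarrow> real" where
  "overlap I u w k l = (cmod (ip I (u k) (w l)))\<^sup>2"

text \<open>In the Hilbert-Schmidt product this is \<open><rho, (L + t R)^(-1) rho>\<close>, with
  \<open>L\<close> the left multiplication by \<open>sigma\<close> and \<open>R\<close> the right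
  multiplication by \<open>rho\<close>, written in their joint eigenbasis \<open>|w_l><u_k|\<close>.
  A vanishing denominator counts as a zero term.\<close>

definition resolvent_form ::
    "'i set \<Rightarrow> 'k set \<Rightarrow> ('k \<Rightarrow> 'i \<Rightarrow> complex) \<Rightarrow> ('k \<Rightarrow> real) \<Rightarrow>
     'l set \<Rightarrow> ('l \<Rightarrow> 'i \<Rightarrow> complex) \<Rightarrow> ('l \<Rightarrow> real) \<Rightarrow> real \<Rightarrow> real" where
  "resolvent_form I K u p L w q t =
     (\<Sum>k\<in>K. \<Sum>l\<in>L. overlap I u w k l * (p k)\<^sup>2 / (q l + t * p k))"

definition trial_value ::
    "'i set \<Rightarrow> 'k set \<Rightarrow> ('k \<Rightarrow> 'i \<Rightarrow> complex) \<Rightarrow> ('k \<Rightarrow> real) \<Rightarrow>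
     'l set \<Rightarrow> ('l \<Rightarrow> 'i \<Rightarrow> complex) \<Rightarrow> ('l \<Rightarrow> real) \<Rightarrow> real \<Rightarrow> ('i \<Rightarrow> 'i \<Rightarrow> complex) \<Rightarrow> real" where
  "trial_value I K u p L w q t Y =
     2 * Re (\<Sum>k\<in>K. complex_of_real (p k) * ip I (u k) (mv I Y (u k)))
     - (\<Sum>l\<in>L. q l * sqnorm I (mv I (adj Y) (w l)))
     - t * (\<Sum>k\<in>K. p k * sqnorm I (mv I Y (u k)))"

text \<open>The coordinates \<open><Y u_k, w_l>\<close> are independent of each other, so optimising
  over \<open>Y\<close> becomes a separate scalar problem for every pair. The norms of
  \<open>adj Y\<close> on the \<open>w l\<close> involve the same coordinates, summed over
  \<open>k\<close> instead of \<open>l\<close>.\<close>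

lemma trial_value_coordinates:
  assumes I: "finite I" and u: "spanning I K u" and w: "spanning I L w"
  shows "trial_value I K u p L w q t Y =
    (\<Sum>k\<in>K. \<Sum>l\<in>L. 2 * Re (complex_of_real (p k) * ip I (u k) (w l) * cnj (ip I (mv I Y (u k)) (w l)))
       - (q l + t * p k) * (cmod (ip I (mv I Y (u k)) (w l)))\<^sup>2)"
proof -
  let ?y = "\<lambda>k l. ip I (mv I Y (u k)) (w l)"
  have 1: "ip I (u k) (mv I Y (u k)) = (\<Sum>l\<in>L. ip I (u k) (w l) * cnj (?y k l))" for k
    by (rule parseval[OF I w, symmetric])
  have 2: "sqnorm I (mv I Y (u k)) = (\<Sum>l\<in>L. (cmod (?y k l))\<^sup>2)" for k
    by (rule parseval_sqnorm[OF I w, symmetric])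
  have 3: "sqnorm I (mv I (adj Y) (w l)) = (\<Sum>k\<in>K. (cmod (?y k l))\<^sup>2)" for l
  proof -
    have "cmod (ip I (mv I (adj Y) (w l)) (u k)) = cmod (?y k l)" for k
      by (simp add: ip_adj[of I I Y "u k"] ip_cnj[of I "mv I (adj Y) (w l)" "u k", symmetric])
    then show ?thesis using parseval_sqnorm[OF I u, of "mv I (adj Y) (w l)"] by simp
  qed
  have 4: "(\<Sum>l\<in>L. q l * sqnorm I (mv I (adj Y) (w l))) = (\<Sum>k\<in>K. \<Sum>l\<in>L. q l * (cmod (?y k l))\<^sup>2)"
    unfolding 3 sum_distrib_left by (rule sum.swap)
  show ?thesis
    unfolding trial_value_def 4 unfolding 1 2
    by (simp add: sum_distrib_left sum_subtractf sum.distrib algebra_simps)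
qed

lemma complete_square_le:
  fixes a y :: complex and p q t :: real
  assumes "0 \<le> p" "0 \<le> q" "0 \<le> t" and s: "q = 0 \<longrightarrow> (cmod a)\<^sup>2 * p = 0"
  shows "2 * Re (complex_of_real p * a * cnj y) - (q + t * p) * (cmod y)\<^sup>2
    \<le> (cmod a)\<^sup>2 * p\<^sup>2 / (q + t * p)"
proof (cases "q + t * p = 0")
  \<comment> \<open>Here \<open>q\<close> must vanish, and the support condition makes the linear
    term zero; the right-hand side is zero because division by zero is.\<close>
  case True
  then have "q = 0" using assms by (smt (verit) mult_nonneg_nonneg)
  then have "a = 0 \<or> p = 0" using s by auto
  then show ?thesis using True by auto
next
  case False
  define r where "r = q + t * p"
  have r: "0 < r" using False assms by (simp add: r_def less_le)
  have "Re (complex_of_real p * a * cnj y) \<le> p * cmod a * cmod y"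
    using complex_Re_le_cmod[of "complex_of_real p * a * cnj y"] assms by (simp add: norm_mult)
  moreover have "2 * (p * cmod a * cmod y) \<le> r * (cmod y)\<^sup>2 + (cmod a)\<^sup>2 * p\<^sup>2 / r"
  proof -
    have "0 \<le> (r * cmod y - cmod a * p)\<^sup>2 / r" using r by simp
    also have "\<dots> = r * (cmod y)\<^sup>2 + (cmod a)\<^sup>2 * p\<^sup>2 / r - 2 * (p * cmod a * cmod y)"
      using r by (simp add: power2_eq_square field_simps)
    finally show ?thesis by simp
  qed
  ultimately show ?thesis unfolding r_def by linarith
qed

lemma trial_value_le:
  assumes "finite I" "spanning I K u" "spanning I L w" "0 \<le> t"
    and "\<And>k. k \<in> K \<Longrightarrow> 0 \<le> p k" "\<And>l. l \<in> L \<Longrightarrow> 0 \<le> q l"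
    and "\<And>k l. k \<in> K \<Longrightarrow> l \<in> L \<Longrightarrow> q l = 0 \<Longrightarrow> overlap I u w k l * p k = 0"
  shows "trial_value I K u p L w q t Y \<le> resolvent_form I K u p L w q t"
  unfolding trial_value_coordinates[OF assms(1-3)] resolvent_form_def overlap_def
  using assms(4-) by (intro sum_mono complete_square_le) (auto simp: overlap_def)

lemma trial_value_attained:
  assumes fin: "finite I" "finite K" "finite L"
    and u: "ortho I K u" "spanning I K u" and w: "ortho I L w" "spanning I L w"
  shows "\<exists>Y. trial_value I K u p L w q t Y = resolvent_form I K u p L w q t"
proof -
  \<comment> \<open>The maximiser of each scalar quadratic; \<open>Y\<close> is the operator with
    these coordinates. Where the denominator vanishes, \<open>g\<close> is zero and both sides of
    the claimed identity are zero.\<close>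
  define g where "g k l = complex_of_real (p k / (q l + t * p k)) * ip I (u k) (w l)" for k l
  define Y where "Y i j = (\<Sum>k\<in>K. \<Sum>l\<in>L. g k l * w l i * cnj (u k j))" for i j
  have Yu: "mv I Y (u k) = (\<lambda>i. \<Sum>l\<in>L. g k l * w l i)" if k: "k \<in> K" for k
  proof
    fix i
    have "mv I Y (u k) i = (\<Sum>j\<in>I. \<Sum>k'\<in>K. (\<Sum>l\<in>L. g k' l * w l i) * (u k j * cnj (u k' j)))"
      by (simp add: mv_def Y_def sum_distrib_right sum_distrib_left mult_ac)
    also have "\<dots> = (\<Sum>k'\<in>K. (\<Sum>l\<in>L. g k' l * w l i) * ip I (u k) (u k'))"
      by (subst sum.swap) (simp add: ip_def sum_distrib_left)
    also have "\<dots> = (\<Sum>k'\<in>K. if k' = k then (\<Sum>l\<in>L. g k' l * w l i) else 0)"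
      using k u(1) by (intro sum.cong refl) (auto simp: ortho_def)
    finally show "mv I Y (u k) i = (\<Sum>l\<in>L. g k l * w l i)" using fin k by simp
  qed
  have y: "ip I (mv I Y (u k)) (w l) = g k l" if k: "k \<in> K" and l: "l \<in> L" for k l
  proof -
    have "ip I (mv I Y (u k)) (w l) = (\<Sum>i\<in>I. \<Sum>l'\<in>L. g k l' * (w l' i * cnj (w l i)))"
      by (simp add: Yu[OF k] ip_def sum_distrib_right sum_distrib_left mult_ac)
    also have "\<dots> = (\<Sum>l'\<in>L. g k l' * ip I (w l') (w l))"
      by (subst sum.swap) (simp add: ip_def sum_distrib_left)
    also have "\<dots> = (\<Sum>l'\<in>L. if l' = l then g k l' else 0)"
      using l w(1) by (intro sum.cong refl) (auto simp: ortho_def)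
    finally show ?thesis using fin l by simp
  qed
  have "2 * Re (complex_of_real (p k) * ip I (u k) (w l) * cnj (g k l)) - (q l + t * p k) * (cmod (g k l))\<^sup>2
      = overlap I u w k l * (p k)\<^sup>2 / (q l + t * p k)" for k l
  proof (cases "q l + t * p k = 0")
    case False
    define r where "r = q l + t * p k"
    have r: "r \<noteq> 0" using False by (simp add: r_def)
    have "complex_of_real (p k) * ip I (u k) (w l) * cnj (g k l)
        = complex_of_real (p k * (p k / r)) * (ip I (u k) (w l) * cnj (ip I (u k) (w l)))"
      by (simp add: g_def r_def)
    also have "\<dots> = complex_of_real ((p k * (p k / r)) * overlap I u w k l)"
      by (simp add: overlap_def complex_norm_square del: of_real_power)
    finally have "Re (complex_of_real (p k) * ip I (u k) (w l) * cnj (g k l)) = p k * (p k / r) * overlap I u w k l"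
      by simp
    moreover have "(cmod (g k l))\<^sup>2 = (p k / r)\<^sup>2 * overlap I u w k l"
      by (simp add: g_def r_def[symmetric] norm_mult power_mult_distrib overlap_def norm_divide power_divide)
    ultimately show ?thesis
      unfolding r_def[symmetric] using r by (simp add: power2_eq_square field_simps)
  qed (simp add: g_def)
  then have "trial_value I K u p L w q t Y = resolvent_form I K u p L w q t"
    unfolding trial_value_coordinates[OF fin(1) u(2) w(2)] resolvent_form_def
    by (intro sum.cong refl) (simp add: y)
  then show ?thesis by blast
qed

text \<open>The right-hand sides of the next two lemmas do not depend on the expansion chosen.\<close>

lemma expands_sqnorm_sum:
  assumes "expands I K u p X"
  shows "complex_of_real (\<Sum>k\<in>K. p k * sqnorm J (mv I Y (u k))) =
    (\<Sum>j\<in>J. \<Sum>i\<in>I. \<Sum>i'\<in>I. Y j i * X i i' * cnj (Y j i'))"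
proof -
  have "(\<Sum>j\<in>J. \<Sum>i\<in>I. \<Sum>i'\<in>I. Y j i * X i i' * cnj (Y j i'))
    = (\<Sum>j\<in>J. \<Sum>i\<in>I. \<Sum>i'\<in>I. \<Sum>k\<in>K. complex_of_real (p k) * ((Y j i * u k i) * cnj (Y j i' * u k i')))"
    using assms by (intro sum.cong refl) (simp add: expands_def sum_distrib_left sum_distrib_right mult_ac)
  also have "\<dots> = (\<Sum>j\<in>J. \<Sum>i\<in>I. \<Sum>k\<in>K. \<Sum>i'\<in>I. complex_of_real (p k) * ((Y j i * u k i) * cnj (Y j i' * u k i')))"
    by (intro sum.cong refl, rule sum.swap)
  also have "\<dots> = (\<Sum>j\<in>J. \<Sum>k\<in>K. \<Sum>i\<in>I. \<Sum>i'\<in>I. complex_of_real (p k) * ((Y j i * u k i) * cnj (Y j i' * u k i')))"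
    by (intro sum.cong refl, rule sum.swap)
  also have "\<dots> = (\<Sum>k\<in>K. \<Sum>j\<in>J. \<Sum>i\<in>I. \<Sum>i'\<in>I. complex_of_real (p k) * ((Y j i * u k i) * cnj (Y j i' * u k i')))"
    by (rule sum.swap)
  also have "\<dots> = (\<Sum>k\<in>K. complex_of_real (p k) * ip J (mv I Y (u k)) (mv I Y (u k)))"
    unfolding ip_def mv_def cnj_sum unfolding sum_product unfolding sum_distrib_left by (rule refl)
  finally show ?thesis by (simp add: ip_self)
qed

lemma expands_ip_sum:
  assumes "expands I K u p X"
  shows "(\<Sum>k\<in>K. complex_of_real (p k) * ip I (u k) (mv I Y (u k))) =
    (\<Sum>i\<in>I. \<Sum>i'\<in>I. X i i' * cnj (Y i i'))"
proof -
  have "(\<Sum>i\<in>I. \<Sum>i'\<in>I. X i i' * cnj (Y i i'))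
    = (\<Sum>i\<in>I. \<Sum>i'\<in>I. \<Sum>k\<in>K. complex_of_real (p k) * (u k i * cnj (Y i i' * u k i')))"
    using assms by (intro sum.cong refl) (simp add: expands_def sum_distrib_left sum_distrib_right mult_ac)
  also have "\<dots> = (\<Sum>i\<in>I. \<Sum>k\<in>K. \<Sum>i'\<in>I. complex_of_real (p k) * (u k i * cnj (Y i i' * u k i')))"
    by (intro sum.cong refl, rule sum.swap)
  also have "\<dots> = (\<Sum>k\<in>K. \<Sum>i\<in>I. \<Sum>i'\<in>I. complex_of_real (p k) * (u k i * cnj (Y i i' * u k i')))"
    by (rule sum.swap)
  finally show ?thesis by (simp add: ip_def mv_def sum_distrib_left)
qed

text \<open>\<open>kraus A I F X\<close> is \<open>\<Sum>\<^sub>a F\<^sub>a X F\<^sub>a\<^sup>\<dagger>\<close>; trace preservation says that the columns of the stacked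
  operators \<open>F\<^sub>a\<close> are orthonormal.\<close>

definition kraus :: "'a set \<Rightarrow> 'i set \<Rightarrow> ('a \<Rightarrow> 'j \<Rightarrow> 'i \<Rightarrow> complex) \<Rightarrow> ('i \<Rightarrow> 'i \<Rightarrow> complex) \<Rightarrow> 'j \<Rightarrow> 'j \<Rightarrow> complex"
  where "kraus A I F X j j' = (\<Sum>a\<in>A. \<Sum>i\<in>I. \<Sum>i'\<in>I. F a j i * X i i' * cnj (F a j' i'))"

definition trace_preserving :: "'a set \<Rightarrow> 'j set \<Rightarrow> 'i set \<Rightarrow> ('a \<Rightarrow> 'j \<Rightarrow> 'i \<Rightarrow> complex) \<Rightarrow> bool" where
  "trace_preserving A J I F \<longleftrightarrow> ortho (A \<times> J) I (\<lambda>i (a, j). F a j i)"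

section \<open>Kraus maps, their duals and monotonicity of the resolvent form\<close>

lemma expands_kraus:
  assumes "expands I K u p X"
  shows "expands J (A \<times> K) (\<lambda>(a, k). mv I (F a) (u k)) (\<lambda>(a, k). p k) (kraus A I F X)"
  unfolding expands_def
proof (intro ballI)
  fix j j'
  have "kraus A I F X j j'
    = (\<Sum>a\<in>A. \<Sum>i\<in>I. \<Sum>i'\<in>I. \<Sum>k\<in>K. complex_of_real (p k) * ((F a j i * u k i) * cnj (F a j' i' * u k i')))"
    unfolding kraus_def
    using assms by (intro sum.cong refl) (simp add: expands_def sum_distrib_left sum_distrib_right mult_ac)
  also have "\<dots> = (\<Sum>a\<in>A. \<Sum>i\<in>I. \<Sum>k\<in>K. \<Sum>i'\<in>I. complex_of_real (p k) * ((F a j i * u k i) * cnj (F a j' i' * u k i')))"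
    by (intro sum.cong refl, rule sum.swap)
  also have "\<dots> = (\<Sum>a\<in>A. \<Sum>k\<in>K. \<Sum>i\<in>I. \<Sum>i'\<in>I. complex_of_real (p k) * ((F a j i * u k i) * cnj (F a j' i' * u k i')))"
    by (intro sum.cong refl, rule sum.swap)
  also have "\<dots> = (\<Sum>a\<in>A. \<Sum>k\<in>K. complex_of_real (p k) * (mv I (F a) (u k) j * cnj (mv I (F a) (u k) j')))"
    unfolding mv_def cnj_sum unfolding sum_product unfolding sum_distrib_left by (rule refl)
  finally show "kraus A I F X j j' = (\<Sum>k\<in>A \<times> K. complex_of_real (case k of (a, k) \<Rightarrow> p k) *
      (case k of (a, k) \<Rightarrow> mv I (F a) (u k)) j * cnj ((case k of (a, k) \<Rightarrow> mv I (F a) (u k)) j'))"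
    by (simp add: sum.cartesian_product split_def mult_ac)
qed

definition kraus_dual :: "'a set \<Rightarrow> 'j set \<Rightarrow> ('a \<Rightarrow> 'j \<Rightarrow> 'i \<Rightarrow> complex) \<Rightarrow> ('j \<Rightarrow> 'j \<Rightarrow> complex) \<Rightarrow> 'i \<Rightarrow> 'i \<Rightarrow> complex"
  where "kraus_dual A J F Y i i' = (\<Sum>a\<in>A. \<Sum>j\<in>J. \<Sum>j'\<in>J. cnj (F a j i) * Y j j' * F a j' i')"

lemma adj_kraus_dual: "adj (kraus_dual A J F Y) = kraus_dual A J F (adj Y)"
proof (intro ext)
  fix i i'
  show "adj (kraus_dual A J F Y) i i' = kraus_dual A J F (adj Y) i i'"
    unfolding adj_def kraus_dual_def cnj_sum
    by (rule sum.cong[OF refl], subst sum.swap) (simp add: mult_ac)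
qed

lemma mv_kraus_dual:
  "mv I (kraus_dual A J F Y) x i = (\<Sum>a\<in>A. mv J (adj (F a)) (mv J Y (mv I (F a) x)) i)"
proof -
  have "mv I (kraus_dual A J F Y) x i
      = (\<Sum>i'\<in>I. \<Sum>a\<in>A. \<Sum>j\<in>J. \<Sum>j'\<in>J. cnj (F a j i) * (Y j j' * (F a j' i' * x i')))"
    by (simp add: mv_def kraus_dual_def sum_distrib_right sum_distrib_left mult_ac)
  also have "\<dots> = (\<Sum>a\<in>A. \<Sum>i'\<in>I. \<Sum>j\<in>J. \<Sum>j'\<in>J. cnj (F a j i) * (Y j j' * (F a j' i' * x i')))"
    by (rule sum.swap)
  also have "\<dots> = (\<Sum>a\<in>A. \<Sum>j\<in>J. \<Sum>i'\<in>I. \<Sum>j'\<in>J. cnj (F a j i) * (Y j j' * (F a j' i' * x i')))"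
    by (intro sum.cong refl, rule sum.swap)
  also have "\<dots> = (\<Sum>a\<in>A. \<Sum>j\<in>J. \<Sum>j'\<in>J. \<Sum>i'\<in>I. cnj (F a j i) * (Y j j' * (F a j' i' * x i')))"
    by (intro sum.cong refl, rule sum.swap)
  finally show ?thesis
    by (simp add: mv_def adj_def sum_distrib_left)
qed

text \<open>The Kadison-Schwarz inequality for the dual map: its value at \<open>x\<close> is the adjoint of the stacked
  isometry applied to the stacked vectors \<open>Y F\<^sub>a x\<close>.\<close>

lemma sqnorm_kraus_dual_le:
  assumes "finite I" "trace_preserving A J I F"
  shows "sqnorm I (mv I (kraus_dual A J F Y) x) \<le> (\<Sum>a\<in>A. sqnorm J (mv J Y (mv I (F a) x)))"
proof -
  let ?x = "\<lambda>(a, j). mv J Y (mv I (F a) x) j"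
  have "mv I (kraus_dual A J F Y) x i = ip (A \<times> J) ?x (\<lambda>(a, j). F a j i)" for i
    unfolding mv_kraus_dual
    by (simp add: ip_def mv_def[of J "\<lambda>i j. cnj (F _ j i)"] adj_def sum.cartesian_product split_def mult_ac)
  then have "sqnorm I (mv I (kraus_dual A J F Y) x)
      = (\<Sum>i\<in>I. (cmod (ip (A \<times> J) ?x ((\<lambda>i (a, j). F a j i) i)))\<^sup>2)"
    by (simp add: sqnorm_def)
  also have "\<dots> \<le> sqnorm (A \<times> J) ?x"
    using assms by (intro bessel) (auto simp: trace_preserving_def)
  also have "\<dots> = (\<Sum>a\<in>A. sqnorm J (mv J Y (mv I (F a) x)))"
    by (simp add: sqnorm_def sum.cartesian_product split_def)
  finally show ?thesis .
qed

text \<open>The weighted sum depends only on the operator, so the expansion \<open>u'\<close> of the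
  output may be exchanged for the vectors \<open>F a (u k)\<close>. After that the Kadison-Schwarz
  inequality applies to each \<open>u k\<close> separately.\<close>

lemma kraus_sqnorm_sum_mono:
  assumes I: "finite I" and trace_preserving: "trace_preserving A J I F"
    and X: "expands I K u p X" and p: "\<And>k. k \<in> K \<Longrightarrow> 0 \<le> p k"
    and X': "expands J K' u' p' (kraus A I F X)"
  shows "(\<Sum>k\<in>K. p k * sqnorm I (mv I (kraus_dual A J F Y) (u k))) \<le> (\<Sum>k\<in>K'. p' k * sqnorm J (mv J Y (u' k)))"
proof -
  have "complex_of_real (\<Sum>k\<in>K'. p' k * sqnorm J (mv J Y (u' k)))
    = complex_of_real (\<Sum>k\<in>A \<times> K. (case k of (a, k) \<Rightarrow> p k) * sqnorm J (mv J Y (case k of (a, k) \<Rightarrow> mv I (F a) (u k))))"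
    unfolding expands_sqnorm_sum[OF X'] expands_sqnorm_sum[OF expands_kraus[OF X]] ..
  then have "(\<Sum>k\<in>K'. p' k * sqnorm J (mv J Y (u' k)))
      = (\<Sum>(a, k)\<in>A \<times> K. p k * sqnorm J (mv J Y (mv I (F a) (u k))))"
    unfolding of_real_eq_iff by (simp add: split_def)
  also have "\<dots> = (\<Sum>k\<in>K. p k * (\<Sum>a\<in>A. sqnorm J (mv J Y (mv I (F a) (u k)))))"
    by (subst sum.cartesian_product[symmetric], subst sum.swap) (simp add: sum_distrib_left)
  finally show ?thesis
    using sqnorm_kraus_dual_le[OF I trace_preserving] p by (auto intro!: sum_mono mult_left_mono)
qed

text \<open>Duality of the two pictures under the trace. It is an equality: the linear term of the
  trial value survives the pull-back unchanged, and only the two quadratic penalties shrink.\<close>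

lemma kraus_ip_sum:
  assumes X: "expands I K u p X" and X': "expands J K' u' p' (kraus A I F X)"
  shows "(\<Sum>k\<in>K. complex_of_real (p k) * ip I (u k) (mv I (kraus_dual A J F Y) (u k)))
    = (\<Sum>k\<in>K'. complex_of_real (p' k) * ip J (u' k) (mv J Y (u' k)))"
proof -
  have dual: "ip I x (mv I (kraus_dual A J F Y) x) = (\<Sum>a\<in>A. ip J (mv I (F a) x) (mv J Y (mv I (F a) x)))" for x
  proof -
    have "ip I x (mv I (kraus_dual A J F Y) x) = (\<Sum>a\<in>A. ip I x (mv J (adj (F a)) (mv J Y (mv I (F a) x))))"
      unfolding ip_def[of I x] mv_kraus_dual cnj_sum sum_distrib_left by (rule sum.swap)
    then show ?thesis by (simp add: ip_adj)
  qed
  have "(\<Sum>k\<in>K'. complex_of_real (p' k) * ip J (u' k) (mv J Y (u' k)))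
    = (\<Sum>k\<in>A \<times> K. complex_of_real (case k of (a, k) \<Rightarrow> p k) *
        ip J (case k of (a, k) \<Rightarrow> mv I (F a) (u k)) (mv J Y (case k of (a, k) \<Rightarrow> mv I (F a) (u k))))"
    unfolding expands_ip_sum[OF X'] expands_ip_sum[OF expands_kraus[OF X]] ..
  also have "\<dots> = (\<Sum>(a, k)\<in>A \<times> K. complex_of_real (p k) * ip J (mv I (F a) (u k)) (mv J Y (mv I (F a) (u k))))"
    by (simp add: split_def)
  also have "\<dots> = (\<Sum>k\<in>K. complex_of_real (p k) * (\<Sum>a\<in>A. ip J (mv I (F a) (u k)) (mv J Y (mv I (F a) (u k)))))"
    by (subst sum.cartesian_product[symmetric], subst sum.swap) (simp add: sum_distrib_left)
  finally show ?thesis by (simp add: dual)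
qed

lemma resolvent_form_mono:
  assumes I: "finite I" and J: "finite J" "finite K'" "finite L'"
    and trace_preserving: "trace_preserving A J I F" and t: "0 \<le> t"
    and u: "spanning I K u" "expands I K u p X" "\<And>k. k \<in> K \<Longrightarrow> 0 \<le> p k"
    and w: "spanning I L w" "expands I L w q Z" "\<And>l. l \<in> L \<Longrightarrow> 0 \<le> q l"
    and supp: "\<And>k l. k \<in> K \<Longrightarrow> l \<in> L \<Longrightarrow> q l = 0 \<Longrightarrow> overlap I u w k l * p k = 0"
    and u': "ortho J K' u'" "spanning J K' u'" "expands J K' u' p' (kraus A I F X)"
    and w': "ortho J L' w'" "spanning J L' w'" "expands J L' w' q' (kraus A I F Z)"
  shows "resolvent_form J K' u' p' L' w' q' t \<le> resolvent_form I K u p L w q t"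
proof -
  obtain Y where Y: "trial_value J K' u' p' L' w' q' t Y = resolvent_form J K' u' p' L' w' q' t"
    using trial_value_attained[OF J u'(1,2) w'(1,2)] by blast
  \<comment> \<open>One pulled-back operator serves both penalties: the dual map commutes with
    \<open>adj\<close>, so Kadison-Schwarz for \<open>Y\<close> bounds the term of \<open>X\<close>
    and for \<open>adj Y\<close> the term of \<open>Z\<close>.\<close>
  have "trial_value J K' u' p' L' w' q' t Y \<le> trial_value I K u p L w q t (kraus_dual A J F Y)"
    unfolding trial_value_def kraus_ip_sum[OF u(2) u'(3)] adj_kraus_dual
    using mult_left_mono[OF kraus_sqnorm_sum_mono[OF I trace_preserving u(2,3) u'(3), of Y] t]
      kraus_sqnorm_sum_mono[OF I trace_preserving w(2,3) w'(3), of "adj Y"]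
    by linarith
  also have "\<dots> \<le> resolvent_form I K u p L w q t"
    by (rule trial_value_le[OF I u(1) w(1) t u(3) w(3) supp])
  finally show ?thesis using Y by simp
qed

section \<open>The spectral theorem and entropy\<close>

lemma two_point_form:
  fixes \<alpha> \<beta> :: complex
  assumes I: "finite I" "i \<in> I" "j \<in> I"
  defines "x \<equiv> \<lambda>k. (if k = i then \<alpha> else 0) + (if k = j then \<beta> else 0)"
  shows "ip I (mv I M x) x = (M i i * \<alpha> + M i j * \<beta>) * cnj \<alpha> + (M j i * \<alpha> + M j j * \<beta>) * cnj \<beta>"
proof -
  have *: "(\<Sum>k\<in>I. f k * ((if k = i then a else 0) + (if k = j then b else 0))) = f i * a + f j * b"
    for f :: "'a \<Rightarrow> complex" and a b
  proof -
    have "f k * ((if k = i then a else 0) + (if k = j then b else 0))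
        = (if k = i then f i * a else 0) + (if k = j then f j * b else 0)" for k
      by (simp add: distrib_left)
    then show ?thesis using I by (simp add: sum.distrib)
  qed
  have "mv I M x k = M k i * \<alpha> + M k j * \<beta>" for k
    unfolding mv_def x_def by (rule *)
  moreover have "cnj (x k) = (if k = i then cnj \<alpha> else 0) + (if k = j then cnj \<beta> else 0)" for k
    by (simp add: x_def)
  ultimately show ?thesis unfolding ip_def by (simp only: *)
qed

text \<open>Polarisation: unit vectors kill the diagonal, and the vectors with entries
  \<open>1, 1\<close> and \<open>1, \<i>\<close> at the places \<open>i, j\<close> kill the sum and
  the difference of the two off-diagonal entries.\<close>

lemma quadratic_form_zero:
  assumes I: "finite I" "i \<in> I" "j \<in> I" and z: "\<And>x. ip I (mv I M x) x = 0"
  shows "M i j = 0"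
proof -
  note f = two_point_form[of I _ _ M, unfolded z]
  have d: "M k k = 0" if "k \<in> I" for k
    using f[OF I(1) that that, of 1 0] by simp
  have "M i j + M j i = 0" "\<i> * M i j - \<i> * M j i = 0"
    using f[OF I, of 1 1] f[OF I, of 1 \<i>] I d by (simp_all add: algebra_simps)
  then have "M i j = - M j i" "M i j = M j i" by (auto simp: eq_neg_iff_add_eq_0)
  then show ?thesis by simp
qed

definition hermitian :: "'i set \<Rightarrow> ('i \<Rightarrow> 'i \<Rightarrow> complex) \<Rightarrow> bool" where
  "hermitian I X \<longleftrightarrow> (\<forall>i\<in>I. \<forall>j\<in>I. X j i = cnj (X i j))"

definition pos :: "'i set \<Rightarrow> ('i \<Rightarrow> 'i \<Rightarrow> complex) \<Rightarrow> bool" where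
  "pos I X \<longleftrightarrow> (\<forall>x. 0 \<le> ip I (mv I X x) x)"

lemma ip_cong: "(\<And>i. i \<in> I \<Longrightarrow> x i = x' i) \<Longrightarrow> (\<And>i. i \<in> I \<Longrightarrow> y i = y' i) \<Longrightarrow> ip I x y = ip I x' y'"
  by (simp add: ip_def)

lemma mv_cong: "(\<And>i. i \<in> I \<Longrightarrow> X j i = X' j i) \<Longrightarrow> (\<And>i. i \<in> I \<Longrightarrow> x i = x' i) \<Longrightarrow> mv I X x j = mv I X' x' j"
  by (simp add: mv_def)

text \<open>Nonnegativity in the order of the complex numbers forces the form to be real, so the
  form of \<open>X\<close> minus its adjoint vanishes identically.\<close>

lemma pos_hermitian:
  assumes "finite I" "pos I X" shows "hermitian I X"
  unfolding hermitian_def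
proof (intro ballI)
  fix i j assume ij: "i \<in> I" "j \<in> I"
  have "ip I (mv I (\<lambda>i j. X i j - adj X i j) x) x = 0" for x
  proof -
    have "ip I (mv I (\<lambda>i j. X i j - adj X i j) x) x = ip I (mv I X x) x - ip I (mv I (adj X) x) x"
      by (simp add: ip_def mv_def left_diff_distrib sum_subtractf)
    also have "ip I (mv I (adj X) x) x = cnj (ip I (mv I X x) x)"
      by (simp add: ip_adj ip_cnj)
    also have "\<dots> = ip I (mv I X x) x"
      using assms(2) by (simp add: pos_def complex_eq_iff less_eq_complex_def)
    finally show ?thesis by simp
  qed
  from quadratic_form_zero[OF assms(1) ij(2,1) this]
  show "X j i = cnj (X i j)" by (simp add: adj_def)
qed

lemma ip_hermitian:
  assumes "hermitian I X"
  shows "ip I (mv I X x) y = ip I x (mv I X y)"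
proof -
  have "adj X i j = X i j" if "i \<in> I" "j \<in> I" for i j
    unfolding adj_def using assms[unfolded hermitian_def, rule_format, OF that(2,1)] by simp
  then show ?thesis unfolding ip_adj by (intro ip_cong mv_cong) auto
qed

section \<open>Diagonalisation of Hermitian operators\<close>

lemma spanning_sum:
  assumes "finite I" "spanning I K w" "i \<in> I"
  shows "(\<Sum>k\<in>K. ip I x (w k) * w k i) = x i"
proof -
  have "(\<Sum>k\<in>K. ip I x (w k) * w k i) = (\<Sum>k\<in>K. \<Sum>j\<in>I. x j * (w k i * cnj (w k j)))"
    by (simp add: ip_def sum_distrib_right sum_distrib_left mult_ac)
  also have "\<dots> = (\<Sum>j\<in>I. x j * (\<Sum>k\<in>K. w k i * cnj (w k j)))"
    by (subst sum.swap) (simp add: sum_distrib_left)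
  also have "\<dots> = (\<Sum>j\<in>I. if j = i then x j else 0)"
    using assms by (intro sum.cong refl) (auto simp: spanning_def)
  finally show ?thesis using assms by simp
qed

lemma basis_change:
  assumes I: "finite I" "spanning I K w" "i \<in> I" "j \<in> I"
  shows "X i j = (\<Sum>a\<in>K. \<Sum>b\<in>K. w a i * ip I (mv I X (w b)) (w a) * cnj (w b j))"
proof -
  have "X i j = (\<Sum>k\<in>I. X i k * (if k = j then 1 else 0))"
    using I by (simp add: if_distrib cong: if_cong)
  also have "\<dots> = (\<Sum>k\<in>I. \<Sum>b\<in>K. X i k * w b k * cnj (w b j))"
    using I by (intro sum.cong refl) (simp add: spanning_def sum_distrib_left[symmetric] mult.assoc)
  also have "\<dots> = (\<Sum>b\<in>K. mv I X (w b) i * cnj (w b j))"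
    by (subst sum.swap) (simp add: mv_def sum_distrib_right)
  also have "\<dots> = (\<Sum>b\<in>K. \<Sum>a\<in>K. w a i * ip I (mv I X (w b)) (w a) * cnj (w b j))"
    by (intro sum.cong refl, subst spanning_sum[OF I(1-3), symmetric])
      (simp add: sum_distrib_right sum_distrib_left mult_ac)
  finally show ?thesis by (subst sum.swap) simp
qed

lemma scalar_prod_ip:
  assumes "v \<in> carrier_vec n" "w \<in> carrier_vec n"
  shows "v \<bullet>c w = ip {..<n} (vec_index v) (vec_index w)"
  using assms by (auto simp: scalar_prod_def ip_def atLeast0LessThan intro!: sum.cong)

text \<open>A one-sided inverse of a square matrix is two-sided: \<open>V * U = 1\<close> is
  orthonormality of the columns of \<open>U\<close>, and \<open>U * V = 1\<close> is
  completeness.\<close>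

lemma ortho_square_spanning:
  fixes n :: nat
  assumes "ortho {..<n} {..<n} u" shows "spanning {..<n} {..<n} u"
proof -
  define U where "U = mat n n (\<lambda>(i, k). u k i)"
  define V where "V = mat n n (\<lambda>(k, i). cnj (u k i))"
  have UV: "U \<in> carrier_mat n n" "V \<in> carrier_mat n n" by (auto simp: U_def V_def)
  have "(V * U) $$ (k, l) = ip {..<n} (u l) (u k)" if "k < n" "l < n" for k l
    using that UV by (simp add: U_def V_def scalar_prod_def ip_def atLeast0LessThan mult.commute)
  then have "V * U = 1\<^sub>m n"
    using assms UV by (intro eq_matI) (auto simp: ortho_def)
  then have "U * V = 1\<^sub>m n" using mat_mult_left_right_inverse[OF UV(2,1)] by simp
  moreover have "(U * V) $$ (i, j) = (\<Sum>k<n. u k i * cnj (u k j))" if "i < n" "j < n" for i j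
    using that UV by (simp add: U_def V_def scalar_prod_def atLeast0LessThan)
  ultimately show ?thesis by (simp add: spanning_def)
qed

text \<open>The characteristic polynomial has a complex root. A corresponding eigenvector is
  completed to a basis with itself at the head, which Gram-Schmidt leaves in place.\<close>

lemma orthonormal_basis_with_eigenvector:
  fixes X :: "nat \<Rightarrow> nat \<Rightarrow> complex"
  assumes n: "0 < n"
  shows "\<exists>w e. ortho {..<n} {..<n} w \<and> (\<forall>i<n. mv {..<n} X (w 0) i = e * w 0 i)"
proof -
  define A where "A = mat n n (\<lambda>(i, j). X i j)"
  have A: "A \<in> carrier_mat n n" by (simp add: A_def)
  obtain as where as: "char_poly A = (\<Prod>a\<leftarrow>as. [:- a, 1:])" "length as = n"
    using char_poly_factorized[OF A] by blast
  obtain e where "e \<in> set as" using as(2) n by (cases as) auto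
  then have "poly (char_poly A) e = 0" unfolding as(1) poly_prod_list prod_list_zero_iff by auto
  then have "eigenvalue A e" using eigenvalue_root_char_poly[OF A] by simp
  then obtain v where "eigenvector A v e" unfolding eigenvalue_def by blast
  then have v: "v \<in> carrier_vec n" "v \<noteq> 0\<^sub>v n" "A *\<^sub>v v = e \<cdot>\<^sub>v v"
    using A by (auto simp: eigenvector_def)
  interpret cof_vec_space n "TYPE(complex)" .
  define b where "b = basis_completion v"
  define ws where "ws = gram_schmidt n b"
  note bc = basis_completion[OF v(1,2), folded b_def]
  obtain vs where bv: "b = v # vs" using bc(6,7) n by (cases b) auto
  from gram_schmidt_result[OF bc(2,4,5) refl, folded ws_def]
  have ws: "set ws \<subseteq> carrier_vec n" "corthogonal ws" "length ws = n"
    by (auto simp: bc(6))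
  have "hd ws = v" unfolding ws_def using gram_schmidt_hd[OF v(1), of vs] bv by simp
  then have ws0: "ws ! 0 = v" using ws(3) n by (cases ws) auto
  have wsc: "ws ! i \<in> carrier_vec n" if "i < n" for i using ws that by auto
  define s where "s k = complex_of_real (1 / sqrt (sqnorm {..<n} (vec_index (ws ! k))))" for k
  define w where "w k i = s k * ws ! k $ i" for k i
  have orth: "ip {..<n} (vec_index (ws ! k)) (vec_index (ws ! l)) = 0 \<longleftrightarrow> k \<noteq> l" if "k < n" "l < n" for k l
    using corthogonalD[OF ws(2), of k l] that ws(3) scalar_prod_ip[OF wsc wsc, of k l] by simp
  have wip: "ip {..<n} (w k) (w l) = s k * s l * ip {..<n} (vec_index (ws ! k)) (vec_index (ws ! l))" for k l
    unfolding ip_def sum_distrib_left by (simp add: w_def s_def mult_ac)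
  have "ip {..<n} (w k) (w k) = 1" if "k < n" for k
  proof -
    let ?N = "sqnorm {..<n} (vec_index (ws ! k))"
    have "?N \<noteq> 0" using orth[OF that that] by (auto simp: ip_self)
    then have "0 < ?N" using sqnorm_nonneg[of "{..<n}" "vec_index (ws ! k)"] by simp
    then have "1 / sqrt ?N * (1 / sqrt ?N) * ?N = 1" by simp
    then have "complex_of_real (1 / sqrt ?N * (1 / sqrt ?N) * ?N) = 1" by (simp only: of_real_1)
    then show ?thesis unfolding wip unfolding ip_self s_def by (simp only: of_real_mult)
  qed
  then have "ortho {..<n} {..<n} w" using orth by (auto simp: ortho_def wip)
  moreover have "mv {..<n} X (w 0) i = e * w 0 i" if i: "i < n" for i
  proof -
    have "(A *\<^sub>v v) $ i = (\<Sum>j<n. X i j * v $ j)"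
      using i v(1) A by (auto simp: scalar_prod_def A_def atLeast0LessThan intro!: sum.cong)
    then have "(\<Sum>j<n. X i j * v $ j) = e * v $ i" using v i by simp
    then show ?thesis
      by (simp add: mv_def w_def ws0 mult.left_commute[of _ "s 0"] sum_distrib_left[symmetric])
  qed
  ultimately show ?thesis by blast
qed

text \<open>Deflation: in the basis \<open>w\<close> the first column of \<open>X\<close> is
  \<open>e\<close> times a unit vector, and by hermiticity so is the first row. What remains is a
  Hermitian block of size \<open>n\<close>.\<close>

lemma spectral_theorem_nat:
  "hermitian {..<n::nat} X \<Longrightarrow> \<exists>u p. ortho {..<n} {..<n} u \<and> expands {..<n} {..<n} u p X"
proof (induction n arbitrary: X)
  case 0
  then show ?case by (auto simp: ortho_def expands_def)
next
  case (Suc n)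
  let ?I = "{..<Suc n}"
  obtain w e where w: "ortho ?I ?I w" and e: "\<And>i. i < Suc n \<Longrightarrow> mv ?I X (w 0) i = e * w 0 i"
    using orthonormal_basis_with_eigenvector[of "Suc n" X] by blast
  have wc: "spanning ?I ?I w" by (rule ortho_square_spanning[OF w])
  define M where "M a b = ip ?I (mv ?I X (w b)) (w a)" for a b
  have Mh: "M b a = cnj (M a b)" for a b
    unfolding M_def by (simp add: ip_cnj ip_hermitian[OF Suc.prems])
  have M0: "M a 0 = (if a = 0 then e else 0)" if "a < Suc n" for a
  proof -
    have "M a 0 = e * ip ?I (w 0) (w a)"
      unfolding M_def using e by (simp add: ip_def sum_distrib_left mult.assoc del: sum.lessThan_Suc)
    then show ?thesis using w that by (auto simp: ortho_def)
  qed
  have er: "e = complex_of_real (Re e)"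
  proof -
    have "e = cnj e" using Mh[of 0 0] unfolding M0[OF zero_less_Suc] by simp
    then show ?thesis by (simp add: complex_eq_iff)
  qed
  have "hermitian {..<n} (\<lambda>a b. M (Suc a) (Suc b))"
    unfolding hermitian_def using Mh by blast
  then obtain u p where u: "ortho {..<n} {..<n} u"
    and up: "expands {..<n} {..<n} u p (\<lambda>a b. M (Suc a) (Suc b))"
    using Suc.IH by blast
  \<comment> \<open>Eigenvectors of the remaining block, read as coefficients with respect to
    \<open>w 1, ..., w n\<close>; \<open>U\<close> and \<open>P\<close> put \<open>w 0\<close> with
    its eigenvalue in front.\<close>
  define v where "v k i = (\<Sum>j<n. u k j * w (Suc j) i)" for k i
  define U where "U k = (case k of 0 \<Rightarrow> w 0 | Suc k \<Rightarrow> v k)" for k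
  define P where "P k = (case k of 0 \<Rightarrow> Re e | Suc k \<Rightarrow> p k)" for k
  have vx: "ip ?I (v k) x = (\<Sum>j<n. u k j * ip ?I (w (Suc j)) x)" for k x
  proof -
    have "ip ?I (v k) x = (\<Sum>i\<in>?I. \<Sum>j<n. u k j * (w (Suc j) i * cnj (x i)))"
      by (simp only: ip_def v_def sum_distrib_right mult.assoc)
    also have "\<dots> = (\<Sum>j<n. u k j * ip ?I (w (Suc j)) x)"
      by (subst sum.swap) (simp only: ip_def sum_distrib_left)
    finally show ?thesis .
  qed
  have v0: "ip ?I (v k) (w 0) = 0" for k
    using w by (simp add: vx ortho_def)
  have wv: "ip ?I (w (Suc j)) (v l) = cnj (u l j)" if "j < n" for j l
  proof -
    have "ip ?I (w (Suc j)) (v l) = cnj (ip ?I (v l) (w (Suc j)))" by (simp only: ip_cnj)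
    also have "ip ?I (v l) (w (Suc j)) = (\<Sum>j'<n. if j' = j then u l j' else 0)"
      unfolding vx using w that by (intro sum.cong refl) (auto simp: ortho_def)
    finally show ?thesis using that by simp
  qed
  have vv: "ip ?I (v k) (v l) = ip {..<n} (u k) (u l)" for k l
    unfolding vx by (simp add: wv ip_def[of "{..<n}"])
  have "ortho ?I ?I U"
    unfolding ortho_def
  proof (intro ballI)
    fix k l assume kl: "k \<in> ?I" "l \<in> ?I"
    have "ip ?I (w 0) (v l) = 0" for l using v0[of l] ip_cnj[of ?I "v l" "w 0"] by simp
    then show "ip ?I (U k) (U l) = (if k = l then 1 else 0)"
      using kl w u by (auto simp: U_def ortho_def v0 vv split: nat.split)
  qed
  moreover have "expands ?I ?I U P X"
    unfolding expands_def
  proof (intro ballI)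
    fix i j assume ij: "i \<in> ?I" "j \<in> ?I"
    have M0': "M 0 (Suc b) = 0" "M (Suc b) 0 = 0" if "b < n" for b
      using M0[of "Suc b"] Mh[of "Suc b" 0] that by auto
    have "X i j = (\<Sum>a<Suc n. \<Sum>b<Suc n. w a i * M a b * cnj (w b j))"
      unfolding M_def by (rule basis_change[OF _ wc ij]) simp
    also have "\<dots> = w 0 i * e * cnj (w 0 j)
        + (\<Sum>a<n. \<Sum>b<n. w (Suc a) i * M (Suc a) (Suc b) * cnj (w (Suc b) j))"
      unfolding sum.lessThan_Suc_shift by (simp add: M0' M0)
    also have "(\<Sum>a<n. \<Sum>b<n. w (Suc a) i * M (Suc a) (Suc b) * cnj (w (Suc b) j))
        = (\<Sum>a<n. \<Sum>b<n. \<Sum>k<n. complex_of_real (p k) * ((u k a * w (Suc a) i) * cnj (u k b * w (Suc b) j)))"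
      using up by (intro sum.cong refl)
        (simp add: expands_def sum_distrib_left sum_distrib_right mult_ac)
    also have "\<dots> = (\<Sum>a<n. \<Sum>k<n. \<Sum>b<n. complex_of_real (p k) * ((u k a * w (Suc a) i) * cnj (u k b * w (Suc b) j)))"
      by (rule sum.cong[OF refl], rule sum.swap)
    also have "\<dots> = (\<Sum>k<n. \<Sum>a<n. \<Sum>b<n. complex_of_real (p k) * ((u k a * w (Suc a) i) * cnj (u k b * w (Suc b) j)))"
      by (rule sum.swap)
    also have "\<dots> = (\<Sum>k<n. complex_of_real (p k) * (v k i * cnj (v k j)))"
      unfolding v_def cnj_sum unfolding sum_product unfolding sum_distrib_left by (rule refl)
    finally have "X i j = w 0 i * e * cnj (w 0 j) + (\<Sum>k<n. complex_of_real (p k) * (v k i * cnj (v k j)))" .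
    then show "X i j = (\<Sum>k\<in>?I. complex_of_real (P k) * U k i * cnj (U k j))"
      unfolding sum.lessThan_Suc_shift by (simp add: P_def U_def er[symmetric] mult_ac)
  qed
  ultimately show ?case by blast
qed

lemma ip_reindex: "bij_betw f J I \<Longrightarrow> ip J (\<lambda>j. x (f j)) (\<lambda>j. y (f j)) = ip I x y"
  unfolding ip_def by (rule sum.reindex_bij_betw)

lemma spectral_theorem:
  assumes I: "finite I" and X: "hermitian I X"
  shows "\<exists>u p. ortho I I u \<and> spanning I I u \<and> expands I I u p X"
proof -
  define n where "n = card I"
  obtain f where f: "bij_betw f I {..<n}"
    unfolding n_def lessThan_atLeast0 using ex_bij_betw_finite_nat[OF I] by blast
  define g where "g = the_inv_into I f"
  have g: "bij_betw g {..<n} I" unfolding g_def by (rule bij_betw_the_inv_into[OF f])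
  have gf: "g (f i) = i" if "i \<in> I" for i
    unfolding g_def using f that by (simp add: bij_betw_def the_inv_into_f_f)
  have fI: "f i < n" if "i \<in> I" for i using f that by (auto simp: bij_betw_def)
  have fe: "f i = f j \<longleftrightarrow> i = j" if "i \<in> I" "j \<in> I" for i j using gf that by metis
  have "hermitian {..<n} (\<lambda>a b. X (g a) (g b))"
    unfolding hermitian_def using X[unfolded hermitian_def, rule_format] bij_betwE[OF g] by blast
  then obtain u p where u: "ortho {..<n} {..<n} u" and p: "expands {..<n} {..<n} u p (\<lambda>a b. X (g a) (g b))"
    using spectral_theorem_nat by blast
  have c: "spanning {..<n} {..<n} u" by (rule ortho_square_spanning[OF u])
  define v where "v k i = u (f k) (f i)" for k i
  have "ortho I I v"
  proof -
    have "ip I (v k) (v l) = ip {..<n} (u (f k)) (u (f l))" for k l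
      unfolding v_def by (rule ip_reindex[OF f])
    then show ?thesis using u by (simp add: ortho_def fI fe)
  qed
  moreover have "spanning I I v"
    using c sum.reindex_bij_betw[OF f, of "\<lambda>k. u k _ * cnj (u k _)"]
    by (simp add: spanning_def v_def fI fe)
  moreover have "expands I I v (p \<circ> f) X"
    unfolding expands_def
  proof (intro ballI)
    fix i j assume ij: "i \<in> I" "j \<in> I"
    have "X i j = (\<Sum>k<n. complex_of_real (p k) * u k (f i) * cnj (u k (f j)))"
      using p[unfolded expands_def, rule_format, of "f i" "f j"] ij by (simp add: fI gf)
    then show "X i j = (\<Sum>k\<in>I. complex_of_real ((p \<circ> f) k) * v k i * cnj (v k j))"
      using sum.reindex_bij_betw[OF f, of "\<lambda>k. complex_of_real (p k) * u k (f i) * cnj (u k (f j))"]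
      by (simp add: v_def)
  qed
  ultimately show ?thesis by blast
qed

section \<open>Spectra and entropy of positive operators\<close>

lemma pos_expansion_nonneg:
  assumes "pos I X" "ortho I K u" "expands I K u p X" "finite K" "k \<in> K"
  shows "0 \<le> p k"
proof -
  have "0 \<le> ip I (mv I X (u k)) (u k)" using assms(1) by (simp add: pos_def)
  also have "\<dots> = complex_of_real (p k)"
    using expands_eigen[OF assms(4,2,3,5), of "u k"] assms(2,5) by (simp add: ortho_def)
  finally show ?thesis by (simp add: less_eq_complex_def)
qed

lemma spectral_theorem_pos:
  assumes "finite I" "pos I X"
  obtains u p where "ortho I I u" "spanning I I u" "expands I I u p X" "\<And>k. k \<in> I \<Longrightarrow> 0 \<le> p k"
proof -
  obtain u p where "ortho I I u" "spanning I I u" "expands I I u p X"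
    using spectral_theorem[OF assms(1) pos_hermitian[OF assms]] by blast
  then show ?thesis using that pos_expansion_nonneg[OF assms(2) _ _ assms(1)] by blast
qed

text \<open>Measured in nats; the factor \<open>ln 2\<close> is introduced in the comparison with
  \<open>vn_entropy\<close>. On positive operators the choice of eigenbasis does not affect the
  value, by \<open>entropy_eq\<close>.\<close>

definition entropy :: "'i set \<Rightarrow> ('i \<Rightarrow> 'i \<Rightarrow> complex) \<Rightarrow> real" where
  "entropy I X = (SOME h. \<exists>u p. ortho I I u \<and> spanning I I u \<and> expands I I u p X \<and> h = - (\<Sum>k\<in>I. p k * ln (p k)))"

text \<open>Any finite orthonormal expansion computes the entropy, even an incomplete one: missing
  directions lie in the kernel and would add \<open>0 * ln 0 = 0\<close>. This admits product
  families such as messages paired with eigenvectors.\<close>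

lemma entropy_eq:
  assumes fin: "finite I" "finite L" and X: "pos I X" and w: "ortho I L w" "expands I L w q X"
  shows "entropy I X = - (\<Sum>l\<in>L. q l * ln (q l))"
proof -
  have "h = - (\<Sum>l\<in>L. q l * ln (q l))"
    if h: "\<exists>u p. ortho I I u \<and> spanning I I u \<and> expands I I u p X \<and> h = - (\<Sum>k\<in>I. p k * ln (p k))" for h
  proof -
    obtain u p where "ortho I I u" "spanning I I u" "expands I I u p X" "h = - (\<Sum>k\<in>I. p k * ln (p k))"
      using h by blast
    then show ?thesis using expansion_sum_unique[OF fin(1,1,2) _ _ _ w, of u p "\<lambda>x. x * ln x"] by simp
  qed
  moreover have "\<exists>h u p. ortho I I u \<and> spanning I I u \<and> expands I I u p X \<and> h = - (\<Sum>k\<in>I. p k * ln (p k))"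
    using spectral_theorem[OF fin(1) pos_hermitian[OF fin(1) X]] by blast
  ultimately show ?thesis unfolding entropy_def by (rule someI2_ex[rotated])
qed

section \<open>Monotonicity of the relative entropy\<close>

text \<open>Integrating the resolvent bound up to \<open>T\<close> compares sums that both grow like
  \<open>S * ln T\<close>. The equal total weights assumed in \<open>s\<close> let this growth
  cancel, and the limit of large \<open>T\<close> leaves the logarithmic sums.\<close>

lemma resolvent_bound_imp_log_bound:
  fixes c p q :: "'x \<Rightarrow> real" and c' p' q' :: "'y \<Rightarrow> real"
  assumes c: "\<And>x. x \<in> P \<Longrightarrow> 0 \<le> c x" "\<And>x. x \<in> P \<Longrightarrow> 0 \<le> p x" "\<And>x. x \<in> P \<Longrightarrow> 0 \<le> q x"
      "\<And>x. x \<in> P \<Longrightarrow> q x = 0 \<Longrightarrow> c x * p x = 0"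
    and c': "\<And>x. x \<in> P' \<Longrightarrow> 0 \<le> c' x" "\<And>x. x \<in> P' \<Longrightarrow> 0 \<le> p' x" "\<And>x. x \<in> P' \<Longrightarrow> 0 \<le> q' x"
      "\<And>x. x \<in> P' \<Longrightarrow> q' x = 0 \<Longrightarrow> c' x * p' x = 0"
    and F: "\<And>t. 0 \<le> t \<Longrightarrow> (\<Sum>x\<in>P'. c' x * (p' x)\<^sup>2 / (q' x + t * p' x)) \<le> (\<Sum>x\<in>P. c x * (p x)\<^sup>2 / (q x + t * p x))"
    and s: "(\<Sum>x\<in>P'. c' x * p' x) = (\<Sum>x\<in>P. c x * p x)"
  shows "(\<Sum>x\<in>P'. c' x * p' x * (ln (p' x) - ln (q' x))) \<le> (\<Sum>x\<in>P. c x * p x * (ln (p x) - ln (q x)))"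
proof -
  \<comment> \<open>The integral of the resolvent sum from \<open>0\<close> to \<open>T\<close>,
    normalised to vanish at \<open>T = 0\<close>.\<close>
  define G where "G T = (\<Sum>x\<in>P. c x * p x * (ln (q x + T * p x) - ln (q x)))" for T
  define G' where "G' T = (\<Sum>x\<in>P'. c' x * p' x * (ln (q' x + T * p' x) - ln (q' x)))" for T
  \<comment> \<open>If \<open>d = 0\<close>, the coefficient \<open>a * b\<close> vanishes and the
    function is constantly zero; otherwise the argument of the logarithm stays positive.\<close>
  have der1: "((\<lambda>T. a * b * (ln (d + T * b) - ln d)) has_real_derivative a * b\<^sup>2 / (d + T * b)) (at T)"
    if "0 \<le> b" "0 \<le> d" "d = 0 \<Longrightarrow> a * b = 0" "0 \<le> T" for a b d T :: real
  proof (cases "a * b = 0")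
    case False
    then have "0 < d" using that by (auto simp: less_le)
    then have "0 < d + T * b" using that by (simp add: add_pos_nonneg)
    then show ?thesis
      by (auto intro!: derivative_eq_intros simp: power2_eq_square)
  qed (auto simp: power2_eq_square)
  have G: "(G has_real_derivative (\<Sum>x\<in>P. c x * (p x)\<^sup>2 / (q x + T * p x))) (at T)" if "0 \<le> T" for T
    unfolding G_def using c that by (intro DERIV_sum der1) auto
  have G': "(G' has_real_derivative (\<Sum>x\<in>P'. c' x * (p' x)\<^sup>2 / (q' x + T * p' x))) (at T)" if "0 \<le> T" for T
    unfolding G'_def using c' that by (intro DERIV_sum der1) auto
  have GG: "G' T \<le> G T" if T: "0 \<le> T" for T
  proof -
    have "G 0 - G' 0 \<le> G T - G' T"
    proof (rule DERIV_nonneg_imp_nondecreasing[OF T])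
      fix x :: real assume "0 \<le> x"
      from DERIV_diff[OF G[OF this] G'[OF this]] F[OF this]
      show "\<exists>y. ((\<lambda>T. G T - G' T) has_real_derivative y) (at x) \<and> 0 \<le> y"
        by (intro exI conjI) (assumption, simp)
    qed
    then show ?thesis by (simp add: G_def G'_def)
  qed
  define S where "S = (\<Sum>x\<in>P. c x * p x)"
  define D where "D = (\<Sum>x\<in>P. c x * p x * (ln (p x) - ln (q x)))"
  define D' where "D' = (\<Sum>x\<in>P'. c' x * p' x * (ln (p' x) - ln (q' x)))"
  define C where "C = (\<Sum>x\<in>P. c x * q x)"
  have C: "0 \<le> C" unfolding C_def using c by (intro sum_nonneg) simp
  \<comment> \<open>Dropping the nonnegative \<open>q' x\<close> from the logarithm suffices on this
    side.\<close>
  have lower: "D' + S * ln T \<le> G' T" if T: "0 < T" for T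
  proof -
    have "c' x * p' x * (ln (p' x) - ln (q' x)) + c' x * p' x * ln T
        \<le> c' x * p' x * (ln (q' x + T * p' x) - ln (q' x))" if x: "x \<in> P'" for x
    proof (cases "p' x = 0")
      case False
      then have "0 < p' x" using c'(2)[OF x] by simp
      then have "ln (p' x) + ln T = ln (T * p' x)" using T by (simp add: ln_mult)
      also have "\<dots> \<le> ln (q' x + T * p' x)" using \<open>0 < p' x\<close> T c'(3)[OF x] by (intro ln_mono) auto
      finally show ?thesis
        unfolding distrib_left[symmetric] using c'(1,2)[OF x] by (intro mult_left_mono) auto
    qed simp
    then have "(\<Sum>x\<in>P'. c' x * p' x * (ln (p' x) - ln (q' x)) + c' x * p' x * ln T) \<le> G' T"
      unfolding G'_def by (rule sum_mono)
    then show ?thesis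
      by (simp add: sum.distrib sum_distrib_right[symmetric] D'_def S_def s)
  qed
  \<comment> \<open>Factor \<open>T * p x\<close> out of the logarithm and use
    \<open>ln (1 + y) \<le> y\<close> with \<open>y = q x / (T * p x)\<close>; the errors add up to
    \<open>C / T\<close>.\<close>
  have upper: "G T \<le> D + S * ln T + C / T" if T: "0 < T" for T
  proof -
    have "c x * p x * (ln (q x + T * p x) - ln (q x))
        \<le> c x * p x * (ln (p x) - ln (q x)) + c x * p x * ln T + c x * q x / T" if x: "x \<in> P" for x
    proof (cases "p x = 0")
      case False
      then have p: "0 < p x" using c(2)[OF x] by simp
      have "q x + T * p x = T * p x * (1 + q x / (T * p x))" using T p by (simp add: field_simps)
      moreover have "0 < 1 + q x / (T * p x)" using T p c(3)[OF x] by (simp add: add_pos_nonneg)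
      ultimately have "ln (q x + T * p x) = ln (p x) + ln T + ln (1 + q x / (T * p x))"
        using T p by (simp add: ln_mult)
      also have "\<dots> \<le> ln (p x) + ln T + q x / (T * p x)"
        using T p c(3)[OF x] by (intro add_left_mono ln_add_one_self_le_self) simp
      finally have "c x * p x * (ln (q x + T * p x) - ln (q x)) \<le> c x * p x * (ln (p x) - ln (q x) + ln T + q x / (T * p x))"
        using c(1,2)[OF x] by (intro mult_left_mono) auto
      also have "\<dots> = c x * p x * (ln (p x) - ln (q x)) + c x * p x * ln T + c x * q x / T"
        using p T by (simp add: field_simps)
      finally show ?thesis .
    qed (use c(1,3)[OF x] T in simp)
    then have "G T \<le> (\<Sum>x\<in>P. c x * p x * (ln (p x) - ln (q x)) + c x * p x * ln T + c x * q x / T)"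
      unfolding G_def by (rule sum_mono)
    then show ?thesis
      by (simp add: sum.distrib sum_distrib_right[symmetric] sum_divide_distrib[symmetric] D_def S_def C_def)
  qed
  have "D' \<le> D + e" if e: "0 < e" for e
  proof -
    \<comment> \<open>Then \<open>e * T = C + e\<close>, so \<open>C / T \<le> e\<close>; the
      summand \<open>1\<close> keeps \<open>T\<close> positive when \<open>C = 0\<close>.\<close>
    define T where "T = C / e + 1"
    have T: "0 < T" using C e by (simp add: T_def add_nonneg_pos)
    have "C / T \<le> e" using T e by (simp add: divide_le_eq T_def field_simps)
    then show ?thesis using lower[OF T] upper[OF T] GG[of T] T by linarith
  qed
  then show ?thesis unfolding D_def D'_def by (rule field_le_epsilon)
qed

text \<open>For orthonormal eigenbases this is \<open>tr rho (ln rho - ln sigma)\<close> in terms of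
  eigenvalues and overlaps, provided the support of \<open>rho\<close> lies in that of
  \<open>sigma\<close>. Then a term with \<open>q l = 0\<close> has coefficient zero, so the value
  \<open>ln 0 = 0\<close> has no influence.\<close>

definition relative_entropy ::
    "'i set \<Rightarrow> 'k set \<Rightarrow> ('k \<Rightarrow> 'i \<Rightarrow> complex) \<Rightarrow> ('k \<Rightarrow> real) \<Rightarrow>
     'l set \<Rightarrow> ('l \<Rightarrow> 'i \<Rightarrow> complex) \<Rightarrow> ('l \<Rightarrow> real) \<Rightarrow> real" where
  "relative_entropy I K u p L w q = (\<Sum>k\<in>K. \<Sum>l\<in>L. overlap I u w k l * p k * (ln (p k) - ln (q l)))"

lemma overlap_sum:
  assumes "finite I" "spanning I L w" "ortho I K u" "k \<in> K"
  shows "(\<Sum>l\<in>L. overlap I u w k l) = 1"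
proof -
  have "complex_of_real (sqnorm I (u k)) = 1"
    using assms(3,4) by (simp add: ip_self[symmetric] ortho_def)
  then show ?thesis unfolding overlap_def parseval_sqnorm[OF assms(1,2)] by simp
qed

lemma relative_entropy_mono:
  assumes I: "finite I" and J: "finite J" "finite K'" "finite L'"
    and trace_preserving: "trace_preserving A J I F"
    and u: "ortho I K u" "spanning I K u" "expands I K u p X" "\<And>k. k \<in> K \<Longrightarrow> 0 \<le> p k"
    and w: "spanning I L w" "expands I L w q Z" "\<And>l. l \<in> L \<Longrightarrow> 0 \<le> q l"
    and supp: "\<And>k l. k \<in> K \<Longrightarrow> l \<in> L \<Longrightarrow> q l = 0 \<Longrightarrow> overlap I u w k l * p k = 0"
    and u': "ortho J K' u'" "spanning J K' u'" "expands J K' u' p' (kraus A I F X)" "\<And>k. k \<in> K' \<Longrightarrow> 0 \<le> p' k"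
    and w': "ortho J L' w'" "spanning J L' w'" "expands J L' w' q' (kraus A I F Z)" "\<And>l. l \<in> L' \<Longrightarrow> 0 \<le> q' l"
    and supp': "\<And>k l. k \<in> K' \<Longrightarrow> l \<in> L' \<Longrightarrow> q' l = 0 \<Longrightarrow> overlap J u' w' k l * p' k = 0"
    and trace: "(\<Sum>k\<in>K'. p' k) = (\<Sum>k\<in>K. p k)"
  shows "relative_entropy J K' u' p' L' w' q' \<le> relative_entropy I K u p L w q"
proof -
  have "(\<Sum>x\<in>K' \<times> L'. overlap J u' w' (fst x) (snd x) * p' (fst x) * (ln (p' (fst x)) - ln (q' (snd x))))
    \<le> (\<Sum>x\<in>K \<times> L. overlap I u w (fst x) (snd x) * p (fst x) * (ln (p (fst x)) - ln (q (snd x))))"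
  proof (rule resolvent_bound_imp_log_bound)
    fix t :: real assume "0 \<le> t"
    show "(\<Sum>x\<in>K' \<times> L'. overlap J u' w' (fst x) (snd x) * (p' (fst x))\<^sup>2 / (q' (snd x) + t * p' (fst x)))
      \<le> (\<Sum>x\<in>K \<times> L. overlap I u w (fst x) (snd x) * (p (fst x))\<^sup>2 / (q (snd x) + t * p (fst x)))"
      by (rule resolvent_form_mono[OF I J trace_preserving \<open>0 \<le> t\<close> u(2-4) w supp u'(1-3) w'(1-3),
            unfolded resolvent_form_def sum.cartesian_product split_def])
  next
    \<comment> \<open>Overlaps with a complete family sum to one, so the total weight of either side
      is its trace.\<close>
    have "(\<Sum>k\<in>K'. \<Sum>l\<in>L'. overlap J u' w' k l * p' k) = (\<Sum>k\<in>K. \<Sum>l\<in>L. overlap I u w k l * p k)"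
      unfolding sum_distrib_right[symmetric]
      using overlap_sum[OF J(1) w'(2) u'(1)] overlap_sum[OF I w(1) u(1)] trace by simp
    then show "(\<Sum>x\<in>K' \<times> L'. overlap J u' w' (fst x) (snd x) * p' (fst x))
      = (\<Sum>x\<in>K \<times> L. overlap I u w (fst x) (snd x) * p (fst x))"
      unfolding sum.cartesian_product split_def .
  next
    fix x assume "x \<in> K \<times> L"
    then show "0 \<le> p (fst x)" "0 \<le> q (snd x)"
      "q (snd x) = 0 \<Longrightarrow> overlap I u w (fst x) (snd x) * p (fst x) = 0"
      using u(4) w(3) supp by (simp_all add: mem_Times_iff)
  next
    fix x assume "x \<in> K' \<times> L'"
    then show "0 \<le> p' (fst x)" "0 \<le> q' (snd x)"
      "q' (snd x) = 0 \<Longrightarrow> overlap J u' w' (fst x) (snd x) * p' (fst x) = 0"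
      using u'(4) w'(4) supp' by (simp_all add: mem_Times_iff)
  qed (simp_all add: overlap_def)
  then show ?thesis unfolding relative_entropy_def sum.cartesian_product split_def .
qed

lemma expands_trace:
  assumes "expands I K u p X" "ortho I K u"
  shows "complex_of_real (\<Sum>k\<in>K. p k) = (\<Sum>i\<in>I. X i i)"
proof -
  have "(\<Sum>i\<in>I. X i i) = (\<Sum>i\<in>I. \<Sum>k\<in>K. complex_of_real (p k) * (u k i * cnj (u k i)))"
    using assms(1) by (intro sum.cong refl) (simp add: expands_def mult.assoc)
  also have "\<dots> = (\<Sum>k\<in>K. complex_of_real (p k) * ip I (u k) (u k))"
    by (subst sum.swap) (simp add: ip_def sum_distrib_left)
  finally show ?thesis using assms(2) by (simp add: ortho_def)
qed

lemma trace_kraus: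
  assumes I: "finite I" and trace_preserving: "trace_preserving A J I F"
  shows "(\<Sum>j\<in>J. kraus A I F X j j) = (\<Sum>i\<in>I. X i i)"
proof -
  have "(\<Sum>j\<in>J. kraus A I F X j j) = (\<Sum>a\<in>A. \<Sum>j\<in>J. \<Sum>i\<in>I. \<Sum>i'\<in>I. X i i' * (F a j i * cnj (F a j i')))"
    unfolding kraus_def by (subst sum.swap) (simp only: mult_ac)
  also have "\<dots> = (\<Sum>(a, j)\<in>A \<times> J. \<Sum>i\<in>I. \<Sum>i'\<in>I. X i i' * (F a j i * cnj (F a j i')))"
    by (rule sum.cartesian_product)
  also have "\<dots> = (\<Sum>i\<in>I. \<Sum>(a, j)\<in>A \<times> J. \<Sum>i'\<in>I. X i i' * (F a j i * cnj (F a j i')))"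
    unfolding split_def by (rule sum.swap)
  also have "\<dots> = (\<Sum>i\<in>I. \<Sum>i'\<in>I. \<Sum>(a, j)\<in>A \<times> J. X i i' * (F a j i * cnj (F a j i')))"
    unfolding split_def by (rule sum.cong[OF refl], rule sum.swap)
  also have "\<dots> = (\<Sum>i\<in>I. \<Sum>i'\<in>I. X i i' * ip (A \<times> J) (\<lambda>(a, j). F a j i) (\<lambda>(a, j). F a j i'))"
    by (simp add: ip_def split_def sum_distrib_left)
  also have "\<dots> = (\<Sum>i\<in>I. \<Sum>i'\<in>I. if i' = i then X i i' else 0)"
    using trace_preserving by (intro sum.cong refl) (auto simp: trace_preserving_def ortho_def)
  finally show ?thesis using I by simp
qed

lemma expands_pos:
  assumes "expands I K u p X" "\<And>k. k \<in> K \<Longrightarrow> 0 \<le> p k"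
  shows "pos I X"
  unfolding pos_def
proof
  fix x
  have "ip I (mv I X x) x = complex_of_real (\<Sum>k\<in>K. p k * (cmod (ip I x (u k)))\<^sup>2)"
    unfolding ip_expands[OF assms(1)] of_real_sum of_real_mult
    by (intro sum.cong refl) (simp add: complex_norm_square ip_cnj mult_ac del: of_real_power)
  moreover have "0 \<le> (\<Sum>k\<in>K. p k * (cmod (ip I x (u k)))\<^sup>2)"
    using assms(2) by (intro sum_nonneg) simp
  ultimately show "0 \<le> ip I (mv I X x) x" by (simp add: less_eq_complex_def)
qed

lemma pos_kraus:
  assumes "finite I" "pos I X" shows "pos J (kraus A I F X)"
proof -
  obtain u p where "expands I I u p X" "\<And>k. k \<in> I \<Longrightarrow> 0 \<le> p k"
    using spectral_theorem_pos[OF assms] by blast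
  then show ?thesis by (intro expands_pos[OF expands_kraus]) auto
qed

lemma expands_cong:
  "(\<And>i j. i \<in> I \<Longrightarrow> j \<in> I \<Longrightarrow> X i j = X' i j) \<Longrightarrow> expands I K u p X \<longleftrightarrow> expands I K u p X'"
  by (simp add: expands_def)

lemma pos_cong:
  assumes "\<And>i j. i \<in> I \<Longrightarrow> j \<in> I \<Longrightarrow> X i j = X' i j" shows "pos I X \<longleftrightarrow> pos I X'"
proof -
  have "ip I (mv I X x) x = ip I (mv I X' x) x" for x
    using assms by (intro ip_cong mv_cong) auto
  then show ?thesis by (simp add: pos_def)
qed

lemma entropy_cong:
  assumes "\<And>i j. i \<in> I \<Longrightarrow> j \<in> I \<Longrightarrow> X i j = X' i j" shows "entropy I X = entropy I X'"
proof -
  have "expands I I u p X \<longleftrightarrow> expands I I u p X'" for u p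
    using assms by (rule expands_cong)
  then show ?thesis by (simp add: entropy_def)
qed

lemma pos_reindex:
  fixes f :: "'a \<Rightarrow> 'b"
  assumes f: "bij_betw f J I" and X: "pos I X"
  shows "pos J (\<lambda>i j. X (f i) (f j))"
  unfolding pos_def
proof
  fix x :: "'a \<Rightarrow> complex"
  define y where "y = x \<circ> the_inv_into J f"
  have x: "x j = y (f j)" if "j \<in> J" for j
    using f that by (simp add: y_def bij_betw_def the_inv_into_f_f)
  have "ip J (mv J (\<lambda>i j. X (f i) (f j)) x) x = ip J (\<lambda>j. mv I X y (f j)) (\<lambda>j. y (f j))"
  proof (rule ip_cong)
    fix i
    have "mv J (\<lambda>i j. X (f i) (f j)) x i = (\<Sum>j\<in>J. X (f i) (f j) * y (f j))"
      by (simp add: mv_def x)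
    also have "\<dots> = mv I X y (f i)"
      unfolding mv_def by (rule sum.reindex_bij_betw[OF f])
    finally show "mv J (\<lambda>i j. X (f i) (f j)) x i = mv I X y (f i)" .
  qed (rule x)
  also have "\<dots> = ip I (mv I X y) y" by (rule ip_reindex[OF f])
  finally show "0 \<le> ip J (mv J (\<lambda>i j. X (f i) (f j)) x) x" using X by (simp add: pos_def)
qed

text \<open>Every regrouping or permutation of tensor factors is an instance of such a change of
  index set.\<close>

lemma entropy_reindex:
  assumes f: "bij_betw f J I" and I: "finite I" and X: "pos I X"
  shows "entropy J (\<lambda>i j. X (f i) (f j)) = entropy I X"
proof -
  obtain u p where u: "ortho I I u" "expands I I u p X"
    using spectral_theorem_pos[OF I X] by metis
  have "ortho J I (\<lambda>k j. u k (f j))"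
    using u(1) by (simp add: ortho_def ip_reindex[OF f])
  moreover have "expands J I (\<lambda>k j. u k (f j)) p (\<lambda>i j. X (f i) (f j))"
    using u(2) bij_betwE[OF f] by (simp add: expands_def)
  moreover have "finite J" using f I by (simp add: bij_betw_finite)
  ultimately have "entropy J (\<lambda>i j. X (f i) (f j)) = - (\<Sum>l\<in>I. p l * ln (p l))"
    using entropy_eq[OF _ I pos_reindex[OF f X]] by blast
  then show ?thesis using entropy_eq[OF I I X u] by simp
qed

section \<open>Conditional entropy\<close>

definition trace_first :: "'b set \<Rightarrow> ('b \<times> 'x \<Rightarrow> 'b \<times> 'x \<Rightarrow> complex) \<Rightarrow> 'x \<Rightarrow> 'x \<Rightarrow> complex" where
  "trace_first B R x x' = (\<Sum>b\<in>B. R (b, x) (b, x'))"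

definition id_tensor :: "('x \<Rightarrow> 'x \<Rightarrow> complex) \<Rightarrow> 'b \<times> 'x \<Rightarrow> 'b \<times> 'x \<Rightarrow> complex" where
  "id_tensor Z = (\<lambda>(b, x) (b', x'). if b = b' then Z x x' else 0)"

text \<open>The product vector \<open>|b> \<otimes> v\<close>. With \<open>v\<close> running through
  an eigenbasis of \<open>Z\<close>, these vectors form an eigenbasis of
  \<open>id_tensor Z\<close>.\<close>

definition embed_at :: "'b \<Rightarrow> ('x \<Rightarrow> complex) \<Rightarrow> 'b \<times> 'x \<Rightarrow> complex" where
  "embed_at b v = (\<lambda>(b', x). if b' = b then v x else 0)"

lemma sum_prod_delta:
  assumes "finite B" "b \<in> B"
  shows "(\<Sum>z\<in>B \<times> X. case z of (b', x) \<Rightarrow> if b' = b then g x else (0::complex)) = (\<Sum>x\<in>X. g x)"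
proof -
  have "(\<Sum>z\<in>B \<times> X. case z of (b', x) \<Rightarrow> if b' = b then g x else 0)
      = (\<Sum>b'\<in>B. \<Sum>x\<in>X. if b' = b then g x else 0)"
    by (rule sum.cartesian_product[symmetric])
  also have "\<dots> = (\<Sum>b'\<in>B. if b' = b then \<Sum>x\<in>X. g x else 0)"
    by (intro sum.cong refl) auto
  finally show ?thesis using assms by simp
qed

lemma mv_embed:
  assumes "finite B" "b \<in> B"
  shows "mv (B \<times> X) R (embed_at b v) z = (\<Sum>x\<in>X. R z (b, x) * v x)"
proof -
  have "mv (B \<times> X) R (embed_at b v) z = (\<Sum>y\<in>B \<times> X. case y of (b', x) \<Rightarrow> if b' = b then R z (b, x) * v x else 0)"
    unfolding mv_def embed_at_def by (intro sum.cong refl) auto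
  then show ?thesis unfolding sum_prod_delta[OF assms] .
qed

lemma ip_embed:
  assumes "finite B" "b \<in> B"
  shows "ip (B \<times> X) z (embed_at b v) = ip X (\<lambda>x. z (b, x)) v"
proof -
  have "ip (B \<times> X) z (embed_at b v) = (\<Sum>y\<in>B \<times> X. case y of (b', x) \<Rightarrow> if b' = b then z (b, x) * cnj (v x) else 0)"
    unfolding ip_def embed_at_def by (intro sum.cong refl) auto
  then show ?thesis unfolding sum_prod_delta[OF assms] ip_def .
qed

lemma ip_trace_first:
  assumes "finite B"
  shows "ip X (mv X (trace_first B R) v) v = (\<Sum>b\<in>B. ip (B \<times> X) (mv (B \<times> X) R (embed_at b v)) (embed_at b v))"
proof -
  have "ip X (mv X (trace_first B R) v) v = (\<Sum>x\<in>X. (\<Sum>b\<in>B. \<Sum>x'\<in>X. R (b, x) (b, x') * v x') * cnj (v x))"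
    unfolding ip_def mv_def trace_first_def sum_distrib_right
    by (rule sum.cong[OF refl], rule sum.swap)
  also have "\<dots> = (\<Sum>b\<in>B. \<Sum>x\<in>X. (\<Sum>x'\<in>X. R (b, x) (b, x') * v x') * cnj (v x))"
    unfolding sum_distrib_right[of _ B] by (rule sum.swap)
  finally show ?thesis
    by (simp add: ip_embed mv_embed assms ip_def[of X])
qed

lemma pos_trace_first:
  assumes "finite B" "pos (B \<times> X) R" shows "pos X (trace_first B R)"
  using assms by (auto simp: pos_def ip_trace_first intro!: sum_nonneg)

lemma ortho_embed:
  assumes B: "finite B" and w: "ortho X L w"
  shows "ortho (B \<times> X) (B \<times> L) (\<lambda>(b, l). embed_at b (w l))"
  unfolding ortho_def
proof (intro ballI)
  fix k k' assume "k \<in> B \<times> L" "k' \<in> B \<times> L"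
  then obtain b l b' l' where k: "k = (b, l)" "k' = (b', l')"
    and bl: "b \<in> B" "l \<in> L" "b' \<in> B" "l' \<in> L" by auto
  have "ip (B \<times> X) (embed_at b (w l)) (embed_at b' (w l')) = (if b = b' then ip X (w l) (w l') else 0)"
    unfolding ip_embed[OF B bl(3)] by (simp add: embed_at_def ip_def)
  then show "ip (B \<times> X) (case k of (b, l) \<Rightarrow> embed_at b (w l)) (case k' of (b, l) \<Rightarrow> embed_at b (w l)) = (if k = k' then 1 else 0)"
    using w bl by (simp add: ortho_def k)
qed

lemma sum_embed:
  assumes "finite B" "b \<in> B"
  shows "(\<Sum>z\<in>B \<times> L. complex_of_real (q (snd z)) * embed_at (fst z) (w (snd z)) (b, x) * cnj (embed_at (fst z) (w (snd z)) (b', x')))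
    = (if b = b' then \<Sum>l\<in>L. complex_of_real (q l) * w l x * cnj (w l x') else 0)"
proof -
  have "(\<Sum>z\<in>B \<times> L. complex_of_real (q (snd z)) * embed_at (fst z) (w (snd z)) (b, x) * cnj (embed_at (fst z) (w (snd z)) (b', x')))
    = (\<Sum>z\<in>B \<times> L. case z of (c, l) \<Rightarrow> if c = b then
         (if b = b' then complex_of_real (q l) * w l x * cnj (w l x') else 0) else 0)"
    by (intro sum.cong refl) (auto simp: embed_at_def)
  then show ?thesis unfolding sum_prod_delta[OF assms] by simp
qed

lemma spanning_embed:
  assumes B: "finite B" and w: "spanning X L w"
  shows "spanning (B \<times> X) (B \<times> L) (\<lambda>(b, l). embed_at b (w l))"
  unfolding spanning_def
proof (clarify)
  fix b x b' x' assume "b \<in> B" "x \<in> X" "b' \<in> B" "x' \<in> X"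
  then show "(\<Sum>k\<in>B \<times> L. (case k of (b, l) \<Rightarrow> embed_at b (w l)) (b, x) * cnj ((case k of (b, l) \<Rightarrow> embed_at b (w l)) (b', x')))
      = (if (b, x) = (b', x') then 1 else 0)"
    using sum_embed[OF B, where b = b and L = L and q = "\<lambda>_. 1" and w = w and x = x and b' = b' and x' = x'] w by (simp add: split_def spanning_def)
qed

lemma expands_embed:
  assumes B: "finite B" and w: "expands X L w q Z"
  shows "expands (B \<times> X) (B \<times> L) (\<lambda>(b, l). embed_at b (w l)) (\<lambda>(b, l). q l) (id_tensor Z)"
  unfolding expands_def
proof (clarify)
  fix b x b' x' assume "b \<in> B" "x \<in> X" "b' \<in> B" "x' \<in> X"
  then show "id_tensor Z (b, x) (b', x') = (\<Sum>k\<in>B \<times> L. complex_of_real (case k of (b, l) \<Rightarrow> q l) *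
      (case k of (b, l) \<Rightarrow> embed_at b (w l)) (b, x) * cnj ((case k of (b, l) \<Rightarrow> embed_at b (w l)) (b', x')))"
    using sum_embed[OF B, where b = b and L = L and q = q and w = w and x = x and b' = b' and x' = x'] w by (simp add: split_def expands_def id_tensor_def)
qed

text \<open>The left-hand side is the sum over \<open>b\<close> of the diagonal values of
  \<open>R\<close> at \<open>|b> \<otimes> w_l\<close>, which is the diagonal value of the marginal
  at its own eigenvector \<open>w l\<close>.\<close>

lemma overlap_embed_sum:
  assumes fin: "finite B" "finite X" "finite L"
    and u: "expands (B \<times> X) K u p R"
    and w: "ortho X L w" "expands X L w q (trace_first B R)" and l: "l \<in> L"
  shows "(\<Sum>b\<in>B. \<Sum>k\<in>K. overlap (B \<times> X) u (\<lambda>(b, l). embed_at b (w l)) k (b, l) * p k) = q l"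
proof -
  have "complex_of_real (\<Sum>b\<in>B. \<Sum>k\<in>K. overlap (B \<times> X) u (\<lambda>(b, l). embed_at b (w l)) k (b, l) * p k)
      = (\<Sum>b\<in>B. ip (B \<times> X) (mv (B \<times> X) R (embed_at b (w l))) (embed_at b (w l)))"
    unfolding ip_expands[OF u] of_real_sum of_real_mult overlap_def
    by (intro sum.cong refl)
      (simp add: complex_norm_square ip_cnj mult_ac del: of_real_power)
  also have "\<dots> = ip X (mv X (trace_first B R) (w l)) (w l)" by (rule ip_trace_first[OF fin(1), symmetric])
  also have "\<dots> = complex_of_real (q l)"
    using expands_eigen[OF fin(3) w l] w(1) l by (simp add: ortho_def)
  finally show ?thesis unfolding of_real_eq_iff .
qed

text \<open>The support condition for a state against the identity tensor its marginal: by
  \<open>overlap_embed_sum\<close> these nonnegative weights add up to the eigenvalue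
  \<open>q l\<close>, so all of them vanish with it.\<close>

lemma overlap_embed_zero:
  assumes fin: "finite B" "finite X" "finite L" "finite K"
    and u: "expands (B \<times> X) K u p R" and p: "\<And>k. k \<in> K \<Longrightarrow> 0 \<le> p k"
    and w: "ortho X L w" "expands X L w q (trace_first B R)"
    and kl: "k \<in> K" "bl \<in> B \<times> L" "(case bl of (b, l) \<Rightarrow> q l) = 0"
  shows "overlap (B \<times> X) u (\<lambda>(b, l). embed_at b (w l)) k bl * p k = 0"
proof -
  obtain b l where bl: "bl = (b, l)" "b \<in> B" "l \<in> L" using kl by auto
  have nn: "0 \<le> overlap (B \<times> X) u (\<lambda>(b, l). embed_at b (w l)) k y * p k" if "k \<in> K" for k y
    using p[OF that] by (simp add: overlap_def)
  have "(\<Sum>b\<in>B. \<Sum>k\<in>K. overlap (B \<times> X) u (\<lambda>(b, l). embed_at b (w l)) k (b, l) * p k) = 0"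
    using overlap_embed_sum[OF fin(1-3) u w bl(3)] kl bl by simp
  then have "(\<Sum>k\<in>K. overlap (B \<times> X) u (\<lambda>(b, l). embed_at b (w l)) k (b, l) * p k) = 0"
    using nn bl fin by (subst (asm) sum_nonneg_eq_0_iff) (auto intro: sum_nonneg)
  then show ?thesis
    using nn kl fin unfolding bl by (subst (asm) sum_nonneg_eq_0_iff) auto
qed

text \<open>In the part with \<open>ln (p k)\<close> the overlaps sum to one over the second index;
  in the part with \<open>ln (q l)\<close> the weights sum to \<open>q l\<close> over the first.
  Each double sum thus collapses to one entropy.\<close>

lemma relative_entropy_embed:
  assumes fin: "finite B" "finite X" "finite L" "finite K"
    and R: "pos (B \<times> X) R"
    and u: "ortho (B \<times> X) K u" "expands (B \<times> X) K u p R"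
    and w: "ortho X L w" "spanning X L w" "expands X L w q (trace_first B R)"
  shows "relative_entropy (B \<times> X) K u p (B \<times> L) (\<lambda>(b, l). embed_at b (w l)) (\<lambda>(b, l). q l)
    = entropy X (trace_first B R) - entropy (B \<times> X) R"
proof -
  let ?w = "\<lambda>(b, l). embed_at b (w l)"
  let ?o = "overlap (B \<times> X) u ?w"
  have "(\<Sum>k\<in>K. \<Sum>z\<in>B \<times> L. ?o k z * p k * ln (p k)) = (\<Sum>k\<in>K. (\<Sum>z\<in>B \<times> L. ?o k z) * (p k * ln (p k)))"
    by (simp add: sum_distrib_right mult.assoc)
  also have "\<dots> = (\<Sum>k\<in>K. p k * ln (p k))"
    using overlap_sum[OF _ spanning_embed[OF fin(1) w(2)] u(1)] fin by simp
  also have "\<dots> = - entropy (B \<times> X) R"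
    using entropy_eq[OF _ fin(4) R u] fin by simp
  finally have 1: "(\<Sum>k\<in>K. \<Sum>z\<in>B \<times> L. ?o k z * p k * ln (p k)) = - entropy (B \<times> X) R" .
  have "(\<Sum>k\<in>K. \<Sum>z\<in>B \<times> L. ?o k z * p k * ln (case z of (b, l) \<Rightarrow> q l))
      = (\<Sum>k\<in>K. \<Sum>b\<in>B. \<Sum>l\<in>L. ?o k (b, l) * p k * ln (q l))"
    by (simp add: sum.cartesian_product split_def)
  also have "\<dots> = (\<Sum>b\<in>B. \<Sum>k\<in>K. \<Sum>l\<in>L. ?o k (b, l) * p k * ln (q l))" by (rule sum.swap)
  also have "\<dots> = (\<Sum>b\<in>B. \<Sum>l\<in>L. \<Sum>k\<in>K. ?o k (b, l) * p k * ln (q l))"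
    by (rule sum.cong[OF refl], rule sum.swap)
  also have "\<dots> = (\<Sum>l\<in>L. \<Sum>b\<in>B. \<Sum>k\<in>K. ?o k (b, l) * p k * ln (q l))" by (rule sum.swap)
  also have "\<dots> = (\<Sum>l\<in>L. q l * ln (q l))"
    using overlap_embed_sum[OF fin(1-3) u(2) w(1,3)] by (simp add: sum_distrib_right[symmetric])
  also have "\<dots> = - entropy X (trace_first B R)"
    using entropy_eq[OF fin(2,3) pos_trace_first[OF fin(1) R] w(1,3)] by simp
  finally have 2: "(\<Sum>k\<in>K. \<Sum>z\<in>B \<times> L. ?o k z * p k * ln (case z of (b, l) \<Rightarrow> q l)) = - entropy X (trace_first B R)" .
  show ?thesis
    unfolding relative_entropy_def right_diff_distrib sum_subtractf 1 2 by simp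
qed

section \<open>Channels on the conditioning system\<close>

definition lift_kraus :: "('a \<Rightarrow> 'y \<Rightarrow> 'x \<Rightarrow> complex) \<Rightarrow> 'a \<Rightarrow> 'b \<times> 'y \<Rightarrow> 'b \<times> 'x \<Rightarrow> complex" where
  "lift_kraus F a = (\<lambda>(b, y) (b', x). if b' = b then F a y x else 0)"

lemma kraus_lift:
  assumes B: "finite B" "b \<in> B" "b' \<in> B"
  shows "kraus A (B \<times> X) (lift_kraus F) R (b, y) (b', y')
    = (\<Sum>a\<in>A. \<Sum>x\<in>X. \<Sum>x'\<in>X. F a y x * R (b, x) (b', x') * cnj (F a y' x'))"
  unfolding kraus_def
proof (rule sum.cong[OF refl])
  fix a
  have "(\<Sum>z'\<in>B \<times> X. lift_kraus F a (b, y) z * R z z' * cnj (lift_kraus F a (b', y') z'))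
      = (\<Sum>x'\<in>X. lift_kraus F a (b, y) z * R z (b', x') * cnj (F a y' x'))" for z
  proof -
    have "(\<Sum>z'\<in>B \<times> X. lift_kraus F a (b, y) z * R z z' * cnj (lift_kraus F a (b', y') z'))
      = (\<Sum>z'\<in>B \<times> X. case z' of (c, x') \<Rightarrow> if c = b' then
          lift_kraus F a (b, y) z * R z (b', x') * cnj (F a y' x') else 0)"
      by (intro sum.cong refl) (auto simp: lift_kraus_def)
    then show ?thesis unfolding sum_prod_delta[OF B(1,3)] .
  qed
  then have "(\<Sum>z\<in>B \<times> X. \<Sum>z'\<in>B \<times> X. lift_kraus F a (b, y) z * R z z' * cnj (lift_kraus F a (b', y') z'))
      = (\<Sum>z\<in>B \<times> X. case z of (c, x) \<Rightarrow> if c = b then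
          \<Sum>x'\<in>X. F a y x * R (b, x) (b', x') * cnj (F a y' x') else 0)"
    by (simp only:) (intro sum.cong refl, auto simp: lift_kraus_def)
  then show "(\<Sum>z\<in>B \<times> X. \<Sum>z'\<in>B \<times> X. lift_kraus F a (b, y) z * R z z' * cnj (lift_kraus F a (b', y') z'))
      = (\<Sum>x\<in>X. \<Sum>x'\<in>X. F a y x * R (b, x) (b', x') * cnj (F a y' x'))"
    unfolding sum_prod_delta[OF B(1,2)] .
qed

lemma trace_preserving_lift:
  assumes B: "finite B" and trace_preserving: "trace_preserving A Y X F"
  shows "trace_preserving A (B \<times> Y) (B \<times> X) (lift_kraus F)"
  unfolding trace_preserving_def ortho_def
proof (clarify)
  fix b1 x1 b2 x2 assume *: "b1 \<in> B" "x1 \<in> X" "b2 \<in> B" "x2 \<in> X"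
  have "ip (A \<times> B \<times> Y) (\<lambda>(a, j). lift_kraus F a j (b1, x1)) (\<lambda>(a, j). lift_kraus F a j (b2, x2))
    = (\<Sum>a\<in>A. \<Sum>z\<in>B \<times> Y. lift_kraus F a z (b1, x1) * cnj (lift_kraus F a z (b2, x2)))"
    by (simp add: ip_def sum.cartesian_product split_def)
  also have "\<dots> = (\<Sum>a\<in>A. \<Sum>z\<in>B \<times> Y. case z of (b, y) \<Rightarrow> if b = b1 then
      (if b1 = b2 then F a y x1 * cnj (F a y x2) else 0) else 0)"
    by (intro sum.cong refl) (auto simp: lift_kraus_def)
  also have "\<dots> = (if b1 = b2 then ip (A \<times> Y) (\<lambda>(a, y). F a y x1) (\<lambda>(a, y). F a y x2) else 0)"
    unfolding sum_prod_delta[OF B *(1)]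
    by (simp add: ip_def sum.cartesian_product split_def)
  finally show "ip (A \<times> B \<times> Y) (\<lambda>(a, j). lift_kraus F a j (b1, x1)) (\<lambda>(a, j). lift_kraus F a j (b2, x2))
      = (if (b1, x1) = (b2, x2) then 1 else 0)"
    using trace_preserving * by (simp add: trace_preserving_def ortho_def)
qed

lemma trace_first_kraus_lift:
  assumes B: "finite B"
  shows "trace_first B (kraus A (B \<times> X) (lift_kraus F) R) y y' = kraus A X F (trace_first B R) y y'"
proof -
  have "trace_first B (kraus A (B \<times> X) (lift_kraus F) R) y y'
      = (\<Sum>b\<in>B. \<Sum>a\<in>A. \<Sum>x\<in>X. \<Sum>x'\<in>X. F a y x * R (b, x) (b, x') * cnj (F a y' x'))"
    unfolding trace_first_def by (intro sum.cong refl) (simp add: kraus_lift[OF B])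
  also have "\<dots> = (\<Sum>a\<in>A. \<Sum>b\<in>B. \<Sum>x\<in>X. \<Sum>x'\<in>X. F a y x * R (b, x) (b, x') * cnj (F a y' x'))"
    by (rule sum.swap)
  also have "\<dots> = (\<Sum>a\<in>A. \<Sum>x\<in>X. \<Sum>b\<in>B. \<Sum>x'\<in>X. F a y x * R (b, x) (b, x') * cnj (F a y' x'))"
    by (rule sum.cong[OF refl], rule sum.swap)
  also have "\<dots> = (\<Sum>a\<in>A. \<Sum>x\<in>X. \<Sum>x'\<in>X. \<Sum>b\<in>B. F a y x * R (b, x) (b, x') * cnj (F a y' x'))"
    by (rule sum.cong[OF refl], rule sum.cong[OF refl], rule sum.swap)
  finally show ?thesis by (simp add: kraus_def trace_first_def sum_distrib_left sum_distrib_right)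
qed

lemma kraus_lift_id_tensor:
  assumes B: "finite B" "b \<in> B" "b' \<in> B"
  shows "kraus A (B \<times> X) (lift_kraus F) (id_tensor Z) (b, y) (b', y') = id_tensor (kraus A X F Z) (b, y) (b', y')"
  unfolding kraus_lift[OF B] by (simp add: id_tensor_def kraus_def)

lemma cond_entropy_mono:
  assumes fin: "finite B" "finite X" "finite Y" "finite A"
    and R: "pos (B \<times> X) R" and trace_preserving: "trace_preserving A Y X F"
  defines "R' \<equiv> kraus A (B \<times> X) (lift_kraus F) R"
  shows "entropy (B \<times> X) R - entropy X (trace_first B R) \<le> entropy (B \<times> Y) R' - entropy Y (trace_first B R')"
proof -
  have fBX: "finite (B \<times> X)" and fBY: "finite (B \<times> Y)" using fin by auto
  have R': "pos (B \<times> Y) R'" unfolding R'_def by (rule pos_kraus[OF fBX R])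
  obtain u p where u: "ortho (B \<times> X) (B \<times> X) u" "spanning (B \<times> X) (B \<times> X) u"
      "expands (B \<times> X) (B \<times> X) u p R" "\<And>k. k \<in> B \<times> X \<Longrightarrow> 0 \<le> p k"
    using spectral_theorem_pos[OF fBX R] by blast
  obtain w q where w: "ortho X X w" "spanning X X w" "expands X X w q (trace_first B R)" "\<And>k. k \<in> X \<Longrightarrow> 0 \<le> q k"
    using spectral_theorem_pos[OF fin(2) pos_trace_first[OF fin(1) R]] by blast
  obtain u' p' where u': "ortho (B \<times> Y) (B \<times> Y) u'" "spanning (B \<times> Y) (B \<times> Y) u'"
      "expands (B \<times> Y) (B \<times> Y) u' p' R'" "\<And>k. k \<in> B \<times> Y \<Longrightarrow> 0 \<le> p' k"
    using spectral_theorem_pos[OF fBY R'] by blast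
  obtain w' q' where w': "ortho Y Y w'" "spanning Y Y w'" "expands Y Y w' q' (trace_first B R')" "\<And>k. k \<in> Y \<Longrightarrow> 0 \<le> q' k"
    using spectral_theorem_pos[OF fin(3) pos_trace_first[OF fin(1) R']] by blast
  \<comment> \<open>The channel acts on \<open>X\<close> alone, so it takes the identity tensor the
    input marginal to the identity tensor the output marginal. The output pair again has the form
    that \<open>relative_entropy_embed\<close> evaluates.\<close>
  have expands_out: "expands (B \<times> Y) (B \<times> Y) (\<lambda>(b, l). embed_at b (w' l)) (\<lambda>(b, l). q' l)
      (kraus A (B \<times> X) (lift_kraus F) (id_tensor (trace_first B R)))"
  proof -
    have "kraus A (B \<times> X) (lift_kraus F) (id_tensor (trace_first B R)) i j = id_tensor (trace_first B R') i j"
      if ij': "i \<in> B \<times> Y" "j \<in> B \<times> Y" for i j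
    proof -
      obtain b y b' y' where ij: "i = (b, y)" "j = (b', y')" "b \<in> B" "b' \<in> B" using ij' by auto
      show ?thesis
        unfolding ij(1,2) kraus_lift_id_tensor[OF fin(1) ij(3,4)]
        by (simp add: R'_def id_tensor_def trace_first_kraus_lift[OF fin(1)])
    qed
    then show ?thesis using expands_embed[OF fin(1) w'(3)] by (simp cong: expands_cong)
  qed
  have trace_preserving': "trace_preserving A (B \<times> Y) (B \<times> X) (lift_kraus F)" by (rule trace_preserving_lift[OF fin(1) trace_preserving])
  have "complex_of_real (\<Sum>k\<in>B \<times> Y. p' k) = complex_of_real (\<Sum>k\<in>B \<times> X. p k)"
    unfolding expands_trace[OF u'(3,1)] expands_trace[OF u(3,1)]
    unfolding R'_def by (rule trace_kraus[OF fBX trace_preserving'])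
  then have tr: "(\<Sum>k\<in>B \<times> Y. p' k) = (\<Sum>k\<in>B \<times> X. p k)" unfolding of_real_eq_iff .
  have "relative_entropy (B \<times> Y) (B \<times> Y) u' p' (B \<times> Y) (\<lambda>(b, l). embed_at b (w' l)) (\<lambda>(b, l). q' l)
    \<le> relative_entropy (B \<times> X) (B \<times> X) u p (B \<times> X) (\<lambda>(b, l). embed_at b (w l)) (\<lambda>(b, l). q l)"
  proof (rule relative_entropy_mono[OF fBX fBY fBY fBY trace_preserving' u spanning_embed[OF fin(1) w(2)]
        expands_embed[OF fin(1) w(3)] _ _ u'(1,2) u'(3)[unfolded R'_def] u'(4)
        ortho_embed[OF fin(1) w'(1)] spanning_embed[OF fin(1) w'(2)] expands_out _ _ tr])
    show "overlap (B \<times> X) u (\<lambda>(b, l). embed_at b (w l)) k l * p k = 0"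
      if "k \<in> B \<times> X" "l \<in> B \<times> X" "(case l of (b, l) \<Rightarrow> q l) = 0" for k l
      by (rule overlap_embed_zero[OF fin(1,2,2) fBX u(3,4) w(1,3) that])
    show "overlap (B \<times> Y) u' (\<lambda>(b, l). embed_at b (w' l)) k l * p' k = 0"
      if "k \<in> B \<times> Y" "l \<in> B \<times> Y" "(case l of (b, l) \<Rightarrow> q' l) = 0" for k l
      by (rule overlap_embed_zero[OF fin(1,3,3) fBY u'(3,4) w'(1,3) that])
  qed (use w(4) w'(4) in auto)
  then show ?thesis
    unfolding relative_entropy_embed[OF fin(1,2,2) fBX R u(1,3) w(1-3)]
      relative_entropy_embed[OF fin(1,3,3) fBY R' u'(1,3) w'(1-3)]
    by simp
qed

section \<open>Conditional mutual information\<close>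

definition cond_entropy :: "'b set \<Rightarrow> 'x set \<Rightarrow> ('b \<times> 'x \<Rightarrow> 'b \<times> 'x \<Rightarrow> complex) \<Rightarrow> real" where
  "cond_entropy B X R = entropy (B \<times> X) R - entropy X (trace_first B R)"

definition trace_middle :: "'q set \<Rightarrow> ('b \<times> 'q \<times> 'x \<Rightarrow> 'b \<times> 'q \<times> 'x \<Rightarrow> complex) \<Rightarrow> 'b \<times> 'x \<Rightarrow> 'b \<times> 'x \<Rightarrow> complex" where
  "trace_middle Q R = (\<lambda>(b, x) (b', x'). \<Sum>q\<in>Q. R (b, q, x) (b', q, x'))"

text \<open>The form \<open>S(A|E) - S(A|BE)\<close> treats the two parties differently; it fits
  operations of Bob directly, and those of Alice after \<open>cond_mutual_info_swap\<close>.\<close>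

definition cond_mutual_info :: "'a set \<Rightarrow> 'b set \<Rightarrow> 'e set \<Rightarrow> ('a \<times> 'b \<times> 'e \<Rightarrow> 'a \<times> 'b \<times> 'e \<Rightarrow> complex) \<Rightarrow> real" where
  "cond_mutual_info A B E R = cond_entropy A E (trace_middle B R) - cond_entropy A (B \<times> E) R"

definition state :: "'i set \<Rightarrow> ('i \<Rightarrow> 'i \<Rightarrow> complex) \<Rightarrow> bool" where
  "state I X \<longleftrightarrow> pos I X \<and> (\<Sum>i\<in>I. X i i) = 1"

lemma cond_entropy_cong:
  assumes "\<And>i j. i \<in> B \<times> X \<Longrightarrow> j \<in> B \<times> X \<Longrightarrow> R i j = R' i j"
  shows "cond_entropy B X R = cond_entropy B X R'"
proof -
  have "entropy (B \<times> X) R = entropy (B \<times> X) R'" using assms by (rule entropy_cong)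
  moreover have "entropy X (trace_first B R) = entropy X (trace_first B R')"
    using assms by (intro entropy_cong) (simp add: trace_first_def)
  ultimately show ?thesis by (simp add: cond_entropy_def)
qed

lemma cond_mutual_info_cong:
  assumes "\<And>i j. i \<in> A \<times> B \<times> E \<Longrightarrow> j \<in> A \<times> B \<times> E \<Longrightarrow> R i j = R' i j"
  shows "cond_mutual_info A B E R = cond_mutual_info A B E R'"
proof -
  have "cond_entropy A (B \<times> E) R = cond_entropy A (B \<times> E) R'" using assms by (rule cond_entropy_cong)
  moreover have "cond_entropy A E (trace_middle B R) = cond_entropy A E (trace_middle B R')"
    using assms by (intro cond_entropy_cong) (auto simp: trace_middle_def)
  ultimately show ?thesis by (simp add: cond_mutual_info_def)
qed

text \<open>An interface to \<open>cond_entropy_mono\<close> in which the output is prescribed by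
  entries, and only on the index set, as is the case for operators read off from matrices.\<close>

lemma cond_entropy_kraus:
  assumes fin: "finite B" "finite X" "finite Y" "finite A" and R: "pos (B \<times> X) R" and trace_preserving: "trace_preserving A Y X F"
    and R': "\<And>b y b' y'. b \<in> B \<Longrightarrow> y \<in> Y \<Longrightarrow> b' \<in> B \<Longrightarrow> y' \<in> Y \<Longrightarrow>
      R' (b, y) (b', y') = (\<Sum>a\<in>A. \<Sum>x\<in>X. \<Sum>x'\<in>X. F a y x * R (b, x) (b', x') * cnj (F a y' x'))"
  shows "cond_entropy B X R \<le> cond_entropy B Y R'" and "state (B \<times> X) R \<Longrightarrow> state (B \<times> Y) R'"
proof -
  let ?K = "kraus A (B \<times> X) (lift_kraus F) R"
  have eq: "R' i j = ?K i j" if "i \<in> B \<times> Y" "j \<in> B \<times> Y" for i j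
    using that by (auto simp: R' kraus_lift[OF fin(1)])
  have "cond_entropy B Y R' = cond_entropy B Y ?K" by (rule cond_entropy_cong[OF eq])
  then show "cond_entropy B X R \<le> cond_entropy B Y R'" using cond_entropy_mono[OF fin R trace_preserving] by (simp add: cond_entropy_def)
  assume s: "state (B \<times> X) R"
  have "finite (B \<times> X)" using fin by simp
  then have "pos (B \<times> Y) ?K" "(\<Sum>i\<in>B \<times> Y. ?K i i) = (\<Sum>i\<in>B \<times> X. R i i)"
    by (rule pos_kraus[OF _ R], rule trace_kraus[OF _ trace_preserving_lift[OF fin(1) trace_preserving]])
  then show "state (B \<times> Y) R'"
    using s pos_cong[of "B \<times> Y" R' ?K, OF eq] eq by (simp add: state_def)
qed

lemma sum_delta2:
  assumes "finite X" "y \<in> X" "y' \<in> X"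
  shows "(\<Sum>x\<in>X. \<Sum>x'\<in>X. (if x = y then f x else 0) * g x x' * cnj (if x' = y' then h x' else 0))
    = (f y * g y y' * cnj (h y') :: complex)"
proof -
  have "(\<Sum>x\<in>X. \<Sum>x'\<in>X. (if x = y then f x else 0) * g x x' * cnj (if x' = y' then h x' else 0))
      = (\<Sum>x\<in>X. if x = y then \<Sum>x'\<in>X. if x' = y' then f x * g x x' * cnj (h x') else 0 else 0)"
    by (intro sum.cong refl) (auto intro!: sum.cong)
  then show ?thesis using assms by simp
qed

text \<open>This is strong subadditivity.\<close>

lemma cond_entropy_trace_middle:
  assumes fin: "finite B" "finite Q" "finite X" and R: "pos (B \<times> Q \<times> X) R"
  shows "cond_entropy B (Q \<times> X) R \<le> cond_entropy B X (trace_middle Q R)"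
proof (rule cond_entropy_kraus(1)[OF fin(1) _ fin(3,2) R])
  \<comment> \<open>The partial trace over \<open>Q\<close> as a channel: its Kraus operators are
    \<open><q| \<otimes> 1\<close>.\<close>
  let ?F = "\<lambda>q y z. if z = (q, y) then 1 else 0 :: complex"
  show "finite (Q \<times> X)" using fin by simp
  show "trace_preserving Q X (Q \<times> X) ?F"
    unfolding trace_preserving_def ortho_def
  proof (intro ballI)
    fix k l assume kl: "k \<in> Q \<times> X" "l \<in> Q \<times> X"
    have "ip (Q \<times> X) (\<lambda>(q, y). ?F q y k) (\<lambda>(q, y). ?F q y l) = (\<Sum>z\<in>Q \<times> X. if z = k then if k = l then 1 else 0 else 0)"
      unfolding ip_def by (intro sum.cong refl) auto
    also have "\<dots> = (if k = l then 1 else 0)" using kl fin by simp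
    finally show "ip (Q \<times> X) (\<lambda>(q, y). ?F q y k) (\<lambda>(q, y). ?F q y l) = (if k = l then 1 else 0)" .
  qed
  show "trace_middle Q R (b, y) (b', y') = (\<Sum>q\<in>Q. \<Sum>z\<in>Q \<times> X. \<Sum>z'\<in>Q \<times> X. ?F q y z * R (b, z) (b', z') * cnj (?F q y' z'))"
    if "y \<in> X" "y' \<in> X" for b y b' y'
    using that fin sum_delta2[of "Q \<times> X" _ _ "\<lambda>_. 1" "\<lambda>z z'. R (b, z) (b', z')" "\<lambda>_. 1"]
    by (simp add: trace_middle_def)
qed

lemma bij_betw_inverse:
  assumes "\<And>x. x \<in> A \<Longrightarrow> f x \<in> B \<and> g (f x) = x" "\<And>y. y \<in> B \<Longrightarrow> g y \<in> A \<and> f (g y) = y"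
  shows "bij_betw f A B"
  using assms by (intro bij_betw_byWitness[where f' = g]) auto

lemma pos_trace_middle:
  assumes fin: "finite Q" and R: "pos (B \<times> Q \<times> X) R" shows "pos (B \<times> X) (trace_middle Q R)"
proof -
  have f: "bij_betw (\<lambda>(q, b, x). (b, q, x)) (Q \<times> B \<times> X) (B \<times> Q \<times> X)"
    by (rule bij_betw_inverse[where g = "\<lambda>(b, q, x). (q, b, x)"]) auto
  have "trace_middle Q R = trace_first Q (\<lambda>i j. R (case i of (q, b, x) \<Rightarrow> (b, q, x)) (case j of (q, b, x) \<Rightarrow> (b, q, x)))"
    by (auto simp: trace_middle_def trace_first_def fun_eq_iff)
  then show ?thesis using pos_trace_first[OF fin pos_reindex[OF f R]] by simp
qed

definition swap_parties :: "('a \<times> 'b \<times> 'e \<Rightarrow> 'a \<times> 'b \<times> 'e \<Rightarrow> complex) \<Rightarrow> 'b \<times> 'a \<times> 'e \<Rightarrow> 'b \<times> 'a \<times> 'e \<Rightarrow> complex" where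
  "swap_parties R = (\<lambda>(b, a, e) (b', a', e'). R (a, b, e) (a', b', e'))"

lemma swap_parties_apply [simp]: "swap_parties R (b, a, e) (b', a', e') = R (a, b, e) (a', b', e')"
  by (simp add: swap_parties_def)

text \<open>Exchanging the parties only permutes the four entropies: those of \<open>AE\<close> and
  \<open>BE\<close> trade places, those of \<open>ABE\<close> and \<open>E\<close> stay.\<close>

lemma cond_mutual_info_swap:
  assumes fin: "finite A" "finite B" "finite E" and R: "state (A \<times> B \<times> E) R"
  shows "cond_mutual_info B A E (swap_parties R) = cond_mutual_info A B E R"
proof -
  have f: "bij_betw (\<lambda>(b, a, e). (a, b, e)) (B \<times> A \<times> E) (A \<times> B \<times> E)"
    by (rule bij_betw_inverse[where g = "\<lambda>(a, b, e). (b, a, e)"]) auto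
  have "entropy (B \<times> A \<times> E) (swap_parties R) = entropy (A \<times> B \<times> E) R"
    using entropy_reindex[OF f _ R[unfolded state_def, THEN conjunct1]] fin by (simp add: swap_parties_def split_def)
  moreover have "trace_first B (swap_parties R) = trace_middle B R" "trace_middle A (swap_parties R) = trace_first A R"
    by (auto simp: trace_middle_def trace_first_def fun_eq_iff)
  moreover have "trace_first B (trace_middle A (swap_parties R)) = trace_first A (trace_middle B R)"
    unfolding trace_first_def trace_middle_def by (auto simp: fun_eq_iff intro: sum.swap)
  ultimately show ?thesis by (simp add: cond_mutual_info_def cond_entropy_def)
qed

text \<open>In \<open>S(A|E)\<close> the channel is absorbed by the trace over the second party. In
  \<open>S(A|BE)\<close> it acts on the conditioning system, as the channel tensor the identity of
  \<open>E\<close>, and the entropy can only grow.\<close>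

lemma cond_mutual_info_channel_2:
  assumes fin: "finite A" "finite B" "finite B'" "finite E" "finite M"
    and R: "pos (A \<times> B \<times> E) R" and trace_preserving: "trace_preserving M B' B F"
    and R': "\<And>a b e a' b' e'. a \<in> A \<Longrightarrow> b \<in> B' \<Longrightarrow> e \<in> E \<Longrightarrow> a' \<in> A \<Longrightarrow> b' \<in> B' \<Longrightarrow> e' \<in> E \<Longrightarrow>
      R' (a, b, e) (a', b', e') = (\<Sum>m\<in>M. \<Sum>x\<in>B. \<Sum>x'\<in>B. F m b x * R (a, x, e) (a', x', e') * cnj (F m b' x'))"
  shows "cond_mutual_info A B' E R' \<le> cond_mutual_info A B E R" and "state (A \<times> B \<times> E) R \<Longrightarrow> state (A \<times> B' \<times> E) R'"
proof -
  let ?F = "\<lambda>m (b, e) (x, e'). if e' = e then F m b x else 0"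
  have f: "finite (B \<times> E)" "finite (B' \<times> E)" using fin by auto
  have trace_preserving': "trace_preserving M (B' \<times> E) (B \<times> E) ?F"
      unfolding trace_preserving_def ortho_def
    proof (clarify)
      fix x e x' e' assume *: "x \<in> B" "e \<in> E" "x' \<in> B" "e' \<in> E"
      have "ip (M \<times> B' \<times> E) (\<lambda>(m, y). ?F m y (x, e)) (\<lambda>(m, y). ?F m y (x', e'))
        = (\<Sum>m\<in>M. \<Sum>b\<in>B'. \<Sum>d\<in>E. if d = e then if e = e' then F m b x * cnj (F m b x') else 0 else 0)"
        unfolding ip_def sum.cartesian_product by (intro sum.cong refl) auto
      also have "\<dots> = (if e = e' then ip (M \<times> B') (\<lambda>(m, b). F m b x) (\<lambda>(m, b). F m b x') else 0)"
        using fin *(2) by (simp add: ip_def sum.cartesian_product split_def)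
      finally show "ip (M \<times> B' \<times> E) (\<lambda>(m, y). ?F m y (x, e)) (\<lambda>(m, y). ?F m y (x', e'))
          = (if (x, e) = (x', e') then 1 else 0)"
        using trace_preserving * by (simp add: trace_preserving_def ortho_def)
    qed
  have eq: "R' (a, y) (a', y') = (\<Sum>m\<in>M. \<Sum>z\<in>B \<times> E. \<Sum>z'\<in>B \<times> E. ?F m y z * R (a, z) (a', z') * cnj (?F m y' z'))"
    if **: "a \<in> A" "y \<in> B' \<times> E" "a' \<in> A" "y' \<in> B' \<times> E" for a y a' y'
  proof -
    obtain b e b' e' where y: "y = (b, e)" "y' = (b', e')" and be: "b \<in> B'" "e \<in> E" "b' \<in> B'" "e' \<in> E"
      using ** by auto
    have "(\<Sum>z\<in>B \<times> E. \<Sum>z'\<in>B \<times> E. ?F m y z * R (a, z) (a', z') * cnj (?F m y' z'))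
      = (\<Sum>x\<in>B. \<Sum>x'\<in>B. F m b x * R (a, x, e) (a', x', e') * cnj (F m b' x'))" for m
    proof -
      have "(\<Sum>z\<in>B \<times> E. \<Sum>z'\<in>B \<times> E. ?F m y z * R (a, z) (a', z') * cnj (?F m y' z'))
        = (\<Sum>x\<in>B. \<Sum>d\<in>E. \<Sum>x'\<in>B. \<Sum>d'\<in>E. (if d = e then F m b x else 0) * R (a, x, d) (a', x', d')
            * cnj (if d' = e' then F m b' x' else 0))"
        unfolding sum.cartesian_product' by (simp add: y)
      also have "\<dots> = (\<Sum>x\<in>B. \<Sum>x'\<in>B. \<Sum>d\<in>E. \<Sum>d'\<in>E. (if d = e then F m b x else 0) * R (a, x, d) (a', x', d')
            * cnj (if d' = e' then F m b' x' else 0))"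
        by (rule sum.cong[OF refl], rule sum.swap)
      also have "\<dots> = (\<Sum>x\<in>B. \<Sum>x'\<in>B. F m b x * R (a, x, e) (a', x', e') * cnj (F m b' x'))"
        by (intro sum.cong refl sum_delta2 fin be)
      finally show ?thesis .
    qed
    then show ?thesis using R' ** be by (simp add: y)
  qed
  note mono = cond_entropy_kraus[OF fin(1) f fin(5) R trace_preserving' eq]
  have "cond_entropy A E (trace_middle B' R') = cond_entropy A E (trace_middle B R)"
  proof (rule cond_entropy_cong)
    fix i j assume "i \<in> A \<times> E" "j \<in> A \<times> E"
    then obtain a e a' e' where ij: "i = (a, e)" "j = (a', e')" "a \<in> A" "e \<in> E" "a' \<in> A" "e' \<in> E" by auto
    have "trace_middle B' R' i j = (\<Sum>b\<in>B'. kraus M B F (\<lambda>x x'. R (a, x, e) (a', x', e')) b b)"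
      using ij by (simp add: trace_middle_def kraus_def R')
    also have "\<dots> = trace_middle B R i j" unfolding trace_kraus[OF fin(2) trace_preserving] by (simp add: trace_middle_def ij)
    finally show "trace_middle B' R' i j = trace_middle B R i j" .
  qed
  with mono(1) show "cond_mutual_info A B' E R' \<le> cond_mutual_info A B E R" by (simp add: cond_mutual_info_def)
  show "state (A \<times> B' \<times> E) R'" if "state (A \<times> B \<times> E) R" by (rule mono(2)[OF _ _ _ _ that])
qed

text \<open>Both conditional entropies grow, which says nothing about their difference. For
  reversible operations the second bound is therefore applied to the recovery map as well.\<close>

lemma cond_entropy_channel_E:
  assumes fin: "finite A" "finite B" "finite E" "finite E'" "finite M"
    and R: "pos (A \<times> B \<times> E) R" and trace_preserving: "trace_preserving M E' E F"
    and R': "\<And>a b e a' b' e'. a \<in> A \<Longrightarrow> b \<in> B \<Longrightarrow> e \<in> E' \<Longrightarrow> a' \<in> A \<Longrightarrow> b' \<in> B \<Longrightarrow> e' \<in> E' \<Longrightarrow>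
      R' (a, b, e) (a', b', e') = (\<Sum>m\<in>M. \<Sum>x\<in>E. \<Sum>x'\<in>E. F m e x * R (a, b, x) (a', b', x') * cnj (F m e' x'))"
  shows "cond_entropy A (B \<times> E) R \<le> cond_entropy A (B \<times> E') R'"
    and "cond_entropy A E (trace_middle B R) \<le> cond_entropy A E' (trace_middle B R')"
    and "state (A \<times> B \<times> E) R \<Longrightarrow> state (A \<times> B \<times> E') R'"
proof -
  have f: "finite (B \<times> E)" "finite (B \<times> E')" using fin by auto
  have eq: "R' (a, y) (a', y') = (\<Sum>m\<in>M. \<Sum>z\<in>B \<times> E. \<Sum>z'\<in>B \<times> E. lift_kraus F m y z * R (a, z) (a', z') * cnj (lift_kraus F m y' z'))"
    if **: "a \<in> A" "y \<in> B \<times> E'" "a' \<in> A" "y' \<in> B \<times> E'" for a y a' y'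
  proof -
    obtain b e b' e' where y: "y = (b, e)" "y' = (b', e')" and be: "b \<in> B" "e \<in> E'" "b' \<in> B" "e' \<in> E'"
      using ** by auto
    show ?thesis
      using kraus_lift[OF fin(2) be(1,3), of M E F "\<lambda>z z'. R (a, z) (a', z')" e e'] R' ** be
      by (simp add: y kraus_def)
  qed
  note mono = cond_entropy_kraus[OF fin(1) f fin(5) R trace_preserving_lift[OF fin(2) trace_preserving] eq]
  show "cond_entropy A (B \<times> E) R \<le> cond_entropy A (B \<times> E') R'" by (rule mono(1))
  show "state (A \<times> B \<times> E') R'" if "state (A \<times> B \<times> E) R" by (rule mono(2)[OF _ _ _ _ that])
  show "cond_entropy A E (trace_middle B R) \<le> cond_entropy A E' (trace_middle B R')"
  proof (rule cond_entropy_kraus(1)[OF fin(1,3,4,5) pos_trace_middle[OF fin(2) R] trace_preserving])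
    fix a y a' y' assume "a \<in> A" "y \<in> E'" "a' \<in> A" "y' \<in> E'"
    then have "trace_middle B R' (a, y) (a', y')
        = (\<Sum>b\<in>B. \<Sum>m\<in>M. \<Sum>x\<in>E. \<Sum>x'\<in>E. F m y x * R (a, b, x) (a', b, x') * cnj (F m y' x'))"
      by (simp add: trace_middle_def R')
    also have "\<dots> = (\<Sum>m\<in>M. \<Sum>b\<in>B. \<Sum>x\<in>E. \<Sum>x'\<in>E. F m y x * R (a, b, x) (a', b, x') * cnj (F m y' x'))"
      by (rule sum.swap)
    also have "\<dots> = (\<Sum>m\<in>M. \<Sum>x\<in>E. \<Sum>b\<in>B. \<Sum>x'\<in>E. F m y x * R (a, b, x) (a', b, x') * cnj (F m y' x'))"
      by (rule sum.cong[OF refl], rule sum.swap)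
    also have "\<dots> = (\<Sum>m\<in>M. \<Sum>x\<in>E. \<Sum>x'\<in>E. \<Sum>b\<in>B. F m y x * R (a, b, x) (a', b, x') * cnj (F m y' x'))"
      by (rule sum.cong[OF refl], rule sum.cong[OF refl], rule sum.swap)
    finally show "trace_middle B R' (a, y) (a', y')
        = (\<Sum>m\<in>M. \<Sum>x\<in>E. \<Sum>x'\<in>E. F m y x * trace_middle B R (a, x) (a', x') * cnj (F m y' x'))"
      by (simp add: trace_middle_def sum_distrib_left sum_distrib_right)
  qed
qed

text \<open>\<open>S(A|BQE)\<close> only regroups its systems, while
  \<open>S(A|QE) \<le> S(A|E)\<close> is strong subadditivity with \<open>Q\<close> as the discarded
  system.\<close>

lemma cond_mutual_info_send:
  assumes fin: "finite A" "finite B" "finite Q" "finite E" and R: "pos (A \<times> B \<times> Q \<times> E) R"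
  shows "cond_mutual_info A B (Q \<times> E) R \<le> cond_mutual_info A (B \<times> Q) E (\<lambda>(a, (b, q), e) (a', (b', q'), e'). R (a, b, q, e) (a', b', q', e'))"
proof -
  let ?R = "\<lambda>(a, (b, q), e) (a', (b', q'), e'). R (a, b, q, e) (a', b', q', e')"
  have f: "bij_betw (\<lambda>(a, (b, q), e). (a, b, q, e)) (A \<times> (B \<times> Q) \<times> E) (A \<times> B \<times> Q \<times> E)"
    by (rule bij_betw_inverse[where g = "\<lambda>(a, b, q, e). (a, (b, q), e)"]) auto
  have g: "bij_betw (\<lambda>((b, q), e). (b, q, e)) ((B \<times> Q) \<times> E) (B \<times> Q \<times> E)"
    by (rule bij_betw_inverse[where g = "\<lambda>(b, q, e). ((b, q), e)"]) auto
  have "entropy (A \<times> (B \<times> Q) \<times> E) ?R = entropy (A \<times> B \<times> Q \<times> E) R"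
    using entropy_reindex[OF f _ R] fin by (simp add: split_def)
  moreover have "entropy ((B \<times> Q) \<times> E) (trace_first A ?R) = entropy (B \<times> Q \<times> E) (trace_first A R)"
    using entropy_reindex[OF g _ pos_trace_first[OF fin(1) R]] fin by (simp add: split_def trace_first_def[abs_def])
  ultimately have 1: "cond_entropy A ((B \<times> Q) \<times> E) ?R = cond_entropy A (B \<times> Q \<times> E) R" by (simp add: cond_entropy_def)
  have "trace_middle (B \<times> Q) ?R = trace_middle Q (trace_middle B R)"
  proof -
    have "(\<Sum>z\<in>B \<times> Q. R (a, fst z, snd z, e) (a', fst z, snd z, e')) = (\<Sum>q\<in>Q. \<Sum>b\<in>B. R (a, b, q, e) (a', b, q, e'))"
      for a e a' e'
      by (subst sum.swap) (simp add: sum.cartesian_product split_def)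
    then show ?thesis by (simp add: trace_middle_def fun_eq_iff split_def)
  qed
  then have "cond_entropy A (Q \<times> E) (trace_middle B R) \<le> cond_entropy A E (trace_middle (B \<times> Q) ?R)"
    using cond_entropy_trace_middle[OF fin(1,3,4) pos_trace_middle[OF fin(2) R]] by simp
  then show ?thesis by (simp add: cond_mutual_info_def 1)
qed

section \<open>Classical messages\<close>

lemma state_trace_first:
  assumes "finite B" "state (B \<times> X) R" shows "state X (trace_first B R)"
proof -
  have "(\<Sum>x\<in>X. trace_first B R x x) = (\<Sum>i\<in>B \<times> X. R i i)"
    unfolding trace_first_def by (subst sum.swap) (simp add: sum.cartesian_product split_def)
  then show ?thesis using assms pos_trace_first by (auto simp: state_def)
qed

lemma state_trace_middle:
  assumes "finite Q" "state (B \<times> Q \<times> X) R" shows "state (B \<times> X) (trace_middle Q R)"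
proof -
  have "(\<Sum>i\<in>B \<times> X. trace_middle Q R i i) = (\<Sum>b\<in>B. \<Sum>x\<in>X. \<Sum>q\<in>Q. R (b, q, x) (b, q, x))"
    by (simp add: sum.cartesian_product' trace_middle_def)
  also have "\<dots> = (\<Sum>b\<in>B. \<Sum>q\<in>Q. \<Sum>x\<in>X. R (b, q, x) (b, q, x))"
    by (rule sum.cong[OF refl], rule sum.swap)
  also have "\<dots> = (\<Sum>i\<in>B \<times> Q \<times> X. R i i)" by (simp add: sum.cartesian_product')
  finally show ?thesis using assms pos_trace_middle by (auto simp: state_def)
qed

lemma ip_product:
  "ip (C \<times> I) (\<lambda>(c, i). x c * y i) (\<lambda>(c, i). x' c * y' i) = ip C x x' * ip I y y'"
  by (simp add: ip_def sum_product sum.cartesian_product split_def mult_ac)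

text \<open>For a classical-quantum state the products of \<open>v m\<close> with eigenvectors of
  \<open>\<rho> m\<close> are eigenvectors with eigenvalues \<open>p m * r m k\<close>, so its
  entropy is the Shannon entropy of \<open>p\<close> plus the average entropy. There may be fewer
  messages than register dimensions. The bijection \<open>f\<close> locates the register within the
  index.\<close>

lemma entropy_block:
  assumes fin: "finite M" "finite C" "finite I" and f: "bij_betw f J (C \<times> I)"
    and v: "ortho C M v" and p: "\<And>m. m \<in> M \<Longrightarrow> 0 \<le> p m"
    and \<rho>: "\<And>m. m \<in> M \<Longrightarrow> state I (\<rho> m)"
    and X: "\<And>j j'. j \<in> J \<Longrightarrow> j' \<in> J \<Longrightarrow> X j j' = (\<Sum>m\<in>M. complex_of_real (p m) *
      (v m (fst (f j)) * cnj (v m (fst (f j')))) * \<rho> m (snd (f j)) (snd (f j')))"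
  shows "pos J X" and "entropy J X = (\<Sum>m\<in>M. p m * entropy I (\<rho> m)) - (\<Sum>m\<in>M. p m * ln (p m))"
    and "(\<Sum>j\<in>J. X j j) = complex_of_real (\<Sum>m\<in>M. p m)"
proof -
  have "\<exists>u r. ortho I I u \<and> expands I I u r (\<rho> m) \<and> (\<forall>k\<in>I. 0 \<le> r k)" if "m \<in> M" for m
    using spectral_theorem_pos[OF fin(3)] \<rho>[OF that] unfolding state_def by metis
  then obtain u r where u: "\<And>m. m \<in> M \<Longrightarrow> ortho I I (u m)"
    "\<And>m. m \<in> M \<Longrightarrow> expands I I (u m) (r m) (\<rho> m)" "\<And>m k. m \<in> M \<Longrightarrow> k \<in> I \<Longrightarrow> 0 \<le> r m k"
    by metis
  define W where "W = (\<lambda>(m, k) j. v m (fst (f j)) * u m k (snd (f j)))"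
  define P where "P = (\<lambda>(m, k). p m * r m k)"
  have ip: "ip J (W (m, k)) (W (m', k')) = ip C (v m) (v m') * ip I (u m k) (u m' k')" for m k m' k'
    using ip_reindex[OF f, of "\<lambda>(c, i). v m c * u m k i" "\<lambda>(c, i). v m' c * u m' k' i"]
    unfolding ip_product by (simp add: W_def split_def)
  have W: "ortho J (M \<times> I) W"
    unfolding ortho_def
  proof (clarify)
    fix m k m' k' assume "m \<in> M" "k \<in> I" "m' \<in> M" "k' \<in> I"
    then show "ip J (W (m, k)) (W (m', k')) = (if (m, k) = (m', k') then 1 else 0)"
      using v u(1)[of m] by (cases "m = m'") (auto simp: ip ortho_def)
  qed
  have e: "expands J (M \<times> I) W P X"
    unfolding expands_def
  proof (intro ballI)
    fix j j' assume j: "j \<in> J" "j' \<in> J"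
    then have fj: "snd (f j) \<in> I" "snd (f j') \<in> I" using bij_betwE[OF f] by (auto simp: mem_Times_iff)
    have "X j j' = (\<Sum>m\<in>M. complex_of_real (p m) * (v m (fst (f j)) * cnj (v m (fst (f j')))) *
        (\<Sum>k\<in>I. complex_of_real (r m k) * u m k (snd (f j)) * cnj (u m k (snd (f j')))))"
      unfolding X[OF j] using u(2) fj by (intro sum.cong refl) (simp add: expands_def)
    also have "\<dots> = (\<Sum>k\<in>M \<times> I. complex_of_real (P k) * W k j * cnj (W k j'))"
      by (simp add: sum.cartesian_product' P_def W_def sum_distrib_left mult_ac)
    finally show "X j j' = (\<Sum>k\<in>M \<times> I. complex_of_real (P k) * W k j * cnj (W k j'))" .
  qed
  have "0 \<le> P k" if "k \<in> M \<times> I" for k using that p u(3) by (auto simp: P_def)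
  with e show pos: "pos J X" by (rule expands_pos)
  have tr: "(\<Sum>k\<in>I. r m k) = 1" if m: "m \<in> M" for m
  proof -
    have "complex_of_real (\<Sum>k\<in>I. r m k) = 1"
      using expands_trace[OF u(2,1)[OF m]] \<rho>[OF m] by (simp add: state_def)
    then show ?thesis by (simp del: of_real_sum)
  qed
  have "(\<Sum>k\<in>M \<times> I. P k) = (\<Sum>m\<in>M. p m)"
    by (simp add: sum.cartesian_product' P_def sum_distrib_left[symmetric] tr)
  then show "(\<Sum>j\<in>J. X j j) = complex_of_real (\<Sum>m\<in>M. p m)"
    using expands_trace[OF e W] by simp
  have "finite J" using bij_betw_finite[OF f] fin by simp
  then have "entropy J X = - (\<Sum>k\<in>M \<times> I. P k * ln (P k))"
    using fin by (intro entropy_eq[OF _ _ pos W e]) auto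
  also have "(\<Sum>k\<in>M \<times> I. P k * ln (P k)) = (\<Sum>m\<in>M. \<Sum>k\<in>I. p m * r m k * ln (p m * r m k))"
    by (simp add: sum.cartesian_product' P_def)
  also have "\<dots> = (\<Sum>m\<in>M. p m * ln (p m) - p m * entropy I (\<rho> m))"
  proof (rule sum.cong[OF refl])
    fix m assume m: "m \<in> M"
    have "p m * r m k * ln (p m * r m k) = p m * ln (p m) * r m k + p m * (r m k * ln (r m k))" if "k \<in> I" for k
      by (cases "p m = 0 \<or> r m k = 0") (auto simp: ln_mult algebra_simps)
    then have "(\<Sum>k\<in>I. p m * r m k * ln (p m * r m k))
        = p m * ln (p m) * (\<Sum>k\<in>I. r m k) + p m * (\<Sum>k\<in>I. r m k * ln (r m k))"
      by (simp add: sum.distrib sum_distrib_left)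
    then show "(\<Sum>k\<in>I. p m * r m k * ln (p m * r m k)) = p m * ln (p m) - p m * entropy I (\<rho> m)"
      using entropy_eq[OF fin(3,3) _ u(1,2)[OF m]] \<rho>[OF m] by (simp add: tr[OF m] state_def)
  qed
  finally show "entropy J X = (\<Sum>m\<in>M. p m * entropy I (\<rho> m)) - (\<Sum>m\<in>M. p m * ln (p m))"
    by (simp add: sum_subtractf)
qed

text \<open>A register in the conditioning system contributes the Shannon entropy of
  \<open>p\<close> to both terms of the difference, where it cancels.\<close>

lemma cond_entropy_block:
  assumes fin: "finite M" "finite C" "finite B" "finite X" and g: "bij_betw g Y (C \<times> X)"
    and v: "ortho C M v" and p: "\<And>m. m \<in> M \<Longrightarrow> 0 \<le> p m"
    and \<rho>: "\<And>m. m \<in> M \<Longrightarrow> state (B \<times> X) (\<rho> m)"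
    and R: "\<And>b y b' y'. b \<in> B \<Longrightarrow> y \<in> Y \<Longrightarrow> b' \<in> B \<Longrightarrow> y' \<in> Y \<Longrightarrow>
      R (b, y) (b', y') = (\<Sum>m\<in>M. complex_of_real (p m) * (v m (fst (g y)) * cnj (v m (fst (g y')))) *
        \<rho> m (b, snd (g y)) (b', snd (g y')))"
  shows "pos (B \<times> Y) R" and "cond_entropy B Y R = (\<Sum>m\<in>M. p m * cond_entropy B X (\<rho> m))"
proof -
  define h where "h = the_inv_into Y g"
  have gh: "g y \<in> C \<times> X" "h (g y) = y" if "y \<in> Y" for y
    using g that by (auto simp: h_def bij_betw_def the_inv_into_f_f)
  have hg: "h z \<in> Y" "g (h z) = z" if "z \<in> C \<times> X" for z
    using g that bij_betwE[OF bij_betw_the_inv_into[OF g]] by (auto simp: h_def f_the_inv_into_f_bij_betw)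
  \<comment> \<open>Pulls the register, wherever \<open>g\<close> finds it inside \<open>Y\<close>,
    in front of \<open>B\<close>.\<close>
  let ?f = "\<lambda>(b, y). (fst (g y), b, snd (g y))"
  have f: "bij_betw ?f (B \<times> Y) (C \<times> B \<times> X)"
    by (rule bij_betw_inverse[where g = "\<lambda>(c, b, x). (b, h (c, x))"])
      (use gh hg in \<open>auto simp: mem_Times_iff\<close>)
  have fin': "finite (B \<times> X)" using fin by simp
  have R': "R j j' = (\<Sum>m\<in>M. complex_of_real (p m) *
      (v m (fst (?f j)) * cnj (v m (fst (?f j')))) * \<rho> m (snd (?f j)) (snd (?f j')))"
    if "j \<in> B \<times> Y" "j' \<in> B \<times> Y" for j j'
    using that by (auto simp: R)
  show "pos (B \<times> Y) R" by (rule entropy_block(1)[OF fin(1,2) fin' f v p \<rho> R'])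
  have 1: "entropy (B \<times> Y) R = (\<Sum>m\<in>M. p m * entropy (B \<times> X) (\<rho> m)) - (\<Sum>m\<in>M. p m * ln (p m))"
    by (rule entropy_block(2)[OF fin(1,2) fin' f v p \<rho> R'])
  have "trace_first B R y y' = (\<Sum>m\<in>M. complex_of_real (p m) * (v m (fst (g y)) * cnj (v m (fst (g y')))) *
        trace_first B (\<rho> m) (snd (g y)) (snd (g y')))" if "y \<in> Y" "y' \<in> Y" for y y'
    using that unfolding trace_first_def sum_distrib_left by (subst sum.swap) (simp add: R)
  then have 2: "entropy Y (trace_first B R) = (\<Sum>m\<in>M. p m * entropy X (trace_first B (\<rho> m))) - (\<Sum>m\<in>M. p m * ln (p m))"
    by (intro entropy_block(2)[OF fin(1,2,4) g v p state_trace_first[OF fin(3) \<rho>]])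
  show "cond_entropy B Y R = (\<Sum>m\<in>M. p m * cond_entropy B X (\<rho> m))"
    unfolding cond_entropy_def 1 2 by (simp add: right_diff_distrib sum_subtractf)
qed

text \<open>Strong subadditivity in disguise: attach a register holding \<open>m\<close> in the
  standard basis to the conditioning system. With the register the conditional entropy is the
  average; discarding it leaves the average state.\<close>

lemma cond_entropy_concave:
  assumes fin: "finite M" "finite B" "finite X" and p: "\<And>m. m \<in> M \<Longrightarrow> 0 \<le> p m"
    and \<rho>: "\<And>m. m \<in> M \<Longrightarrow> state (B \<times> X) (\<rho> m)"
  shows "(\<Sum>m\<in>M. p m * cond_entropy B X (\<rho> m)) \<le> cond_entropy B X (\<lambda>i j. \<Sum>m\<in>M. complex_of_real (p m) * \<rho> m i j)"
proof -
  define v :: "'a \<Rightarrow> 'a \<Rightarrow> complex" where "v m c = (if c = m then 1 else 0)" for m c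
  define R where "R = (\<lambda>(b, c, x) (b', c', x'). \<Sum>m\<in>M. complex_of_real (p m) * (v m c * cnj (v m c')) * \<rho> m (b, x) (b', x'))"
  have v: "ortho M M v"
    unfolding ortho_def ip_def v_def using fin(1) by (auto simp: if_distrib cong: if_cong)
  have g: "bij_betw id (M \<times> X) (M \<times> X)" by simp
  have R: "R (b, y) (b', y') = (\<Sum>m\<in>M. complex_of_real (p m) * (v m (fst (id y)) * cnj (v m (fst (id y')))) *
        \<rho> m (b, snd (id y)) (b', snd (id y')))" for b y b' y'
    by (simp add: R_def split_def)
  note block = cond_entropy_block[OF fin(1,1,2,3) g v p \<rho>, where R = R, OF _ _ R]
  have "trace_middle M R i j = (\<Sum>m\<in>M. complex_of_real (p m) * \<rho> m i j)" for i j
  proof (cases i, cases j)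
    fix b x b' x' assume ij: "i = (b, x)" "j = (b', x')"
    have "trace_middle M R i j = (\<Sum>c\<in>M. \<Sum>m\<in>M. if m = c then complex_of_real (p m) * \<rho> m i j else 0)"
      unfolding ij trace_middle_def R_def prod.case by (intro sum.cong refl) (auto simp: v_def)
    then show ?thesis using fin(1) by simp
  qed
  then have "trace_middle M R = (\<lambda>i j. \<Sum>m\<in>M. complex_of_real (p m) * \<rho> m i j)" by (intro ext)
  then show ?thesis using cond_entropy_trace_middle[OF fin(2,1,3), of R] block by simp
qed

text \<open>Two copies of a message act as one register with the orthonormal vectors
  \<open>v_m \<otimes> v_m\<close>. Tracing out the copy outside the conditioning system leaves a
  mixture with the same weights, so the Shannon entropy of \<open>p\<close> cancels here
  too.\<close>

lemma cond_entropy_broadcast: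
  assumes fin: "finite M" "finite C" "finite A" "finite X" and g: "bij_betw g Y (C \<times> X)"
    and v: "ortho C M v" and p: "\<And>m. m \<in> M \<Longrightarrow> 0 \<le> p m"
    and \<rho>: "\<And>m. m \<in> M \<Longrightarrow> state (A \<times> X) (\<rho> m)"
    and R: "\<And>c a y c' a' y'. c \<in> C \<Longrightarrow> a \<in> A \<Longrightarrow> y \<in> Y \<Longrightarrow> c' \<in> C \<Longrightarrow> a' \<in> A \<Longrightarrow> y' \<in> Y \<Longrightarrow>
      R ((c, a), y) ((c', a'), y') = (\<Sum>m\<in>M. complex_of_real (p m) * (v m c * cnj (v m c')) *
        (v m (fst (g y)) * cnj (v m (fst (g y')))) * \<rho> m (a, snd (g y)) (a', snd (g y')))"
  shows "cond_entropy (C \<times> A) Y R = (\<Sum>m\<in>M. p m * cond_entropy A X (\<rho> m))"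
    and "(\<Sum>m\<in>M. p m) = 1 \<Longrightarrow> state ((C \<times> A) \<times> Y) R"
proof -
  let ?v = "\<lambda>m (c, d). v m c * v m d"
  have v': "ortho (C \<times> C) M ?v"
    using v by (auto simp: ortho_def ip_product)
  define h where "h = the_inv_into Y g"
  have gh: "g y \<in> C \<times> X" "h (g y) = y" if "y \<in> Y" for y
    using g that by (auto simp: h_def bij_betw_def the_inv_into_f_f)
  have hg: "h z \<in> Y" "g (h z) = z" if "z \<in> C \<times> X" for z
    using g that bij_betwE[OF bij_betw_the_inv_into[OF g]] by (auto simp: h_def f_the_inv_into_f_bij_betw)
  let ?f = "\<lambda>((c, a), y). ((c, fst (g y)), a, snd (g y))"
  have f: "bij_betw ?f ((C \<times> A) \<times> Y) ((C \<times> C) \<times> A \<times> X)"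
    by (rule bij_betw_inverse[where g = "\<lambda>((c, d), a, x). ((c, a), h (d, x))"])
      (use gh hg in \<open>auto simp: mem_Times_iff\<close>)
  have fin': "finite (C \<times> C)" "finite (A \<times> X)" using fin by auto
  have R': "R j j' = (\<Sum>m\<in>M. complex_of_real (p m) *
      (?v m (fst (?f j)) * cnj (?v m (fst (?f j')))) * \<rho> m (snd (?f j)) (snd (?f j')))"
    if "j \<in> (C \<times> A) \<times> Y" "j' \<in> (C \<times> A) \<times> Y" for j j'
    using that by (auto simp: R mult_ac)
  have 1: "entropy ((C \<times> A) \<times> Y) R = (\<Sum>m\<in>M. p m * entropy (A \<times> X) (\<rho> m)) - (\<Sum>m\<in>M. p m * ln (p m))"
    by (rule entropy_block(2)[OF fin(1) fin' f v' p \<rho> R'])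
  have "trace_first (C \<times> A) R y y' = (\<Sum>m\<in>M. complex_of_real (p m) * (v m (fst (g y)) * cnj (v m (fst (g y')))) *
        trace_first A (\<rho> m) (snd (g y)) (snd (g y')))" if y: "y \<in> Y" "y' \<in> Y" for y y'
  proof -
    have "trace_first (C \<times> A) R y y' = (\<Sum>c\<in>C. \<Sum>a\<in>A. \<Sum>m\<in>M. (v m c * cnj (v m c)) * (complex_of_real (p m) *
        (v m (fst (g y)) * cnj (v m (fst (g y')))) * \<rho> m (a, snd (g y)) (a, snd (g y'))))"
      unfolding trace_first_def sum.cartesian_product' using y by (intro sum.cong refl) (simp add: R mult_ac)
    also have "\<dots> = (\<Sum>c\<in>C. \<Sum>m\<in>M. \<Sum>a\<in>A. (v m c * cnj (v m c)) * (complex_of_real (p m) *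
        (v m (fst (g y)) * cnj (v m (fst (g y')))) * \<rho> m (a, snd (g y)) (a, snd (g y'))))"
      by (rule sum.cong[OF refl], rule sum.swap)
    also have "\<dots> = (\<Sum>m\<in>M. \<Sum>c\<in>C. \<Sum>a\<in>A. (v m c * cnj (v m c)) * (complex_of_real (p m) *
        (v m (fst (g y)) * cnj (v m (fst (g y')))) * \<rho> m (a, snd (g y)) (a, snd (g y'))))"
      by (rule sum.swap)
    also have "\<dots> = (\<Sum>m\<in>M. ip C (v m) (v m) * (\<Sum>a\<in>A. complex_of_real (p m) *
        (v m (fst (g y)) * cnj (v m (fst (g y')))) * \<rho> m (a, snd (g y)) (a, snd (g y'))))"
      unfolding ip_def sum_product ..
    finally show ?thesis using v by (simp add: ortho_def trace_first_def sum_distrib_left)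
  qed
  then have 2: "entropy Y (trace_first (C \<times> A) R) = (\<Sum>m\<in>M. p m * entropy X (trace_first A (\<rho> m))) - (\<Sum>m\<in>M. p m * ln (p m))"
    by (intro entropy_block(2)[OF fin(1,2,4) g v p state_trace_first[OF fin(3) \<rho>]])
  show "cond_entropy (C \<times> A) Y R = (\<Sum>m\<in>M. p m * cond_entropy A X (\<rho> m))"
    unfolding cond_entropy_def 1 2 by (simp add: right_diff_distrib sum_subtractf)
  show "state ((C \<times> A) \<times> Y) R" if "(\<Sum>m\<in>M. p m) = 1"
    using entropy_block(1,3)[OF fin(1) fin' f v' p \<rho> R'] that by (simp add: state_def)
qed

text \<open>The second party is the sender. \<open>S(A|BE)\<close> is an average over messages
  before and after, whereas \<open>S(A|E)\<close> turns from its value at the average state into the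
  average of its values. The loss is exactly the gap in the concavity of
  \<open>S(A|E)\<close>.\<close>

lemma cond_mutual_info_broadcast:
  assumes fin: "finite M" "finite C" "finite A" "finite B" "finite E"
    and v: "ortho C M v" and p: "\<And>m. m \<in> M \<Longrightarrow> 0 \<le> p m"
    and \<rho>: "\<And>m. m \<in> M \<Longrightarrow> state (A \<times> B \<times> E) (\<rho> m)"
    and R: "\<And>a c b e a' c' b' e'. \<lbrakk>a \<in> A; c \<in> C; b \<in> B; e \<in> E; a' \<in> A; c' \<in> C; b' \<in> B; e' \<in> E\<rbrakk> \<Longrightarrow>
      R (a, (c, b), e) (a', (c', b'), e') =
        (\<Sum>m\<in>M. complex_of_real (p m) * (v m c * cnj (v m c')) * \<rho> m (a, b, e) (a', b', e'))"
    and R': "\<And>c a b d e c' a' b' d' e'. \<lbrakk>c \<in> C; a \<in> A; b \<in> B; d \<in> C; e \<in> E; c' \<in> C; a' \<in> A; b' \<in> B; d' \<in> C; e' \<in> E\<rbrakk> \<Longrightarrow>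
      R' ((c, a), b, d, e) ((c', a'), b', d', e') =
        (\<Sum>m\<in>M. complex_of_real (p m) * (v m c * cnj (v m c')) * (v m d * cnj (v m d')) * \<rho> m (a, b, e) (a', b', e'))"
  shows "cond_mutual_info (C \<times> A) B (C \<times> E) R' \<le> cond_mutual_info A (C \<times> B) E R"
    and "(\<Sum>m\<in>M. p m) = 1 \<Longrightarrow> state ((C \<times> A) \<times> B \<times> C \<times> E) R'"
proof -
  have fin': "finite (B \<times> E)" using fin by simp
  have \<rho>': "state (A \<times> E) (trace_middle B (\<rho> m))" if "m \<in> M" for m
    by (rule state_trace_middle[OF fin(4) \<rho>[OF that]])
  have 1: "cond_entropy A ((C \<times> B) \<times> E) R = (\<Sum>m\<in>M. p m * cond_entropy A (B \<times> E) (\<rho> m))"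
  proof (rule cond_entropy_block(2)[OF fin(1-3) fin' _ v p \<rho>])
    show "bij_betw (\<lambda>((c, b), e). (c, b, e)) ((C \<times> B) \<times> E) (C \<times> B \<times> E)"
      by (rule bij_betw_inverse[where g = "\<lambda>(c, b, e). ((c, b), e)"]) auto
  qed (auto simp: R)
  have g: "bij_betw (\<lambda>(b, c, e). (c, b, e)) (B \<times> C \<times> E) (C \<times> B \<times> E)"
    by (rule bij_betw_inverse[where g = "\<lambda>(c, b, e). (b, c, e)"]) auto
  have 2: "cond_entropy (C \<times> A) (B \<times> C \<times> E) R' = (\<Sum>m\<in>M. p m * cond_entropy A (B \<times> E) (\<rho> m))"
    by (rule cond_entropy_broadcast(1)[OF fin(1-3) fin' g v p \<rho>]) (auto simp: R')
  show "state ((C \<times> A) \<times> B \<times> C \<times> E) R'" if "(\<Sum>m\<in>M. p m) = 1"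
    by (rule cond_entropy_broadcast(2)[OF fin(1-3) fin' g v p \<rho> _ that]) (auto simp: R')
  have 3: "cond_entropy (C \<times> A) (C \<times> E) (trace_middle B R') = (\<Sum>m\<in>M. p m * cond_entropy A E (trace_middle B (\<rho> m)))"
  proof (rule cond_entropy_broadcast(1)[OF fin(1-3,5) _ v p \<rho>'])
    show "bij_betw id (C \<times> E) (C \<times> E)" by simp
    fix c a y c' a' y' assume *: "c \<in> C" "a \<in> A" "y \<in> C \<times> E" "c' \<in> C" "a' \<in> A" "y' \<in> C \<times> E"
    show "trace_middle B R' ((c, a), y) ((c', a'), y') = (\<Sum>m\<in>M. complex_of_real (p m) * (v m c * cnj (v m c')) *
        (v m (fst (id y)) * cnj (v m (fst (id y')))) * trace_middle B (\<rho> m) (a, snd (id y)) (a', snd (id y')))"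
      using * unfolding trace_middle_def prod.case sum_distrib_left
      by (subst sum.swap) (auto simp: R' intro!: sum.cong)
  qed
  have "trace_middle (C \<times> B) R i j = (\<Sum>m\<in>M. complex_of_real (p m) * trace_middle B (\<rho> m) i j)"
    if ij: "i \<in> A \<times> E" "j \<in> A \<times> E" for i j
  proof -
    obtain a e a' e' where ij': "i = (a, e)" "j = (a', e')" "a \<in> A" "e \<in> E" "a' \<in> A" "e' \<in> E"
      using ij by auto
    have "trace_middle (C \<times> B) R i j = (\<Sum>c\<in>C. \<Sum>b\<in>B. \<Sum>m\<in>M. (v m c * cnj (v m c)) *
        (complex_of_real (p m) * \<rho> m (a, b, e) (a', b, e')))"
      unfolding ij' trace_middle_def prod.case sum.cartesian_product' using ij'
      by (intro sum.cong refl) (simp add: R mult_ac)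
    also have "\<dots> = (\<Sum>c\<in>C. \<Sum>m\<in>M. \<Sum>b\<in>B. (v m c * cnj (v m c)) *
        (complex_of_real (p m) * \<rho> m (a, b, e) (a', b, e')))"
      by (rule sum.cong[OF refl], rule sum.swap)
    also have "\<dots> = (\<Sum>m\<in>M. \<Sum>c\<in>C. \<Sum>b\<in>B. (v m c * cnj (v m c)) *
        (complex_of_real (p m) * \<rho> m (a, b, e) (a', b, e')))"
      by (rule sum.swap)
    also have "\<dots> = (\<Sum>m\<in>M. ip C (v m) (v m) * (\<Sum>b\<in>B. complex_of_real (p m) * \<rho> m (a, b, e) (a', b, e')))"
      unfolding ip_def sum_product ..
    finally show ?thesis using v by (simp add: ortho_def trace_middle_def sum_distrib_left ij')
  qed
  then have "cond_entropy A E (trace_middle (C \<times> B) R) = cond_entropy A E (\<lambda>i j. \<Sum>m\<in>M. complex_of_real (p m) * trace_middle B (\<rho> m) i j)"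
    by (rule cond_entropy_cong)
  then show "cond_mutual_info (C \<times> A) B (C \<times> E) R' \<le> cond_mutual_info A (C \<times> B) E R"
    using cond_entropy_concave[OF fin(1,3,5) p \<rho>'] by (simp add: cond_mutual_info_def 1 2 3)
qed

section \<open>Matrices and quantum operations\<close>

text \<open>The numbering \<open>f\<close> decides how the tensor factors are grouped, so one matrix
  can be read as an operator in several ways.\<close>

definition entries :: "('i \<Rightarrow> nat) \<Rightarrow> cmat \<Rightarrow> 'i \<Rightarrow> 'i \<Rightarrow> complex" where
  "entries f X = (\<lambda>i j. X $$ (f i, f j))"

section \<open>Positivity, spectra and entropy of matrices\<close>

lemma pos_reindex_iff:
  assumes f: "bij_betw f J I"
  shows "pos J (\<lambda>i j. X (f i) (f j)) \<longleftrightarrow> pos I X"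
proof
  assume J: "pos J (\<lambda>i j. X (f i) (f j))"
  let ?g = "the_inv_into J f"
  have "pos I (\<lambda>i j. X (f (?g i)) (f (?g j)))"
    by (rule pos_reindex[OF bij_betw_the_inv_into[OF f] J])
  then show "pos I X" using f by (subst (asm) pos_cong) (auto simp: f_the_inv_into_f_bij_betw)
qed (rule pos_reindex[OF f])

lemma psd_iff_pos: "psd n A \<longleftrightarrow> A \<in> carrier_mat n n \<and> pos {..<n} (entries id A)"
proof -
  have ip: "(A *\<^sub>v v) \<bullet>c v = ip {..<n} (mv {..<n} (entries id A) (vec_index v)) (vec_index v)"
    if A: "A \<in> carrier_mat n n" and v: "v \<in> carrier_vec n" for v
  proof -
    have "(A *\<^sub>v v) \<bullet>c v = ip {..<n} (vec_index (A *\<^sub>v v)) (vec_index v)"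
      using A v by (intro scalar_prod_ip) auto
    also have "\<dots> = ip {..<n} (mv {..<n} (entries id A) (vec_index v)) (vec_index v)"
      using A v by (intro ip_cong) (auto simp: mv_def scalar_prod_def entries_def atLeast0LessThan intro!: sum.cong)
    finally show ?thesis .
  qed
  have vec: "ip {..<n} (mv {..<n} (entries id A) (vec_index (vec n x))) (vec_index (vec n x))
      = ip {..<n} (mv {..<n} (entries id A) x) x" for x
    by (intro ip_cong mv_cong) auto
  show ?thesis
  proof
    assume psd: "psd n A"
    then have A: "A \<in> carrier_mat n n" by (simp add: psd_def)
    have "0 \<le> ip {..<n} (mv {..<n} (entries id A) x) x" for x
      using psd[unfolded psd_def, THEN conjunct2, rule_format, of "vec n x"] ip[OF A, of "vec n x"] by (simp add: vec)
    then show "A \<in> carrier_mat n n \<and> pos {..<n} (entries id A)" using A by (simp add: pos_def)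
  qed (auto simp: psd_def pos_def ip)
qed

lemma density_iff_state:
  assumes f: "bij_betw f J {..<n}"
  shows "density n A \<longleftrightarrow> A \<in> carrier_mat n n \<and> state J (entries f A)"
proof -
  have "mtrace A = (\<Sum>j\<in>J. entries f A j j)" if "A \<in> carrier_mat n n"
    using that sum.reindex_bij_betw[OF f, of "\<lambda>i. A $$ (i, i)"] by (simp add: mtrace_def entries_def)
  moreover have "pos J (entries f A) \<longleftrightarrow> pos {..<n} (entries id A)"
    using pos_reindex_iff[OF f, of "entries id A"] by (simp add: entries_def)
  ultimately show ?thesis by (auto simp: density_def psd_iff_pos state_def)
qed

lemma mat_adjoint_carrier: "A \<in> carrier_mat n m \<Longrightarrow> mat_adjoint A \<in> carrier_mat m n"
  by (intro carrier_matI) (simp_all add: mat_adjoint_def)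

lemma mat_adjoint_index:
  "A \<in> carrier_mat n m \<Longrightarrow> i < m \<Longrightarrow> j < n \<Longrightarrow> mat_adjoint A $$ (i, j) = cnj (A $$ (j, i))"
  by (simp add: mat_adjoint_def mat_of_rows_def)

lemma unitary_iff_ortho:
  assumes U: "U \<in> carrier_mat n n"
  shows "mat_adjoint U * U = 1\<^sub>m n \<longleftrightarrow> ortho {..<n} {..<n} (\<lambda>k i. U $$ (i, k))"
proof -
  have "(mat_adjoint U * U) $$ (k, l) = ip {..<n} (\<lambda>i. U $$ (i, l)) (\<lambda>i. U $$ (i, k))" if "k < n" "l < n" for k l
  proof -
    have "(mat_adjoint U * U) $$ (k, l) = (\<Sum>i<n. mat_adjoint U $$ (k, i) * U $$ (i, l))"
      using that U mat_adjoint_carrier[OF U] by (simp add: scalar_prod_def atLeast0LessThan)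
    also have "\<dots> = (\<Sum>i<n. U $$ (i, l) * cnj (U $$ (i, k)))"
      using that by (intro sum.cong refl) (simp add: mat_adjoint_index[OF U])
    finally show ?thesis by (simp add: ip_def)
  qed
  moreover have "mat_adjoint U * U = 1\<^sub>m n \<longleftrightarrow>
      (\<forall>k<n. \<forall>l<n. (mat_adjoint U * U) $$ (k, l) = (if k = l then 1 else 0))"
  proof
    assume *: "\<forall>k<n. \<forall>l<n. (mat_adjoint U * U) $$ (k, l) = (if k = l then 1 else 0)"
    show "mat_adjoint U * U = 1\<^sub>m n"
      using U mat_adjoint_carrier[OF U] *
      by (intro eq_matI) (simp_all del: index_mult_mat(1))
  qed (simp del: index_mult_mat(1))
  ultimately show ?thesis by (auto simp: ortho_def)
qed

lemma diag_conj_index: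
  assumes U: "U \<in> carrier_mat n n" and ij: "i < n" "j < n"
  shows "(U * mat_diag n f * mat_adjoint U) $$ (i, j) = (\<Sum>k<n. f k * U $$ (i, k) * cnj (U $$ (j, k)))"
  unfolding mat_diag_mult_right[OF U] using U mat_adjoint_carrier[OF U] ij
  by (simp add: scalar_prod_def mat_adjoint_index[OF U] atLeast0LessThan mult_ac)

lemma expands_iff_diag_conj:
  assumes U: "U \<in> carrier_mat n n" and A: "A \<in> carrier_mat n n"
  shows "A = U * mat_diag n (\<lambda>k. complex_of_real (d k)) * mat_adjoint U \<longleftrightarrow>
    expands {..<n} {..<n} (\<lambda>k i. U $$ (i, k)) d (entries id A)"
proof -
  have "A = U * mat_diag n (\<lambda>k. complex_of_real (d k)) * mat_adjoint U \<longleftrightarrow>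
    (\<forall>i<n. \<forall>j<n. A $$ (i, j) = (U * mat_diag n (\<lambda>k. complex_of_real (d k)) * mat_adjoint U) $$ (i, j))"
    using U A mat_adjoint_carrier[OF U] by (auto intro!: eq_matI)
  then show ?thesis by (simp add: expands_def entries_def diag_conj_index[OF U] Ball_def)
qed

lemma mtrace_mult_expands:
  assumes A: "A \<in> carrier_mat n n" and B: "B \<in> carrier_mat n n"
    and u: "ortho {..<n} {..<n} u" "expands {..<n} {..<n} u p (entries id A)" "expands {..<n} {..<n} u q (entries id B)"
  shows "mtrace (A * B) = complex_of_real (\<Sum>k<n. p k * q k)"
proof -
  have "mtrace (A * B) = (\<Sum>i<n. \<Sum>j<n. A $$ (i, j) * B $$ (j, i))"
    using A B by (simp add: mtrace_def scalar_prod_def atLeast0LessThan)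
  also have "\<dots> = (\<Sum>i<n. \<Sum>j<n. \<Sum>k<n. complex_of_real (q k) * (A $$ (i, j) * u k j * cnj (u k i)))"
    using u(3) by (intro sum.cong refl) (simp add: expands_def entries_def sum_distrib_left mult_ac)
  also have "\<dots> = (\<Sum>i<n. \<Sum>k<n. \<Sum>j<n. complex_of_real (q k) * (A $$ (i, j) * u k j * cnj (u k i)))"
    by (rule sum.cong[OF refl], rule sum.swap)
  also have "\<dots> = (\<Sum>k<n. \<Sum>i<n. \<Sum>j<n. complex_of_real (q k) * (A $$ (i, j) * u k j * cnj (u k i)))"
    by (rule sum.swap)
  also have "\<dots> = (\<Sum>k<n. complex_of_real (q k) * ip {..<n} (mv {..<n} (entries id A) (u k)) (u k))"
    by (simp add: ip_def mv_def entries_def sum_distrib_left sum_distrib_right)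
  also have "\<dots> = (\<Sum>k<n. complex_of_real (q k) * complex_of_real (p k))"
    using expands_eigen[OF _ u(1,2)] u(1) by (simp add: ortho_def)
  finally show ?thesis by (simp add: mult.commute)
qed

text \<open>Whatever eigenbasis the choice in \<open>mat_log2\<close> has taken, it diagonalises the
  state and its logarithm together, so the trace is a sum over those eigenvalues;
  \<open>entropy_eq\<close> removes the dependence on the basis.\<close>

lemma vn_entropy_eq_entropy:
  assumes \<rho>: "\<rho> \<in> carrier_mat n n" and f: "bij_betw f J {..<n}" and pos: "pos J (entries f \<rho>)"
  shows "vn_entropy \<rho> = entropy J (entries f \<rho>) / ln 2"
proof -
  have pos': "pos {..<n} (entries id \<rho>)"
    using pos pos_reindex_iff[OF f, of "entries id \<rho>"] by (simp add: entries_def)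
  have fin: "finite {..<n}" by simp
  let ?P = "\<lambda>B. \<exists>U d. U \<in> carrier_mat (dim_row \<rho>) (dim_row \<rho>) \<and>
      mat_adjoint U * U = 1\<^sub>m (dim_row \<rho>) \<and>
      \<rho> = U * mat_diag (dim_row \<rho>) (\<lambda>i. complex_of_real (d i)) * mat_adjoint U \<and>
      B = U * mat_diag (dim_row \<rho>) (\<lambda>i. complex_of_real (log 2 (d i))) * mat_adjoint U"
  have n: "dim_row \<rho> = n" using \<rho> by simp
  obtain u p where u: "ortho {..<n} {..<n} u" "expands {..<n} {..<n} u p (entries id \<rho>)"
    using spectral_theorem_pos[OF fin pos'] by blast
  define U where "U = mat n n (\<lambda>(i, k). u k i)"
  have U: "U \<in> carrier_mat n n" by (simp add: U_def)
  have "ortho {..<n} {..<n} (\<lambda>k i. U $$ (i, k))"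
    using u(1) by (simp add: ortho_def ip_def U_def)
  moreover have "expands {..<n} {..<n} (\<lambda>k i. U $$ (i, k)) p (entries id \<rho>)"
    using u(2) by (simp add: expands_def U_def)
  ultimately have "?P (U * mat_diag n (\<lambda>i. complex_of_real (log 2 (p i))) * mat_adjoint U)"
    unfolding n unitary_iff_ortho[OF U, symmetric] expands_iff_diag_conj[OF U \<rho>, symmetric]
    using U by (intro exI[of _ U] exI[of _ p] conjI) (assumption | rule refl)+
  then have "?P (SOME B. ?P B)" by (rule someI[of ?P])
  then have "?P (mat_log2 \<rho>)" unfolding mat_log2_def .
  then obtain V d where V: "V \<in> carrier_mat n n" "mat_adjoint V * V = 1\<^sub>m n"
      "\<rho> = V * mat_diag n (\<lambda>i. complex_of_real (d i)) * mat_adjoint V"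
      "mat_log2 \<rho> = V * mat_diag n (\<lambda>i. complex_of_real (log 2 (d i))) * mat_adjoint V"
    unfolding n by blast
  have L: "mat_log2 \<rho> \<in> carrier_mat n n"
    unfolding V(4) using V(1) mat_adjoint_carrier[OF V(1)] by (intro mult_carrier_mat[of _ n n]) simp_all
  note o = V(2)[unfolded unitary_iff_ortho[OF V(1)]]
  note e = V(3)[unfolded expands_iff_diag_conj[OF V(1) \<rho>]]
  note l = V(4)[unfolded expands_iff_diag_conj[OF V(1) L]]
  have "vn_entropy \<rho> = - (\<Sum>k<n. d k * log 2 (d k))"
    unfolding vn_entropy_def mtrace_mult_expands[OF \<rho> L o e l] by simp
  also have "\<dots> = - (\<Sum>k<n. d k * ln (d k)) / ln 2"
    by (simp add: log_def sum_divide_distrib)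
  also have "\<dots> = entropy {..<n} (entries id \<rho>) / ln 2"
    using entropy_eq[OF fin fin pos' o e] by simp
  also have "entropy {..<n} (entries id \<rho>) = entropy J (entries f \<rho>)"
    using entropy_reindex[OF f fin pos'] by (simp add: entries_def)
  finally show ?thesis .
qed

section \<open>Partial traces and conditional mutual information of matrices\<close>

definition glue2 :: "nat \<Rightarrow> nat \<times> nat \<Rightarrow> nat" where
  "glue2 r = (\<lambda>(i, j). i * r + j)"

definition glue3 :: "nat \<Rightarrow> nat \<Rightarrow> nat \<times> nat \<times> nat \<Rightarrow> nat" where
  "glue3 d r = (\<lambda>(i, k, j). glue d r i k j)"

lemma bij_glue2: "bij_betw (glue2 r) ({..<l} \<times> {..<r}) {..<l * r}"
proof (rule bij_betw_inverse[where g = "\<lambda>x. (x div r, x mod r)"])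
  fix y assume y: "y \<in> {..<l * r}"
  then have "0 < r" by (cases r) auto
  then show "(y div r, y mod r) \<in> {..<l} \<times> {..<r} \<and> glue2 r (y div r, y mod r) = y"
    using y by (auto simp: glue2_def less_mult_imp_div_less)
qed (auto simp: glue2_def pair_index_less)

lemma bij_glue3: "bij_betw (glue3 d r) ({..<l} \<times> {..<d} \<times> {..<r}) {..<l * d * r}"
proof (rule bij_betw_inverse[where g = "\<lambda>x. (left_ix d r x, mid_ix d r x, right_ix r x)"])
  fix y assume y: "y \<in> {..<l * d * r}"
  then have r: "0 < r" "0 < d" by (auto intro: gr0I)
  moreover have "y div (d * r) < l" using y by (intro less_mult_imp_div_less) (simp add: mult.assoc)
  ultimately show "(left_ix d r y, mid_ix d r y, right_ix r y) \<in> {..<l} \<times> {..<d} \<times> {..<r} \<and>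
      glue3 d r (left_ix d r y, mid_ix d r y, right_ix r y) = y"
    by (auto simp: glue3_def glue_left_mid_right) (auto simp: left_ix_def mid_ix_def right_ix_def)
qed (auto simp: glue3_def glue_less left_mid_right_glue)

lemma ptrace_index:
  assumes "i < l" "j < r" "i' < l" "j' < r"
  shows "ptrace l d r X $$ (i * r + j, i' * r + j') = (\<Sum>k<d. X $$ (glue d r i k j, glue d r i' k j'))"
  using assms by (simp add: ptrace_def pair_index_less)

abbreviation tri :: "nat \<Rightarrow> nat \<Rightarrow> nat \<Rightarrow> (nat \<times> nat \<times> nat) set" where
  "tri a b e \<equiv> {..<a} \<times> {..<b} \<times> {..<e}"

text \<open>Pairing \<open>S(AE)\<close> with \<open>S(E)\<close> and \<open>S(ABE)\<close> with
  \<open>S(BE)\<close> yields the two conditional entropies; the base of the logarithm is a common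
  factor.\<close>

lemma I_M_eq_cond_mutual_info:
  assumes \<rho>: "\<rho> \<in> states (a, b, e)"
  shows "I_M (a, b, e) \<rho> = cond_mutual_info {..<a} {..<b} {..<e} (entries (glue3 b e) \<rho>) / ln 2"
proof -
  let ?R = "entries (glue3 b e) \<rho>"
  have R: "pos (tri a b e) ?R" and c: "\<rho> \<in> carrier_mat (a * b * e) (a * b * e)"
    using \<rho> density_iff_state[OF bij_glue3] by (auto simp: state_def)
  have "vn_entropy \<rho> = entropy (tri a b e) ?R / ln 2"
    by (rule vn_entropy_eq_entropy[OF c bij_glue3 R])
  moreover have "vn_entropy (ptrace a b e \<rho>) = entropy ({..<a} \<times> {..<e}) (trace_middle {..<b} ?R) / ln 2"
  proof -
    have eq: "entries (glue2 e) (ptrace a b e \<rho>) i j = trace_middle {..<b} ?R i j"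
      if "i \<in> {..<a} \<times> {..<e}" "j \<in> {..<a} \<times> {..<e}" for i j
      using that by (auto simp: entries_def glue2_def glue3_def trace_middle_def ptrace_index)
    have "pos ({..<a} \<times> {..<e}) (entries (glue2 e) (ptrace a b e \<rho>))"
      by (rule pos_cong[OF eq, THEN iffD2], assumption+) (rule pos_trace_middle[OF _ R], simp)
    moreover have "ptrace a b e \<rho> \<in> carrier_mat (a * e) (a * e)" by (simp add: ptrace_def)
    ultimately have "vn_entropy (ptrace a b e \<rho>) = entropy ({..<a} \<times> {..<e}) (entries (glue2 e) (ptrace a b e \<rho>)) / ln 2"
      by (intro vn_entropy_eq_entropy[OF _ bij_glue2])
    also have "entropy ({..<a} \<times> {..<e}) (entries (glue2 e) (ptrace a b e \<rho>)) = entropy ({..<a} \<times> {..<e}) (trace_middle {..<b} ?R)"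
      by (rule entropy_cong[OF eq])
    finally show ?thesis .
  qed
  moreover have "vn_entropy (ptrace 1 a (b * e) \<rho>) = entropy ({..<b} \<times> {..<e}) (trace_first {..<a} ?R) / ln 2"
  proof -
    have "entries (glue2 e) (ptrace 1 a (b * e) \<rho>) (k, j) (k', j') = trace_first {..<a} ?R (k, j) (k', j')"
      if "k < b" "j < e" "k' < b" "j' < e" for k j k' j'
      using that ptrace_index[of 0 1 "k * e + j" "b * e" 0 "k' * e + j'" a \<rho>]
      by (simp add: entries_def glue2_def glue3_def trace_first_def pair_index_less)
        (simp add: glue_def algebra_simps)
    then have eq: "entries (glue2 e) (ptrace 1 a (b * e) \<rho>) i j = trace_first {..<a} ?R i j"
      if "i \<in> {..<b} \<times> {..<e}" "j \<in> {..<b} \<times> {..<e}" for i j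
      using that by auto
    have "pos ({..<b} \<times> {..<e}) (entries (glue2 e) (ptrace 1 a (b * e) \<rho>))"
      by (rule pos_cong[OF eq, THEN iffD2], assumption+) (rule pos_trace_first[OF _ R], simp)
    moreover have "ptrace 1 a (b * e) \<rho> \<in> carrier_mat (b * e) (b * e)" by (simp add: ptrace_def)
    ultimately have "vn_entropy (ptrace 1 a (b * e) \<rho>)
        = entropy ({..<b} \<times> {..<e}) (entries (glue2 e) (ptrace 1 a (b * e) \<rho>)) / ln 2"
      by (intro vn_entropy_eq_entropy[OF _ bij_glue2])
    also have "entropy ({..<b} \<times> {..<e}) (entries (glue2 e) (ptrace 1 a (b * e) \<rho>)) = entropy ({..<b} \<times> {..<e}) (trace_first {..<a} ?R)"
      by (rule entropy_cong[OF eq])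
    finally show ?thesis .
  qed
  moreover have "vn_entropy (ptrace 1 (a * b) e \<rho>) = entropy {..<e} (trace_first {..<a} (trace_middle {..<b} ?R)) / ln 2"
  proof -
    have eq: "entries id (ptrace 1 (a * b) e \<rho>) i j = trace_first {..<a} (trace_middle {..<b} ?R) i j"
      if "i \<in> {..<e}" "j \<in> {..<e}" for i j
    proof -
      have "entries id (ptrace 1 (a * b) e \<rho>) i j = (\<Sum>m<a * b. \<rho> $$ (glue (a * b) e 0 m i, glue (a * b) e 0 m j))"
        using that ptrace_index[of 0 1 i e 0 j "a * b" \<rho>] by (simp add: entries_def)
      also have "\<dots> = (\<Sum>z\<in>{..<a} \<times> {..<b}. \<rho> $$ (glue (a * b) e 0 (glue2 b z) i, glue (a * b) e 0 (glue2 b z) j))"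
        by (rule sum.reindex_bij_betw[OF bij_glue2, symmetric])
      also have "\<dots> = trace_first {..<a} (trace_middle {..<b} ?R) i j"
        by (simp add: sum.cartesian_product' trace_first_def trace_middle_def entries_def glue2_def glue3_def glue_def)
      finally show ?thesis .
    qed
    have "pos {..<e} (entries id (ptrace 1 (a * b) e \<rho>))"
      by (rule pos_cong[OF eq, THEN iffD2], assumption+) (rule pos_trace_first[OF _ pos_trace_middle[OF _ R]], simp_all)
    moreover have "ptrace 1 (a * b) e \<rho> \<in> carrier_mat e e" "bij_betw id {..<e} {..<e}"
      by (simp_all add: ptrace_def)
    ultimately have "vn_entropy (ptrace 1 (a * b) e \<rho>) = entropy {..<e} (entries id (ptrace 1 (a * b) e \<rho>)) / ln 2"
      by (intro vn_entropy_eq_entropy)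
    also have "entropy {..<e} (entries id (ptrace 1 (a * b) e \<rho>)) = entropy {..<e} (trace_first {..<a} (trace_middle {..<b} ?R))"
      by (rule entropy_cong[OF eq])
    finally show ?thesis .
  qed
  ultimately show ?thesis
    by (simp add: cond_mutual_info_def cond_entropy_def add_divide_distrib diff_divide_distrib)
qed

section \<open>Choi-Kraus representation and extension by linearity\<close>

definition unit_mat :: "nat \<Rightarrow> nat \<times> nat \<Rightarrow> cmat" where
  "unit_mat n z = mat n n (\<lambda>x. if x = z then 1 else 0)"

lemma linear_map_mat_index:
  assumes lin: "linear_map_mat n m \<Phi>" and Y: "Y \<in> carrier_mat n n" and k: "k < m" "k' < m"
  shows "\<Phi> Y $$ (k, k') = (\<Sum>i<n. \<Sum>i'<n. Y $$ (i, i') * \<Phi> (unit_mat n (i, i')) $$ (k, k'))"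
proof -
  \<comment> \<open>\<open>Y\<close> cut down to the positions in \<open>S\<close>. Adding one
    position at a time turns binary additivity into the full sum.\<close>
  define P where "P S = mat n n (\<lambda>x. if x \<in> S then Y $$ x else 0)" for S
  have P: "P S \<in> carrier_mat n n" for S by (simp add: P_def)
  have u: "unit_mat n z \<in> carrier_mat n n" for z by (simp add: unit_mat_def)
  have \<Phi>: "X \<in> carrier_mat n n \<Longrightarrow> \<Phi> X \<in> carrier_mat m m"
    "X \<in> carrier_mat n n \<Longrightarrow> Z \<in> carrier_mat n n \<Longrightarrow> \<Phi> (X + Z) = \<Phi> X + \<Phi> Z"
    "X \<in> carrier_mat n n \<Longrightarrow> \<Phi> (c \<cdot>\<^sub>m X) = c \<cdot>\<^sub>m \<Phi> X" for X Z c
    using lin by (auto simp: linear_map_mat_def)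
  have sum: "\<Phi> (P S) $$ (k, k') = (\<Sum>z\<in>S. Y $$ z * \<Phi> (unit_mat n z) $$ (k, k'))"
    if "finite S" "S \<subseteq> {..<n} \<times> {..<n}" for S
    using that
  proof (induction S rule: finite_induct)
    case empty
    \<comment> \<open>Writing the zero matrix as \<open>0\<close> times itself lets homogeneity show
      that its image vanishes.\<close>
    have "P {} = 0 \<cdot>\<^sub>m P {}" by (rule eq_matI) (auto simp: P_def)
    then have "\<Phi> (P {}) = 0 \<cdot>\<^sub>m \<Phi> (P {})" using \<Phi>(3)[OF P] by metis
    then have "\<Phi> (P {}) $$ (k, k') = (0 \<cdot>\<^sub>m \<Phi> (P {})) $$ (k, k')" by simp
    then show ?case using k carrier_matD[OF \<Phi>(1)[OF P]] by simp
  next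
    case (insert z S)
    have "P (insert z S) = Y $$ z \<cdot>\<^sub>m unit_mat n z + P S"
      using insert.hyps by (intro eq_matI) (auto simp: P_def unit_mat_def)
    then have "\<Phi> (P (insert z S)) = Y $$ z \<cdot>\<^sub>m \<Phi> (unit_mat n z) + \<Phi> (P S)"
      using \<Phi>(2)[OF smult_carrier_mat[OF u] P] \<Phi>(3)[OF u] by simp
    then show ?case
      using insert k carrier_matD[OF \<Phi>(1)[OF P]] carrier_matD[OF \<Phi>(1)[OF u]] by simp
  qed
  have "P ({..<n} \<times> {..<n}) = Y" using Y by (intro eq_matI) (auto simp: P_def)
  then show ?thesis using sum[of "{..<n} \<times> {..<n}"] by (simp add: sum.cartesian_product')
qed

text \<open>The Kraus operators come from the eigenvectors of the Choi matrix \<open>C\<close>, the image of the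
  unnormalised maximally entangled state.\<close>

lemma quantum_operation_kraus:
  assumes "quantum_operation n m \<Phi>"
  obtains M :: "(nat \<times> nat) set" and F where "finite M" "trace_preserving M {..<m} {..<n} F"
    "\<And>Y k k'. Y \<in> carrier_mat n n \<Longrightarrow> k < m \<Longrightarrow> k' < m \<Longrightarrow>
      \<Phi> Y $$ (k, k') = kraus M {..<n} F (entries id Y) k k'"
proof -
  have lin: "linear_map_mat n m \<Phi>" and cp: "completely_positive n m \<Phi>"
    and tr: "\<And>X. X \<in> carrier_mat n n \<Longrightarrow> mtrace (\<Phi> X) = mtrace X"
    using assms by (auto simp: quantum_operation_def)
  have u: "unit_mat n z \<in> carrier_mat n n" for z by (simp add: unit_mat_def)
  have \<Phi>u: "\<Phi> (unit_mat n z) \<in> carrier_mat m m" for z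
    using lin u by (simp add: linear_map_mat_def)
  \<comment> \<open>The number \<open>x\<close> stands for the pair
    \<open>(x div n, x mod n)\<close>, so this is the rank-one operator of the sum of all
    \<open>|i>|i>\<close>.\<close>
  define X :: cmat where "X = mat (n * n) (n * n)
    (\<lambda>(x, y). (if x div n = x mod n then 1 else 0) * (if y div n = y mod n then 1 else 0))"
  have "expands {..<n * n} {()} (\<lambda>_ x. if x div n = x mod n then 1 else 0) (\<lambda>_. 1) (entries id X)"
    by (auto simp: expands_def entries_def X_def)
  then have "pos {..<n * n} (entries id X)" by (rule expands_pos) simp
  then have "psd (n * n) X" by (simp add: psd_iff_pos X_def)
  then have "psd (n * m) (amplify n n m 1 \<Phi> X)"
    using cp by (simp add: completely_positive_def)
  then have "pos {..<n * m} (entries id (amplify n n m 1 \<Phi> X))" by (simp add: psd_iff_pos)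
  from pos_reindex[OF bij_glue2 this]
  have "pos ({..<n} \<times> {..<m}) (\<lambda>i j. entries id (amplify n n m 1 \<Phi> X) (glue2 m i) (glue2 m j))" .
  moreover define C where "C = (\<lambda>(i, k) (i', k'). \<Phi> (unit_mat n (i, i')) $$ (k, k'))"
  have "entries id (amplify n n m 1 \<Phi> X) (glue2 m i) (glue2 m j) = C i j"
    if ij': "i \<in> {..<n} \<times> {..<m}" "j \<in> {..<n} \<times> {..<m}" for i j
  proof -
    obtain a k a' k' where ij: "i = (a, k)" "j = (a', k')" and l: "a < n" "k < m" "a' < n" "k' < m"
      using ij' by auto
    have g: "left_ix m 1 (a * m + k) = a" "mid_ix m 1 (a * m + k) = k" "right_ix 1 (a * m + k) = 0"
      if "k < m" for a k
      using left_mid_right_glue[OF that, of 0 1 a] by (simp_all add: glue_def)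
    have "mat n n (\<lambda>(s, s'). X $$ (glue n 1 a s 0, glue n 1 a' s' 0)) = unit_mat n (a, a')"
      using l by (intro eq_matI) (auto simp: X_def unit_mat_def glue_def pair_index_less)
    then show ?thesis
      using l by (simp add: ij entries_def glue2_def amplify_def pair_index_less g C_def del: One_nat_def)
  qed
  ultimately have C: "pos ({..<n} \<times> {..<m}) C"
    using pos_cong[of "{..<n} \<times> {..<m}" "\<lambda>i j. entries id (amplify n n m 1 \<Phi> X) (glue2 m i) (glue2 m j)" C]
    by blast
  have fin: "finite ({..<n} \<times> {..<m})" by simp
  obtain w p where w: "expands ({..<n} \<times> {..<m}) ({..<n} \<times> {..<m}) w p C"
    and p: "\<And>a. a \<in> {..<n} \<times> {..<m} \<Longrightarrow> 0 \<le> p a"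
    using spectral_theorem_pos[OF fin C] by blast
  let ?M = "{..<n} \<times> {..<m}"
  \<comment> \<open>Each eigenvector of the Choi matrix, scaled by the root of its eigenvalue, is
    reshaped into a matrix with rows \<open>k\<close> and columns \<open>i\<close>.\<close>
  define F where "F a k i = complex_of_real (sqrt (p a)) * w a (i, k)" for a k i
  have F: "F a k i * cnj (F a k' i') = complex_of_real (p a) * w a (i, k) * cnj (w a (i', k'))"
    if "a \<in> ?M" for a k i k' i'
  proof -
    have "F a k i * cnj (F a k' i') = complex_of_real (sqrt (p a) * sqrt (p a)) * w a (i, k) * cnj (w a (i', k'))"
      by (simp only: F_def complex_cnj_mult complex_cnj_complex_of_real of_real_mult mult_ac)
    also have "sqrt (p a) * sqrt (p a) = p a" using p[OF that] by simp
    finally show ?thesis .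
  qed
  have CF: "C (i, k) (i', k') = (\<Sum>a\<in>?M. F a k i * cnj (F a k' i'))" if "i < n" "k < m" "i' < n" "k' < m" for i k i' k'
    using w that by (simp add: expands_def F)
  \<comment> \<open>The inner product of two stacked columns is an entry of the Choi matrix traced
    over the output, that is the trace of the image of a matrix unit, and \<open>\<Phi>\<close>
    preserves that trace.\<close>
  have "trace_preserving ?M {..<m} {..<n} F"
    unfolding trace_preserving_def ortho_def
  proof (intro ballI)
    fix i i' assume i: "i \<in> {..<n}" "i' \<in> {..<n}"
    have "ip (?M \<times> {..<m}) (\<lambda>(a, k). F a k i) (\<lambda>(a, k). F a k i') = (\<Sum>a\<in>?M. \<Sum>k<m. F a k i * cnj (F a k i'))"
      by (simp add: ip_def sum.cartesian_product split_def)
    also have "\<dots> = (\<Sum>k<m. C (i, k) (i', k))" using i by (subst sum.swap) (simp add: CF)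
    also have "\<dots> = mtrace (\<Phi> (unit_mat n (i, i')))"
      using \<Phi>u[of "(i, i')"] by (simp add: mtrace_def C_def)
    also have "\<dots> = (\<Sum>k<n. if k = i then if i = i' then 1 else 0 else 0)"
      unfolding tr[OF u] by (auto simp: mtrace_def unit_mat_def intro!: sum.cong)
    also have "\<dots> = (if i = i' then 1 else 0)" using i by simp
    finally show "ip (?M \<times> {..<m}) (\<lambda>(a, k). F a k i) (\<lambda>(a, k). F a k i') = (if i = i' then 1 else 0)" .
  qed
  moreover have "\<Phi> Y $$ (k, k') = kraus ?M {..<n} F (entries id Y) k k'"
    if Y: "Y \<in> carrier_mat n n" and k: "k < m" "k' < m" for Y k k'
  proof -
    have "\<Phi> Y $$ (k, k') = (\<Sum>i<n. \<Sum>i'<n. Y $$ (i, i') * C (i, k) (i', k'))"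
      unfolding linear_map_mat_index[OF lin Y k] by (simp add: C_def)
    also have "\<dots> = (\<Sum>i<n. \<Sum>i'<n. \<Sum>a\<in>?M. F a k i * Y $$ (i, i') * cnj (F a k' i'))"
      using k by (intro sum.cong refl) (simp add: CF sum_distrib_left mult_ac)
    also have "\<dots> = (\<Sum>i<n. \<Sum>a\<in>?M. \<Sum>i'<n. F a k i * Y $$ (i, i') * cnj (F a k' i'))"
      by (rule sum.cong[OF refl], rule sum.swap)
    also have "\<dots> = (\<Sum>a\<in>?M. \<Sum>i<n. \<Sum>i'<n. F a k i * Y $$ (i, i') * cnj (F a k' i'))"
      by (rule sum.swap)
    finally show ?thesis by (simp add: kraus_def entries_def)
  qed
  ultimately show ?thesis using that[OF fin] by blast
qed

lemma sum_unit_pair: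
  fixes f :: "nat \<Rightarrow> nat \<Rightarrow> complex"
  assumes "k < n" "k' < n"
  shows "(\<Sum>i<n. \<Sum>i'<n. f i i' * (if (k, k') = (i, i') then 1 else 0)) = f k k'"
proof -
  have "(\<Sum>i<n. \<Sum>i'<n. f i i' * (if (k, k') = (i, i') then 1 else 0))
      = (\<Sum>z\<in>{..<n} \<times> {..<n}. if z = (k, k') then f (fst z) (snd z) else 0)"
    unfolding sum.cartesian_product by (intro sum.cong refl) (auto split: if_splits)
  then show ?thesis using assms by simp
qed

text \<open>Recovery is known on states only, but blocks of a joint state need not be states.
  Normalised pure states are enough: at a fixed output position the deviation from the identity is a
  quadratic form in the state vector, and polarisation makes it vanish.\<close>

lemma linear_map_fixing_densities:
  assumes lin: "linear_map_mat n n W" and W: "\<And>\<rho>. density n \<rho> \<Longrightarrow> W \<rho> = \<rho>" and Y: "Y \<in> carrier_mat n n"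
  shows "W Y = Y"
proof -
  have key: "W (unit_mat n (i, i')) $$ (k, k') = (if (k, k') = (i, i') then 1 else 0)"
    if k: "k < n" "k' < n" and i: "i < n" "i' < n" for k k' i i'
  proof -
    \<comment> \<open>The arguments are exchanged so that pairing with the state of \<open>z\<close>
      gives the form \<open><D z, z>\<close>, up to the normalisation.\<close>
    define D where "D i' i = W (unit_mat n (i, i')) $$ (k, k') - (if (k, k') = (i, i') then 1 else 0)" for i' i
    have "ip {..<n} (mv {..<n} D z) z = 0" for z
    proof (cases "sqnorm {..<n} z = 0")
      case True
      then have "z i = 0" if "i < n" for i
        using that by (auto simp: sqnorm_def sum_nonneg_eq_0_iff)
      then show ?thesis by (simp add: ip_def)
    next
      case False
      define N where "N = sqnorm {..<n} z"
      have N: "0 < N" using False sqnorm_nonneg[of "{..<n}" z] by (simp add: N_def)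
      define \<rho> where "\<rho> = mat n n (\<lambda>(i, i'). z i * cnj (z i') / complex_of_real N)"
      have \<rho>: "\<rho> \<in> carrier_mat n n" by (simp add: \<rho>_def)
      have "expands {..<n} {()} (\<lambda>_. z) (\<lambda>_. 1 / N) (entries id \<rho>)"
        by (auto simp: expands_def entries_def \<rho>_def)
      then have "pos {..<n} (entries id \<rho>)" using N by (intro expands_pos) auto
      moreover have "mtrace \<rho> = ip {..<n} z z / complex_of_real N"
        by (simp add: mtrace_def \<rho>_def ip_def sum_divide_distrib)
      ultimately have "density n \<rho>"
        using \<rho> N by (simp add: density_def psd_iff_pos ip_self N_def)
      then have "W \<rho> $$ (k, k') = \<rho> $$ (k, k')" using W by simp
      then have "(\<Sum>i<n. \<Sum>i'<n. \<rho> $$ (i, i') * W (unit_mat n (i, i')) $$ (k, k')) = \<rho> $$ (k, k')"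
        using linear_map_mat_index[OF lin \<rho> k] by simp
      also have "\<rho> $$ (k, k') = (\<Sum>i<n. \<Sum>i'<n. \<rho> $$ (i, i') * (if (k, k') = (i, i') then 1 else 0))"
        using sum_unit_pair[OF k, of "\<lambda>i i'. \<rho> $$ (i, i')"] by simp
      finally have "(\<Sum>i<n. \<Sum>i'<n. \<rho> $$ (i, i') * D i' i) = 0"
        by (simp add: D_def right_diff_distrib sum_subtractf)
      moreover have "(\<Sum>i<n. \<Sum>i'<n. \<rho> $$ (i, i') * D i' i) = ip {..<n} (mv {..<n} D z) z / complex_of_real N"
      proof -
        have "(\<Sum>i<n. \<Sum>i'<n. \<rho> $$ (i, i') * D i' i) = (\<Sum>i'<n. \<Sum>i<n. D i' i * z i * cnj (z i') / complex_of_real N)"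
          by (subst sum.swap) (simp add: \<rho>_def mult_ac)
        then show ?thesis
          by (simp add: ip_def mv_def sum_distrib_right sum_divide_distrib)
      qed
      ultimately show ?thesis using N by simp
    qed
    from quadratic_form_zero[OF _ _ _ this, of i' i] i show ?thesis by (simp add: D_def)
  qed
  have WY: "W Y \<in> carrier_mat n n" using lin Y by (simp add: linear_map_mat_def)
  show ?thesis
  proof (rule eq_matI)
    fix k k' assume "k < dim_row Y" "k' < dim_col Y"
    then have k: "k < n" "k' < n" using Y by auto
    have "W Y $$ (k, k') = (\<Sum>i<n. \<Sum>i'<n. Y $$ (i, i') * W (unit_mat n (i, i')) $$ (k, k'))"
      by (rule linear_map_mat_index[OF lin Y k])
    also have "\<dots> = (\<Sum>i<n. \<Sum>i'<n. Y $$ (i, i') * (if (k, k') = (i, i') then 1 else 0))"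
      using k by (intro sum.cong refl) (simp add: key)
    finally show "W Y $$ (k, k') = Y $$ (k, k')"
      using sum_unit_pair[OF k, of "\<lambda>i i'. Y $$ (i, i')"] by simp
  qed (use WY Y in auto)
qed

section \<open>Operations of the three parties\<close>

lemma cond_mutual_info_reindex:
  assumes fin: "finite A" "finite B" "finite E" and R: "pos (A \<times> B \<times> E) R"
    and g: "bij_betw gA A' A" "bij_betw gB B' B" "bij_betw gE E' E"
  shows "cond_mutual_info A' B' E' (\<lambda>(a, b, e) (a', b', e'). R (gA a, gB b, gE e) (gA a', gB b', gE e')) = cond_mutual_info A B E R"
proof -
  let ?R = "\<lambda>(a, b, e) (a', b', e'). R (gA a, gB b, gE e) (gA a', gB b', gE e')"
  have "trace_middle B' ?R (a, e) (a', e') = trace_middle B R (gA a, gE e) (gA a', gE e')" for a e a' e'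
    unfolding trace_middle_def prod.case by (rule sum.reindex_bij_betw[OF g(2)])
  then have t: "trace_middle B' ?R = (\<lambda>x y. trace_middle B R (map_prod gA gE x) (map_prod gA gE y))"
    by (auto simp: fun_eq_iff)
  have "trace_first A' ?R y y' = trace_first A R (map_prod gB gE y) (map_prod gB gE y')" for y y'
    unfolding trace_first_def split_def fst_conv snd_conv map_prod_def by (rule sum.reindex_bij_betw[OF g(1)])
  then have p: "trace_first A' ?R = (\<lambda>x y. trace_first A R (map_prod gB gE x) (map_prod gB gE y))"
    by (simp add: fun_eq_iff)
  have "trace_first A' (trace_middle B' ?R) e e' = trace_first A (trace_middle B R) (gE e) (gE e')" for e e'
    unfolding t trace_first_def map_prod_simp by (rule sum.reindex_bij_betw[OF g(1)])
  then have pt: "trace_first A' (trace_middle B' ?R) = (\<lambda>x y. trace_first A (trace_middle B R) (gE x) (gE y))"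
    by (simp add: fun_eq_iff)
  have r: "?R = (\<lambda>x y. R (map_prod gA (map_prod gB gE) x) (map_prod gA (map_prod gB gE) y))"
    by (auto simp: fun_eq_iff)
  have 1: "entropy (A' \<times> E') (trace_middle B' ?R) = entropy (A \<times> E) (trace_middle B R)"
    unfolding t using fin by (intro entropy_reindex bij_betw_map_prod g pos_trace_middle R) auto
  have 2: "entropy E' (trace_first A' (trace_middle B' ?R)) = entropy E (trace_first A (trace_middle B R))"
    unfolding pt using fin by (intro entropy_reindex g pos_trace_first pos_trace_middle R) auto
  have 3: "entropy (B' \<times> E') (trace_first A' ?R) = entropy (B \<times> E) (trace_first A R)"
    unfolding p using fin by (intro entropy_reindex bij_betw_map_prod g pos_trace_first R) auto
  have 4: "entropy (A' \<times> B' \<times> E') ?R = entropy (A \<times> B \<times> E) R"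
    unfolding r using fin by (intro entropy_reindex bij_betw_map_prod g R) auto
  show ?thesis unfolding cond_mutual_info_def cond_entropy_def 1 2 3 4 ..
qed

lemma state_swap_parties: "state (B \<times> A \<times> E) (swap_parties R) \<longleftrightarrow> state (A \<times> B \<times> E) R"
proof -
  have f: "bij_betw (\<lambda>(b, a, e). (a, b, e)) (B \<times> A \<times> E) (A \<times> B \<times> E)"
    by (rule bij_betw_inverse[where g = "\<lambda>(a, b, e). (b, a, e)"]) auto
  have "swap_parties R = (\<lambda>i j. R (case i of (b, a, e) \<Rightarrow> (a, b, e)) (case j of (b, a, e) \<Rightarrow> (a, b, e)))"
    by (auto simp: swap_parties_def fun_eq_iff)
  then show ?thesis
    using pos_reindex_iff[OF f, of R] sum.reindex_bij_betw[OF f, of "\<lambda>i. R i i"]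
    by (simp add: state_def)
qed

text \<open>The system of a party may consist of several registers; \<open>gA\<close>, \<open>gB\<close> and \<open>gE\<close> number their joint basis.\<close>

definition enc :: "nat \<Rightarrow> nat \<Rightarrow> ('x \<Rightarrow> nat) \<Rightarrow> ('y \<Rightarrow> nat) \<Rightarrow> ('z \<Rightarrow> nat) \<Rightarrow> 'x \<times> 'y \<times> 'z \<Rightarrow> nat" where
  "enc b e gA gB gE = (\<lambda>(x, y, z). glue b e (gA x) (gB y) (gE z))"

lemma states_enc:
  assumes g: "bij_betw gA A {..<a}" "bij_betw gB B {..<b}" "bij_betw gE E {..<e}"
  shows "\<rho> \<in> states (a, b, e) \<longleftrightarrow>
      \<rho> \<in> carrier_mat (a * b * e) (a * b * e) \<and> state (A \<times> B \<times> E) (entries (enc b e gA gB gE) \<rho>)"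
    and "\<rho> \<in> states (a, b, e) \<Longrightarrow> I_M (a, b, e) \<rho> = cond_mutual_info A B E (entries (enc b e gA gB gE) \<rho>) / ln 2"
proof -
  have c: "enc b e gA gB gE = glue3 b e \<circ> map_prod gA (map_prod gB gE)"
    by (auto simp: enc_def glue3_def fun_eq_iff)
  have f: "bij_betw (enc b e gA gB gE) (A \<times> B \<times> E) {..<a * b * e}"
    unfolding c by (rule bij_betw_trans[OF bij_betw_map_prod[OF g(1) bij_betw_map_prod[OF g(2,3)]] bij_glue3])
  show "\<rho> \<in> states (a, b, e) \<longleftrightarrow>
      \<rho> \<in> carrier_mat (a * b * e) (a * b * e) \<and> state (A \<times> B \<times> E) (entries (enc b e gA gB gE) \<rho>)"
    using density_iff_state[OF f] by simp
  assume \<rho>: "\<rho> \<in> states (a, b, e)"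
  then have pos: "pos (tri a b e) (entries (glue3 b e) \<rho>)"
    using density_iff_state[OF bij_glue3] by (auto simp: state_def)
  have "entries (enc b e gA gB gE) \<rho> = (\<lambda>(x, y, z) (x', y', z').
      entries (glue3 b e) \<rho> (gA x, gB y, gE z) (gA x', gB y', gE z'))"
    by (auto simp: entries_def enc_def glue3_def fun_eq_iff)
  then have "cond_mutual_info A B E (entries (enc b e gA gB gE) \<rho>) = cond_mutual_info {..<a} {..<b} {..<e} (entries (glue3 b e) \<rho>)"
    using cond_mutual_info_reindex[OF _ _ _ pos g] by simp
  then show "I_M (a, b, e) \<rho> = cond_mutual_info A B E (entries (enc b e gA gB gE) \<rho>) / ln 2"
    using I_M_eq_cond_mutual_info[OF \<rho>] by simp
qed

lemma bij_id: "bij_betw id {..<n::nat} {..<n}"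
  by simp

section \<open>Local and reversible operations\<close>

lemma amplify_index:
  assumes kr: "\<And>Y k k'. Y \<in> carrier_mat n n \<Longrightarrow> k < m \<Longrightarrow> k' < m \<Longrightarrow> \<Phi> Y $$ (k, k') = kraus M {..<n} F (entries id Y) k k'"
    and "i < l" "k < m" "j < r" "i' < l" "k' < m" "j' < r"
  shows "amplify l n m r \<Phi> X $$ (glue m r i k j, glue m r i' k' j')
    = (\<Sum>a\<in>M. \<Sum>s<n. \<Sum>s'<n. F a k s * X $$ (glue n r i s j, glue n r i' s' j') * cnj (F a k' s'))"
proof -
  have "amplify l n m r \<Phi> X $$ (glue m r i k j, glue m r i' k' j')
    = \<Phi> (mat n n (\<lambda>(s, s'). X $$ (glue n r i s j, glue n r i' s' j'))) $$ (k, k')"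
    using assms by (simp add: amplify_def glue_less left_mid_right_glue)
  also have "\<dots> = kraus M {..<n} F (entries id (mat n n (\<lambda>(s, s'). X $$ (glue n r i s j, glue n r i' s' j')))) k k'"
    using assms by (intro kr) auto
  finally show ?thesis by (simp add: kraus_def entries_def)
qed

text \<open>Registers may be grouped differently before and after an operation, hence the two
  separate families of numberings.\<close>

lemma I_M_step:
  assumes g: "bij_betw gA A {..<a}" "bij_betw gB B {..<b}" "bij_betw gE E {..<e}"
    and g': "bij_betw gA' A' {..<a'}" "bij_betw gB' B' {..<b'}" "bij_betw gE' E' {..<e'}"
    and \<rho>: "\<rho> \<in> states (a, b, e)" and \<sigma>: "\<sigma> \<in> carrier_mat (a' * b' * e') (a' * b' * e')"
    and st: "state (A' \<times> B' \<times> E') (entries (enc b' e' gA' gB' gE') \<sigma>)"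
    and le: "cond_mutual_info A' B' E' (entries (enc b' e' gA' gB' gE') \<sigma>) \<le> cond_mutual_info A B E (entries (enc b e gA gB gE) \<rho>)"
  shows "\<sigma> \<in> states (a', b', e') \<and> I_M (a', b', e') \<sigma> \<le> I_M (a, b, e) \<rho>"
proof
  show \<sigma>': "\<sigma> \<in> states (a', b', e')" using states_enc(1)[OF g'] \<sigma> st by blast
  show "I_M (a', b', e') \<sigma> \<le> I_M (a, b, e) \<rho>"
    unfolding states_enc(2)[OF g' \<sigma>'] states_enc(2)[OF g \<rho>] using le by (simp add: divide_right_mono)
qed

lemma amplify_carrier: "amplify l n m r \<Phi> X \<in> carrier_mat (l * m * r) (l * m * r)"
  by (simp add: amplify_def)

lemma I_M_local_B:
  assumes \<Phi>: "quantum_operation b b' \<Phi>" and \<rho>: "\<rho> \<in> states (a, b, e)"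
  defines "\<sigma> \<equiv> amplify a b b' e \<Phi> \<rho>"
  shows "\<sigma> \<in> states (a, b', e) \<and> I_M (a, b', e) \<sigma> \<le> I_M (a, b, e) \<rho>"
proof -
  obtain M :: "(nat \<times> nat) set" and F where M: "finite M" and trace_preserving: "trace_preserving M {..<b'} {..<b} F" and
    kr: "\<And>Y k k'. Y \<in> carrier_mat b b \<Longrightarrow> k < b' \<Longrightarrow> k' < b' \<Longrightarrow> \<Phi> Y $$ (k, k') = kraus M {..<b} F (entries id Y) k k'"
    using quantum_operation_kraus[OF \<Phi>] by blast
  have R: "state (tri a b e) (entries (enc b e id id id) \<rho>)"
    using \<rho> states_enc(1)[OF bij_id bij_id bij_id] by blast
  then have pos: "pos (tri a b e) (entries (enc b e id id id) \<rho>)" by (simp add: state_def)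
  have eq: "entries (enc b' e id id id) \<sigma> (i, k, j) (i', k', j') =
      (\<Sum>m\<in>M. \<Sum>s<b. \<Sum>s'<b. F m k s * entries (enc b e id id id) \<rho> (i, s, j) (i', s', j') * cnj (F m k' s'))"
    if "i \<in> {..<a}" "k \<in> {..<b'}" "j \<in> {..<e}" "i' \<in> {..<a}" "k' \<in> {..<b'}" "j' \<in> {..<e}" for i k j i' k' j'
    using that by (simp add: entries_def enc_def \<sigma>_def amplify_index[OF kr])
  note ch = cond_mutual_info_channel_2[OF finite_lessThan finite_lessThan finite_lessThan finite_lessThan M pos trace_preserving eq]
  show ?thesis
    by (rule I_M_step[OF bij_id bij_id bij_id bij_id bij_id bij_id \<rho> _ ch(2)[OF _ _ _ _ _ _ R] ch(1)])
      (simp_all add: \<sigma>_def amplify_carrier)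
qed

lemma glue_assoc: "glue b e i k j = glue a (b * e) 0 i (k * e + j)" "glue b e i k j = glue e 1 (i * b + k) j 0"
  by (simp_all add: glue_def algebra_simps)

text \<open>After exchanging the parties this is a channel on the second one. The systems
  \<open>B\<close> and \<open>E\<close> form a single outer factor of \<open>amplify\<close> here,
  which \<open>glue_assoc\<close> splits again.\<close>

lemma I_M_local_A:
  assumes \<Phi>: "quantum_operation a a' \<Phi>" and \<rho>: "\<rho> \<in> states (a, b, e)"
  defines "\<sigma> \<equiv> amplify 1 a a' (b * e) \<Phi> \<rho>"
  shows "\<sigma> \<in> states (a', b, e) \<and> I_M (a', b, e) \<sigma> \<le> I_M (a, b, e) \<rho>"
proof -
  obtain M :: "(nat \<times> nat) set" and F where M: "finite M" and trace_preserving: "trace_preserving M {..<a'} {..<a} F" and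
    kr: "\<And>Y k k'. Y \<in> carrier_mat a a \<Longrightarrow> k < a' \<Longrightarrow> k' < a' \<Longrightarrow> \<Phi> Y $$ (k, k') = kraus M {..<a} F (entries id Y) k k'"
    using quantum_operation_kraus[OF \<Phi>] by blast
  let ?R = "entries (enc b e id id id) \<rho>" and ?R' = "entries (enc b e id id id) \<sigma>"
  have R: "state (tri a b e) ?R"
    using \<rho> states_enc(1)[OF bij_id bij_id bij_id] by blast
  then have Rs: "state (tri b a e) (swap_parties ?R)" by (simp add: state_swap_parties)
  then have pos: "pos (tri b a e) (swap_parties ?R)" by (simp add: state_def)
  have eq: "swap_parties ?R' (k, i, j) (k', i', j') = (\<Sum>m\<in>M. \<Sum>s<a. \<Sum>s'<a. F m i s * swap_parties ?R (k, s, j) (k', s', j') * cnj (F m i' s'))"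
    if "k \<in> {..<b}" "i \<in> {..<a'}" "j \<in> {..<e}" "k' \<in> {..<b}" "i' \<in> {..<a'}" "j' \<in> {..<e}" for k i j k' i' j'
  proof -
    have "swap_parties ?R' (k, i, j) (k', i', j') = \<sigma> $$ (glue a' (b * e) 0 i (k * e + j), glue a' (b * e) 0 i' (k' * e + j'))"
      by (simp add: entries_def enc_def glue_assoc(1)[of b e _ _ _ a'])
    also have "\<dots> = (\<Sum>m\<in>M. \<Sum>s<a. \<Sum>s'<a. F m i s *
        \<rho> $$ (glue a (b * e) 0 s (k * e + j), glue a (b * e) 0 s' (k' * e + j')) * cnj (F m i' s'))"
      unfolding \<sigma>_def using that by (intro amplify_index[OF kr]) (simp_all add: pair_index_less)
    finally show ?thesis by (simp add: entries_def enc_def glue_assoc(1)[of b e _ _ _ a])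
  qed
  note ch = cond_mutual_info_channel_2[OF finite_lessThan finite_lessThan finite_lessThan finite_lessThan M pos trace_preserving eq]
  have "state (tri b a' e) (swap_parties ?R')" by (rule ch(2)[OF _ _ _ _ _ _ Rs])
  then have R': "state (tri a' b e) ?R'" by (simp only: state_swap_parties)
  have le: "cond_mutual_info {..<b} {..<a'} {..<e} (swap_parties ?R') \<le> cond_mutual_info {..<b} {..<a} {..<e} (swap_parties ?R)" by (rule ch(1))
  show ?thesis
    by (rule I_M_step[OF bij_id bij_id bij_id bij_id bij_id bij_id \<rho> _ R'])
      (use le cond_mutual_info_swap[OF _ _ _ R] cond_mutual_info_swap[OF _ _ _ R'] in \<open>simp_all add: \<sigma>_def amplify_def mult.assoc\<close>)
qed

text \<open>\<open>V\<close> cannot lower \<open>S(A|BE)\<close>, and the recovery \<open>V'\<close>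
  shows that the output value of \<open>S(A|E)\<close> does not exceed the input value. Together
  these bound the difference.\<close>

lemma I_M_reversible_E:
  assumes V: "reversible_operation e e' V" and \<rho>: "\<rho> \<in> states (a, b, e)"
  defines "\<sigma> \<equiv> amplify (a * b) e e' 1 V \<rho>"
  shows "\<sigma> \<in> states (a, b, e') \<and> I_M (a, b, e') \<sigma> \<le> I_M (a, b, e) \<rho>"
proof -
  obtain V' where qV: "quantum_operation e e' V" and qV': "quantum_operation e' e V'"
    and VV: "\<And>\<rho>. density e \<rho> \<Longrightarrow> V' (V \<rho>) = \<rho>"
    using V by (auto simp: reversible_operation_def)
  obtain M :: "(nat \<times> nat) set" and F where M: "finite M" and trace_preserving: "trace_preserving M {..<e'} {..<e} F" and
    kr: "\<And>Y k k'. Y \<in> carrier_mat e e \<Longrightarrow> k < e' \<Longrightarrow> k' < e' \<Longrightarrow> V Y $$ (k, k') = kraus M {..<e} F (entries id Y) k k'"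
    using quantum_operation_kraus[OF qV] by blast
  obtain M' :: "(nat \<times> nat) set" and F' where M': "finite M'" and trace_preserving': "trace_preserving M' {..<e} {..<e'} F'" and
    kr': "\<And>Y k k'. Y \<in> carrier_mat e' e' \<Longrightarrow> k < e \<Longrightarrow> k' < e \<Longrightarrow> V' Y $$ (k, k') = kraus M' {..<e'} F' (entries id Y) k k'"
    using quantum_operation_kraus[OF qV'] by blast
  have lin: "linear_map_mat e e (\<lambda>Y. V' (V Y))"
    using qV qV' by (simp add: quantum_operation_def linear_map_mat_def)
  let ?R = "entries (enc b e id id id) \<rho>" and ?R' = "entries (enc b e' id id id) \<sigma>"
  have R: "state (tri a b e) ?R"
    using \<rho> states_enc(1)[OF bij_id bij_id bij_id] by blast
  then have pos: "pos (tri a b e) ?R" by (simp add: state_def)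
  have eq: "?R' (i, k, j) (i', k', j') = (\<Sum>m\<in>M. \<Sum>s<e. \<Sum>s'<e. F m j s * ?R (i, k, s) (i', k', s') * cnj (F m j' s'))"
    if "i \<in> {..<a}" "k \<in> {..<b}" "j \<in> {..<e'}" "i' \<in> {..<a}" "k' \<in> {..<b}" "j' \<in> {..<e'}" for i k j i' k' j'
    using that amplify_index[OF kr, where i = "i * b + k" and l = "a * b" and k = j and j = 0 and r = 1
          and i' = "i' * b + k'" and k' = j' and j' = 0 and X = \<rho>]
    by (simp add: entries_def enc_def \<sigma>_def glue_assoc(2)[of b e] glue_assoc(2)[of b e'] pair_index_less del: One_nat_def)
  note ch = cond_entropy_channel_E[OF finite_lessThan finite_lessThan finite_lessThan finite_lessThan M pos trace_preserving eq]
  have R': "state (tri a b e') ?R'" by (rule ch(3)[OF _ _ _ _ _ _ R])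
  then have pos': "pos (tri a b e') ?R'" by (simp add: state_def)
  have eq': "?R (i, k, j) (i', k', j') = (\<Sum>m\<in>M'. \<Sum>s<e'. \<Sum>s'<e'. F' m j s * ?R' (i, k, s) (i', k', s') * cnj (F' m j' s'))"
    if "i \<in> {..<a}" "k \<in> {..<b}" "j \<in> {..<e}" "i' \<in> {..<a}" "k' \<in> {..<b}" "j' \<in> {..<e}" for i k j i' k' j'
  proof -
    \<comment> \<open>A block of the joint state at fixed indices of Alice and Bob; the recovery
      acts on it through its linear extension.\<close>
    define Y where "Y = mat e e (\<lambda>(s, s'). ?R (i, k, s) (i', k', s'))"
    have Y: "Y \<in> carrier_mat e e" by (simp add: Y_def)
    have VY: "V Y \<in> carrier_mat e' e'" using qV Y by (simp add: quantum_operation_def linear_map_mat_def)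
    have "?R (i, k, j) (i', k', j') = V' (V Y) $$ (j, j')"
      using that linear_map_fixing_densities[OF lin VV Y] by (simp add: Y_def)
    also have "\<dots> = (\<Sum>m\<in>M'. \<Sum>s<e'. \<Sum>s'<e'. F' m j s * V Y $$ (s, s') * cnj (F' m j' s'))"
      using kr'[OF VY] that by (simp add: kraus_def entries_def)
    also have "\<dots> = (\<Sum>m\<in>M'. \<Sum>s<e'. \<Sum>s'<e'. F' m j s * ?R' (i, k, s) (i', k', s') * cnj (F' m j' s'))"
      using that by (intro sum.cong refl) (simp add: kr[OF Y] eq kraus_def, simp add: Y_def entries_def)
    finally show ?thesis .
  qed
  note ch' = cond_entropy_channel_E[OF finite_lessThan finite_lessThan finite_lessThan finite_lessThan M' pos' trace_preserving' eq']
  have "cond_entropy {..<a} ({..<b} \<times> {..<e}) ?R \<le> cond_entropy {..<a} ({..<b} \<times> {..<e'}) ?R'" by (rule ch(1))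
  moreover have "cond_entropy {..<a} {..<e'} (trace_middle {..<b} ?R') \<le> cond_entropy {..<a} {..<e} (trace_middle {..<b} ?R)" by (rule ch'(2))
  ultimately have le: "cond_mutual_info {..<a} {..<b} {..<e'} ?R' \<le> cond_mutual_info {..<a} {..<b} {..<e} ?R" by (simp add: cond_mutual_info_def)
  show ?thesis
    by (rule I_M_step[OF bij_id bij_id bij_id bij_id bij_id bij_id \<rho> _ R' le])
      (simp add: \<sigma>_def amplify_def)
qed

section \<open>Broadcast of classical messages\<close>

lemma orthonormal_iff_ortho:
  assumes "orthonormal c n v" shows "ortho {..<c} {..<n} (\<lambda>m. vec_index (v m))"
  using assms by (auto simp: orthonormal_def ortho_def scalar_prod_ip[symmetric])

lemma ket_bra_index:
  assumes "orthonormal c n v" "m < n" "s < c" "s' < c"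
  shows "ket_bra (v m) $$ (s, s') = v m $ s * cnj (v m $ s')"
proof -
  have "dim_vec (v m) = c" using assms by (auto simp: orthonormal_def)
  then show ?thesis using assms by (simp add: ket_bra_def)
qed

lemma tensor_insert_index:
  assumes "i < l" "k < d" "j < r" "i' < l" "k' < d" "j' < r"
  shows "tensor_insert l d r K X $$ (glue d r i k j, glue d r i' k' j') = K $$ (k, k') * X $$ (i * r + j, i' * r + j')"
  using assms by (simp add: tensor_insert_def glue_less left_mid_right_glue)

lemma mixture_index:
  "x < N \<Longrightarrow> y < N \<Longrightarrow> mixture N n p X $$ (x, y) = (\<Sum>m<n. complex_of_real (p m) * X m $$ (x, y))"
  by (simp add: mixture_def)

lemma mixture_carrier: "mixture N n p X \<in> carrier_mat N N"
  by (simp add: mixture_def)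

lemma broadcast_out_A_index:
  assumes v: "orthonormal c n v" and m: "m < n"
    and lt: "i < a" "s < c" "k < b" "t < c" "j < e" "i' < a" "s' < c" "k' < b" "t' < c" "j' < e"
  shows "tensor_insert a c (b * (c * e)) (ket_bra (v m)) (tensor_insert (a * b) c e (ket_bra (v m)) X) $$
      (glue (c * b) (c * e) i (s * b + k) (t * e + j), glue (c * b) (c * e) i' (s' * b + k') (t' * e + j'))
    = (v m $ s * cnj (v m $ s')) * (v m $ t * cnj (v m $ t')) * X $$ (glue b e i k j, glue b e i' k' j')"
proof -
  \<comment> \<open>One basis number is read in two ways: \<open>g\<close> exposes Bob's register
    for the outer insertion, and \<open>h\<close> exposes Eve's register for the inner one.\<close>
  have g: "glue (c * b) (c * e) i (s * b + k) (t * e + j) = glue c (b * (c * e)) i s (k * (c * e) + (t * e + j))" for i s k t j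
    by (simp add: glue_def algebra_simps)
  have h: "i * (b * (c * e)) + (k * (c * e) + (t * e + j)) = glue c e (i * b + k) t j" for i k t j
    by (simp add: glue_def algebra_simps)
  have f: "(i * b + k) * e + j = glue b e i k j" for i k j by (simp add: glue_def)
  show ?thesis
    unfolding g using lt
    by (simp add: tensor_insert_index pair_index_less h f ket_bra_index[OF v m])
qed

lemma broadcast_out_B_index:
  assumes v: "orthonormal c n v" and m: "m < n"
    and lt: "i < a" "s < c" "k < b" "t < c" "j < e" "i' < a" "s' < c" "k' < b" "t' < c" "j' < e"
  shows "tensor_insert 1 c (a * b * (c * e)) (ket_bra (v m)) (tensor_insert (a * b) c e (ket_bra (v m)) X) $$
      (glue b (c * e) (s * a + i) k (t * e + j), glue b (c * e) (s' * a + i') k' (t' * e + j'))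
    = (v m $ s * cnj (v m $ s')) * (v m $ t * cnj (v m $ t')) * X $$ (glue b e i k j, glue b e i' k' j')"
proof -
  have g: "glue b (c * e) (s * a + i) k (t * e + j) = glue c (a * b * (c * e)) 0 s ((i * b + k) * (c * e) + (t * e + j))" for i s k t j
    by (simp add: glue_def algebra_simps)
  have h: "0 * (a * b * (c * e)) + ((i * b + k) * (c * e) + (t * e + j)) = glue c e (i * b + k) t j" for i k t j
    by (simp add: glue_def algebra_simps)
  have f: "(i * b + k) * e + j = glue b e i k j" for i k j by (simp add: glue_def)
  have l: "(i * b + k) * (c * e) + (t * e + j) < a * b * (c * e)" if "i < a" "k < b" "t < c" "j < e" for i k t j
    using that by (simp add: pair_index_less)
  note lt' = l[OF lt(1,3,4,5)] l[OF lt(6,8,9,10)]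
  have z: "(0 :: nat) < 1" by simp
  show ?thesis
    unfolding g tensor_insert_index[OF z lt(2) lt'(1) z lt(7) lt'(2)] h
    using lt by (simp add: tensor_insert_index pair_index_less f ket_bra_index[OF v m])
qed

lemma broadcast_in_A_index:
  assumes v: "orthonormal c n v" and m: "m < n"
    and lt: "i < a" "s < c" "k < b" "j < e" "i' < a" "s' < c" "k' < b" "j' < e"
  shows "tensor_insert 1 c (a * b * e) (ket_bra (v m)) X $$
      (glue b e (s * a + i) k j, glue b e (s' * a + i') k' j')
    = (v m $ s * cnj (v m $ s')) * X $$ (glue b e i k j, glue b e i' k' j')"
proof -
  have g: "glue b e (s * a + i) k j = glue c (a * b * e) 0 s (glue b e i k j)" for i s k j
    by (simp add: glue_def algebra_simps)
  have z: "(0 :: nat) < 1" by simp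
  show ?thesis
    unfolding g tensor_insert_index[OF z lt(2) glue_less[OF lt(1,3,4)] z lt(6) glue_less[OF lt(5,7,8)]]
    using lt by (simp add: ket_bra_index[OF v m])
qed

lemma broadcast_in_B_index:
  assumes v: "orthonormal c n v" and m: "m < n"
    and lt: "i < a" "s < c" "k < b" "j < e" "i' < a" "s' < c" "k' < b" "j' < e"
  shows "tensor_insert a c (b * e) (ket_bra (v m)) X $$
      (glue (c * b) e i (s * b + k) j, glue (c * b) e i' (s' * b + k') j')
    = (v m $ s * cnj (v m $ s')) * X $$ (glue b e i k j, glue b e i' k' j')"
proof -
  have g: "glue (c * b) e i (s * b + k) j = glue c (b * e) i s (k * e + j)" for i s k j
    by (simp add: glue_def algebra_simps)
  have h: "i * (b * e) + (k * e + j) = glue b e i k j" for i k j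
    by (simp add: glue_def algebra_simps)
  show ?thesis
    unfolding g using lt by (simp add: tensor_insert_index pair_index_less h ket_bra_index[OF v m])
qed

lemma I_M_public_B:
  assumes v: "orthonormal c n v" and \<rho>\<sigma>: "(\<rho>, \<sigma>) \<in> broadcast_B c n v (a, b, e)"
    and \<rho>: "\<rho> \<in> states (a, c * b, e)"
  shows "\<sigma> \<in> states (c * a, b, c * e) \<and> I_M (c * a, b, c * e) \<sigma> \<le> I_M (a, c * b, e) \<rho>"
proof -
  obtain p r where ens: "ensemble (a * b * e) n p r"
    and \<rho>_eq: "\<rho> = mixture (a * (c * b) * e) n p (\<lambda>m. tensor_insert a c (b * e) (ket_bra (v m)) (r m))"
    and \<sigma>_eq: "\<sigma> = mixture (c * a * b * (c * e)) n p (\<lambda>m.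
         tensor_insert 1 c (a * b * (c * e)) (ket_bra (v m)) (tensor_insert (a * b) c e (ket_bra (v m)) (r m)))"
    using \<rho>\<sigma> by auto
  have p: "\<And>m. m \<in> {..<n} \<Longrightarrow> 0 \<le> p m" "(\<Sum>m<n. p m) = 1" and r: "\<And>m. m < n \<Longrightarrow> r m \<in> states (a, b, e)"
    using ens by (auto simp: ensemble_def)
  let ?R = "entries (enc (c * b) e id (glue2 b) id) \<rho>"
  let ?R' = "entries (enc b (c * e) (glue2 a) id (glue2 e)) \<sigma>"
  let ?r = "\<lambda>m. entries (enc b e id id id) (r m)"
  have st: "state (tri a b e) (?r m)" if "m \<in> {..<n}" for m
    using r that states_enc(1)[OF bij_id bij_id bij_id] by blast
  have R: "?R (i, (s, k), j) (i', (s', k'), j') =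
      (\<Sum>m<n. complex_of_real (p m) * (v m $ s * cnj (v m $ s')) * ?r m (i, k, j) (i', k', j'))"
    if "i \<in> {..<a}" "s \<in> {..<c}" "k \<in> {..<b}" "j \<in> {..<e}" "i' \<in> {..<a}" "s' \<in> {..<c}" "k' \<in> {..<b}" "j' \<in> {..<e}"
    for i s k j i' s' k' j'
    using that unfolding \<rho>_eq
    by (simp add: entries_def enc_def glue2_def mixture_index glue_less pair_index_less
        broadcast_in_B_index[OF v] mult.assoc[of "complex_of_real _"])
  have R': "?R' ((s, i), k, t, j) ((s', i'), k', t', j') =
      (\<Sum>m<n. complex_of_real (p m) * (v m $ s * cnj (v m $ s')) * (v m $ t * cnj (v m $ t')) * ?r m (i, k, j) (i', k', j'))"
    if "s \<in> {..<c}" "i \<in> {..<a}" "k \<in> {..<b}" "t \<in> {..<c}" "j \<in> {..<e}"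
      "s' \<in> {..<c}" "i' \<in> {..<a}" "k' \<in> {..<b}" "t' \<in> {..<c}" "j' \<in> {..<e}"
    for s i k t j s' i' k' t' j'
    using that unfolding \<sigma>_eq
    by (simp add: entries_def enc_def glue2_def mixture_index glue_less pair_index_less
        broadcast_out_B_index[OF v] mult.assoc[of "complex_of_real _"] del: One_nat_def)
  note bc = cond_mutual_info_broadcast[OF finite_lessThan finite_lessThan finite_lessThan finite_lessThan finite_lessThan
      orthonormal_iff_ortho[OF v] p(1) st R R']
  have st': "state (({..<c} \<times> {..<a}) \<times> {..<b} \<times> {..<c} \<times> {..<e}) ?R'"
    by (rule bc(2), (assumption | rule p(2))+)
  have le: "cond_mutual_info ({..<c} \<times> {..<a}) {..<b} ({..<c} \<times> {..<e}) ?R' \<le> cond_mutual_info {..<a} ({..<c} \<times> {..<b}) {..<e} ?R"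
    by (rule bc(1))
  show ?thesis
    by (rule I_M_step[OF bij_id bij_glue2 bij_id bij_glue2 bij_id bij_glue2 \<rho> _ st' le])
      (simp add: \<sigma>_eq mixture_carrier)
qed

lemma I_M_public_A:
  assumes v: "orthonormal c n v" and \<rho>\<sigma>: "(\<rho>, \<sigma>) \<in> broadcast_A c n v (a, b, e)"
    and \<rho>: "\<rho> \<in> states (c * a, b, e)"
  shows "\<sigma> \<in> states (a, c * b, c * e) \<and> I_M (a, c * b, c * e) \<sigma> \<le> I_M (c * a, b, e) \<rho>"
proof -
  obtain p r where ens: "ensemble (a * b * e) n p r"
    and \<rho>_eq: "\<rho> = mixture (c * a * b * e) n p (\<lambda>m. tensor_insert 1 c (a * b * e) (ket_bra (v m)) (r m))"
    and \<sigma>_eq: "\<sigma> = mixture (a * (c * b) * (c * e)) n p (\<lambda>m.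
         tensor_insert a c (b * (c * e)) (ket_bra (v m)) (tensor_insert (a * b) c e (ket_bra (v m)) (r m)))"
    using \<rho>\<sigma> by auto
  have p: "\<And>m. m \<in> {..<n} \<Longrightarrow> 0 \<le> p m" "(\<Sum>m<n. p m) = 1" and r: "\<And>m. m < n \<Longrightarrow> r m \<in> states (a, b, e)"
    using ens by (auto simp: ensemble_def)
  let ?R = "entries (enc b e (glue2 a) id id) \<rho>"
  let ?R' = "entries (enc (c * b) (c * e) id (glue2 b) (glue2 e)) \<sigma>"
  \<comment> \<open>The parties are exchanged throughout, since
    \<open>cond_mutual_info_broadcast\<close> has the second party as sender.\<close>
  let ?r = "\<lambda>m. swap_parties (entries (enc b e id id id) (r m))"
  have st: "state (tri b a e) (?r m)" if "m \<in> {..<n}" for m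
    unfolding state_swap_parties using r that states_enc(1)[OF bij_id bij_id bij_id] by blast
  have R: "swap_parties ?R (k, (s, i), j) (k', (s', i'), j') =
      (\<Sum>m<n. complex_of_real (p m) * (v m $ s * cnj (v m $ s')) * ?r m (k, i, j) (k', i', j'))"
    if "k \<in> {..<b}" "s \<in> {..<c}" "i \<in> {..<a}" "j \<in> {..<e}" "k' \<in> {..<b}" "s' \<in> {..<c}" "i' \<in> {..<a}" "j' \<in> {..<e}"
    for k s i j k' s' i' j'
    using that unfolding \<rho>_eq
    by (simp add: entries_def enc_def glue2_def mixture_index glue_less pair_index_less
        broadcast_in_A_index[OF v] mult.assoc[of "complex_of_real _"] del: One_nat_def)
  have R': "swap_parties ?R' ((s, k), i, t, j) ((s', k'), i', t', j') =
      (\<Sum>m<n. complex_of_real (p m) * (v m $ s * cnj (v m $ s')) * (v m $ t * cnj (v m $ t')) * ?r m (k, i, j) (k', i', j'))"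
    if "s \<in> {..<c}" "k \<in> {..<b}" "i \<in> {..<a}" "t \<in> {..<c}" "j \<in> {..<e}"
      "s' \<in> {..<c}" "k' \<in> {..<b}" "i' \<in> {..<a}" "t' \<in> {..<c}" "j' \<in> {..<e}"
    for s k i t j s' k' i' t' j'
    using that unfolding \<sigma>_eq
    by (simp add: entries_def enc_def glue2_def mixture_index glue_less pair_index_less
        broadcast_out_A_index[OF v] mult.assoc[of "complex_of_real _"])
  note bc = cond_mutual_info_broadcast[OF finite_lessThan finite_lessThan finite_lessThan finite_lessThan finite_lessThan
      orthonormal_iff_ortho[OF v] p(1) st R R']
  have stR: "state (({..<c} \<times> {..<a}) \<times> {..<b} \<times> {..<e}) ?R"
    using \<rho> states_enc(1)[OF bij_glue2 bij_id bij_id] by blast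
  have "state (({..<c} \<times> {..<b}) \<times> {..<a} \<times> {..<c} \<times> {..<e}) (swap_parties ?R')"
    by (rule bc(2), (assumption | rule p(2))+)
  then have stR': "state ({..<a} \<times> ({..<c} \<times> {..<b}) \<times> {..<c} \<times> {..<e}) ?R'"
    by (simp only: state_swap_parties)
  have "cond_mutual_info ({..<c} \<times> {..<b}) {..<a} ({..<c} \<times> {..<e}) (swap_parties ?R') \<le> cond_mutual_info {..<b} ({..<c} \<times> {..<a}) {..<e} (swap_parties ?R)"
    by (rule bc(1))
  then have le: "cond_mutual_info {..<a} ({..<c} \<times> {..<b}) ({..<c} \<times> {..<e}) ?R' \<le> cond_mutual_info ({..<c} \<times> {..<a}) {..<b} {..<e} ?R"
    using cond_mutual_info_swap[OF _ _ _ stR] cond_mutual_info_swap[OF _ _ _ stR'] by simp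
  show ?thesis
    by (rule I_M_step[OF bij_glue2 bij_id bij_id bij_id bij_glue2 bij_glue2 \<rho> _ stR' le])
      (simp add: \<sigma>_eq mixture_carrier)
qed

section \<open>Quantum communication to Eve\<close>

lemma I_M_send_B:
  assumes \<rho>: "\<rho> \<in> states (a, b * q, e)"
  shows "\<rho> \<in> states (a, b, q * e) \<and> I_M (a, b, q * e) \<rho> \<le> I_M (a, b * q, e) \<rho>"
proof -
  let ?R = "entries (enc (b * q) e id (glue2 q) id) \<rho>"
  let ?R' = "entries (enc b (q * e) id id (glue2 e)) \<rho>"
  have c: "\<rho> \<in> carrier_mat (a * b * (q * e)) (a * b * (q * e))"
    using \<rho> by (simp add: density_def psd_def mult.assoc)
  have st: "state ({..<a} \<times> {..<b} \<times> {..<q} \<times> {..<e}) ?R'"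
    using \<rho> states_enc(1)[OF bij_id bij_id bij_glue2] by (simp add: mult.assoc)
  then have pos: "pos ({..<a} \<times> {..<b} \<times> {..<q} \<times> {..<e}) ?R'" by (simp add: state_def)
  \<comment> \<open>Both groupings number the basis identically, so the matrix is the same and only
    the assignment of \<open>Q\<close> to a party changes.\<close>
  have "(\<lambda>(a, (b, q), e) (a', (b', q'), e'). ?R' (a, b, q, e) (a', b', q', e')) = ?R"
    by (auto simp: fun_eq_iff entries_def enc_def glue2_def glue_def algebra_simps)
  then have le: "cond_mutual_info {..<a} {..<b} ({..<q} \<times> {..<e}) ?R' \<le> cond_mutual_info {..<a} ({..<b} \<times> {..<q}) {..<e} ?R"
    using cond_mutual_info_send[OF _ _ _ _ pos] by simp
  show ?thesis by (rule I_M_step[OF bij_id bij_glue2 bij_id bij_id bij_id bij_glue2 \<rho> c st le])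
qed

lemma swap_ix_glue:
  assumes "k < b" "t < q" "j < e"
  shows "swap_ix q b e (glue b (q * e) i k (t * e + j)) = glue b e (i * q + t) k j"
proof -
  let ?x = "glue b (q * e) i k (t * e + j)"
  have tj: "t * e + j < q * e" using assms by (simp add: pair_index_less)
  have dm: "(y * r + x) div r = y" "(y * r + x) mod r = x" if "x < r" for x y r :: nat
    using that by simp_all
  have 1: "?x div (q * e) = i * b + k" "?x mod (q * e) = t * e + j" 
    by (simp_all only: glue_def dm[OF tj])
  have "?x div (b * q * e) = ?x div (q * e) div b"
    by (simp add: div_mult2_eq[symmetric] mult_ac)
  then have 2: "?x div (b * q * e) = i" using assms by (simp add: 1)
  have x: "?x = ((i * b + k) * q + t) * e + j" by (simp add: glue_def algebra_simps)
  have 3: "?x div e mod q = t" "?x mod e = j" unfolding x using assms by simp_all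
  show ?thesis unfolding swap_ix_def Let_def 1 2 3 using assms by (simp add: glue_def)
qed

text \<open>The reordering brings \<open>Q\<close> next to \<open>E\<close>; with the parties
  exchanged, the situation is that of the second party sending.\<close>

lemma I_M_send_A:
  assumes \<rho>: "\<rho> \<in> states (a * q, b, e)"
  defines "\<sigma> \<equiv> move_past a q b e \<rho>"
  shows "\<sigma> \<in> states (a, b, q * e) \<and> I_M (a, b, q * e) \<sigma> \<le> I_M (a * q, b, e) \<rho>"
proof -
  let ?R = "entries (enc b e (glue2 q) id id) \<rho>"
  let ?R' = "entries (enc b (q * e) id id (glue2 e)) \<sigma>"
  have stR: "state (({..<a} \<times> {..<q}) \<times> {..<b} \<times> {..<e}) ?R"
    using \<rho> states_enc(1)[OF bij_glue2 bij_id bij_id] by blast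
  have eq: "?R' (i, k, t, j) (i', k', t', j') = ?R ((i, t), k, j) ((i', t'), k', j')"
    if "i < a" "k < b" "t < q" "j < e" "i' < a" "k' < b" "t' < q" "j' < e" for i k t j i' k' t' j'
    using that by (simp add: entries_def enc_def glue2_def \<sigma>_def move_past_def glue_less pair_index_less swap_ix_glue)
  have f: "bij_betw (\<lambda>(i, k, t, j). ((i, t), k, j)) ({..<a} \<times> {..<b} \<times> {..<q} \<times> {..<e}) (({..<a} \<times> {..<q}) \<times> {..<b} \<times> {..<e})"
    by (rule bij_betw_inverse[where g = "\<lambda>((i, t), k, j). (i, k, t, j)"]) auto
  have eq': "?R' x y = ?R (case x of (i, k, t, j) \<Rightarrow> ((i, t), k, j)) (case y of (i, k, t, j) \<Rightarrow> ((i, t), k, j))"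
    if "x \<in> {..<a} \<times> {..<b} \<times> {..<q} \<times> {..<e}" "y \<in> {..<a} \<times> {..<b} \<times> {..<q} \<times> {..<e}" for x y
    using that eq by auto
  have stR': "state ({..<a} \<times> {..<b} \<times> {..<q} \<times> {..<e}) ?R'"
    unfolding state_def
  proof
    show "pos ({..<a} \<times> {..<b} \<times> {..<q} \<times> {..<e}) ?R'"
      by (rule pos_cong[OF eq', THEN iffD2], assumption+) (rule pos_reindex[OF f stR[unfolded state_def, THEN conjunct1]])
    have "(\<Sum>x\<in>{..<a} \<times> {..<b} \<times> {..<q} \<times> {..<e}. ?R' x x) = (\<Sum>x\<in>({..<a} \<times> {..<q}) \<times> {..<b} \<times> {..<e}. ?R x x)"
      using sum.reindex_bij_betw[OF f, of "\<lambda>x. ?R x x"] eq' by simp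
    then show "(\<Sum>x\<in>{..<a} \<times> {..<b} \<times> {..<q} \<times> {..<e}. ?R' x x) = 1" using stR by (simp add: state_def)
  qed
  have "state ({..<b} \<times> {..<a} \<times> {..<q} \<times> {..<e}) (swap_parties ?R')" using stR' by (simp only: state_swap_parties)
  then have pos: "pos ({..<b} \<times> {..<a} \<times> {..<q} \<times> {..<e}) (swap_parties ?R')" by (simp add: state_def)
  have "cond_mutual_info {..<b} ({..<a} \<times> {..<q}) {..<e} (\<lambda>(a, (b, q), e) (a', (b', q'), e'). swap_parties ?R' (a, b, q, e) (a', b', q', e'))
      = cond_mutual_info {..<b} ({..<a} \<times> {..<q}) {..<e} (swap_parties ?R)"
    by (rule cond_mutual_info_cong) (auto simp: eq)
  then have "cond_mutual_info {..<b} {..<a} ({..<q} \<times> {..<e}) (swap_parties ?R') \<le> cond_mutual_info {..<b} ({..<a} \<times> {..<q}) {..<e} (swap_parties ?R)"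
    using cond_mutual_info_send[OF _ _ _ _ pos] by simp
  then have le: "cond_mutual_info {..<a} {..<b} ({..<q} \<times> {..<e}) ?R' \<le> cond_mutual_info ({..<a} \<times> {..<q}) {..<b} {..<e} ?R"
    using cond_mutual_info_swap[OF _ _ _ stR] cond_mutual_info_swap[OF _ _ _ stR'] by simp
  show ?thesis
    by (rule I_M_step[OF bij_glue2 bij_id bij_id bij_id bij_id bij_glue2 \<rho> _ stR' le])
      (simp add: \<sigma>_def move_past_def)
qed

text \<open>Membership of the output in the state space is carried through the induction because a
  composition requires the inequality at the intermediate state as well.\<close>

lemma Omega_mono:
  assumes "Omega D D' F" "(\<rho>, \<sigma>) \<in> F" "\<rho> \<in> states D"
  shows "\<sigma> \<in> states D' \<and> I_M D' \<sigma> \<le> I_M D \<rho>"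
  using assms
proof (induction arbitrary: \<rho> \<sigma> rule: Omega.induct)
  case (local_A a a' \<Phi> b e)
  then show ?case using I_M_local_A[OF local_A(1)] unfolding on_states_def by blast
next
  case (local_B b b' \<Phi> a e)
  then show ?case using I_M_local_B[OF local_B(1)] unfolding on_states_def by blast
next
  case (reversible_E e e' V a b)
  then show ?case using I_M_reversible_E[OF reversible_E(1)] unfolding on_states_def by blast
next
  case (public_A c n v a b e)
  then show ?case using I_M_public_A by blast
next
  case (public_B c n v a b e)
  then show ?case using I_M_public_B by blast
next
  case (send_A a q b e)
  then show ?case using I_M_send_A unfolding on_states_def by blast
next
  case (send_B a b q e)
  then show ?case using I_M_send_B unfolding on_states_def by blast
next
  case (compose D D' F D'' G)
  from compose.prems(1) obtain \<tau> where \<tau>: "(\<rho>, \<tau>) \<in> F" "(\<tau>, \<sigma>) \<in> G" by blast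
  then have "\<tau> \<in> states D'" "I_M D' \<tau> \<le> I_M D \<rho>" using compose.IH(1) compose.prems(2) by blast+
  then show ?case using compose.IH(2)[OF \<tau>(2)] by fastforce
qed

theorem lemma2:
  fixes D D' :: dims and \<E> :: operation and \<rho> \<sigma> :: "complex mat"
  assumes "\<rho> \<in> states D"
    and "Omega D D' \<E>"
    and "(\<rho>, \<sigma>) \<in> \<E>"
  shows "I_M D \<rho> \<ge> I_M D' \<sigma>"
  using Omega_mono[OF assms(2,3,1)] by simp

end
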